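(* Let $\delta\in(0,1)$, $\sigma>0$, $P\in\mathcal{P}(\mathbb{R}^d)$, and let $(X_t)_{t\ge1}$ be i.i.d. from $P$ with empirical measure $P_t=\frac1t\sum_{i=1}^t\delta_{X_i}$. Let $\ell:[0,\infty)\to[1,\infty)$ satisfy $\sum_{j=1}^\infty1/\ell(j)\le1$, $\ell(x)=\ell(1)$ for all $x\in[0,1]$, and $u\mapsto2^{-u}\log\ell(u)$ decreasing (not necessarily strictly) on $[1,\infty)$. (i) (Total variation distance) Assume $P$ is $\tau^2$-sub-Gaussian for some $\tau>0$. Then $$\mathbb{P}\left(\exists t\ge1:\|P_t-P\|^\sigma_{\mathrm{TV}}\ge\frac{c_d}{\sqrt t}+4\sqrt{\frac2t\Big[\log\ell(\log_2t)+\log(1/\delta)\Big]}\right)\le\delta,$$ where $c_d=\sqrt2\left(\frac1{\sqrt2}+\frac\tau\sigma\right)^{d/2}e^{3d/16}$. (ii) ($W_1$ distance) Assume $P$ satisfies the $T_1(\tau^2)$ inequality with respect to $\|\cdot\|_2$, for some $\tau>0$. Then $W_1^\sigma(P_t,P)$ is $(\tau^2/t)$-sub-Gaussian, and for all $\delta\in(0,1)$, $$\mathbb{P}\left(\exists t\ge1:W_1^\sigma(P_t,P)\ge\frac{C_d}{\sqrt t}+2\sqrt{\frac{\tau^2}{t}\Big[\log\ell(\log_2t)+\log(1/\delta)\Big]}\right)\le\delta,$$ where $C_d=2\sqrt{d\sigma^2}\left(\frac1{\sqrt2}+\frac\tau\sigma\right)c_d$ (with $c_d$ as in the formula of part (i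)).
   Context: $\mathcal{K}_\sigma$ is the Gaussian probability measure $N(0,\sigma^2I_d)$ on $\mathbb{R}^d$, and $\star$ denotes convolution of measures. $\|\mu-\nu\|_{\mathrm{TV}}=\sup_A|\mu(A)-\nu(A)|$ (supremum over Borel sets) and $\|\mu-\nu\|_{\mathrm{TV}}^\sigma=\|\mu\star\mathcal{K}_\sigma-\nu\star\mathcal{K}_\sigma\|_{\mathrm{TV}}$. $W_1$ is the 1-Wasserstein distance with respect to $\|\cdot\|_2$ on $\mathbb{R}^d$, $W_1(\mu,\nu)=\inf_{\pi}\int\|x-y\|_2\,d\pi(x,y)$ over couplings $\pi$ of $\mu,\nu$, and $W_1^\sigma(\mu,\nu)=W_1(\mu\star\mathcal{K}_\sigma,\nu\star\mathcal{K}_\sigma)$. An $\mathbb{R}^m$-valued random variable $Y$ (or its law) is $s^2$-sub-Gaussian if $\mathbb{E}\exp(\lambda^\top(Y-\mathbb{E}Y))\le\exp(\|\lambda\|_2^2s^2/2)$ for all $\lambda\in\mathbb{R}^m$. Let $\mathcal{P}_1(\mathbb{R}^d)$ be the set of Borel probability measures on $\mathbb{R}^d$ with finite first moment. $P\in\mathcal{P}_1(\mathbb{R}^d)$ satisfies $T_1(\tau^2)$ with respect to $\|\cdot\|_2$ if $W_1(\mu,P)\le\sqrt{2\tau^2\,\mathrm{KL}(\mu\|P)}$ for all $\mu\in\mathcal{P}_1(\mathbb{R}^d)$, where $\mathrm{KL}$ is the Kullback–Leibler divergence ($+\infty$ if $\mu\not\ll P$). *)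

theory Defs
  imports "HOL-Probability.Probability"
begin

definition gaussian :: "real \<Rightarrow> (real ^ 'd) measure" where
  "gaussian \<sigma> = density lborel
     (\<lambda>x. ennreal (exp (- (norm x)\<^sup>2 / (2 * \<sigma>\<^sup>2)) / sqrt (2 * pi * \<sigma>\<^sup>2) ^ CARD('d)))"

definition smooth :: "real \<Rightarrow> (real ^ 'd) measure \<Rightarrow> (real ^ 'd) measure" where
  "smooth \<sigma> \<mu> = convolution \<mu> (gaussian \<sigma>)"

(* The supremum is taken over a bounded set of reals as soon as both measures are finite. *)
definition tv_dist :: "'a::topological_space measure \<Rightarrow> 'a measure \<Rightarrow> real" where
  "tv_dist \<mu> \<nu> = (SUP A\<in>sets borel. \<bar>measure \<mu> A - measure \<nu> A\<bar>)"

definition tv_smooth :: "real \<Rightarrow> (real ^ 'd) measure \<Rightarrow> (real ^ 'd) measure \<Rightarrow> real" where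
  "tv_smooth \<sigma> \<mu> \<nu> = tv_dist (smooth \<sigma> \<mu>) (smooth \<sigma> \<nu>)"

definition couplings :: "'a::topological_space measure \<Rightarrow> 'a measure \<Rightarrow> ('a \<times> 'a) measure set" where
  "couplings \<mu> \<nu> = {\<pi>. sets \<pi> = sets (borel \<Otimes>\<^sub>M borel) \<and>
                      distr \<pi> borel fst = \<mu> \<and> distr \<pi> borel snd = \<nu>}"

(* Extended-valued, so that an infinite transport cost is not confused with 0. *)
definition W1 :: "'a::real_normed_vector measure \<Rightarrow> 'a measure \<Rightarrow> ennreal" where
  "W1 \<mu> \<nu> = (INF \<pi>\<in>couplings \<mu> \<nu>. \<integral>\<^sup>+(x, y). ennreal (norm (x - y)) \<partial>\<pi>)"

definition W1_smooth :: "real \<Rightarrow> (real ^ 'd) measure \<Rightarrow> (real ^ 'd) measure \<Rightarrow> ennreal" where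
  "W1_smooth \<sigma> \<mu> \<nu> = W1 (smooth \<sigma> \<mu>) (smooth \<sigma> \<nu>)"

(* Integrability of Y makes the Bochner integral below the genuine mean of Y; the moment
   generating function is a nonnegative integral, so the bound forces it to be finite. *)
definition sub_gaussian :: "'a measure \<Rightarrow> ('a \<Rightarrow> 'b::euclidean_space) \<Rightarrow> real \<Rightarrow> bool" where
  "sub_gaussian M Y v \<longleftrightarrow> integrable M Y \<and>
     (\<forall>u. (\<integral>\<^sup>+\<omega>. ennreal (exp (u \<bullet> (Y \<omega> - (LINT \<omega>'|M. Y \<omega>')))) \<partial>M)
            \<le> ennreal (exp ((norm u)\<^sup>2 * v / 2)))"

definition P1 :: "'a::real_normed_vector measure set" where
  "P1 = {\<mu>. prob_space \<mu> \<and> sets \<mu> = sets borel \<and> integrable \<mu> (\<lambda>x. norm x)}"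

(* For probability measures the negative part of the log-density is always integrable under \<mu>,
   so for absolutely continuous \<mu> non-integrability means that the divergence is infinite.
   The library's KL_divergence is real-valued and has its arguments in the order (base, P, \<mu>). *)
definition kl_div :: "'a measure \<Rightarrow> 'a measure \<Rightarrow> ereal" where
  "kl_div \<mu> P = (if absolutely_continuous P \<mu> \<and> integrable \<mu> (entropy_density (exp 1) P \<mu>)
                 then ereal (KL_divergence (exp 1) P \<mu>) else \<infinity>)"

(* The inequality W1 \<mu> P \<le> sqrt (2 * v * KL) is void when the divergence is infinite. *)
definition T1 :: "'a::real_normed_vector measure \<Rightarrow> real \<Rightarrow> bool" where
  "T1 P v \<longleftrightarrow> P \<in> P1 \<and>
     (\<forall>\<mu>\<in>P1. kl_div \<mu> P < \<infinity> \<longrightarrow> W1 \<mu> P \<le> ennreal (sqrt (2 * v * real_of_ereal (kl_div \<mu> P))))"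

definition empirical :: "(nat \<Rightarrow> 'a::topological_space) \<Rightarrow> nat \<Rightarrow> 'a measure" where
  "empirical x t = measure_of UNIV (sets borel)
     (\<lambda>A. (\<Sum>i=1..t. emeasure (return borel (x i)) A) / of_nat t)"

lemma sets_empirical [simp]: "sets (empirical x t) = sets borel"
  unfolding empirical_def
  by (metis sets.sigma_sets_eq sets_measure_of space_borel sets.space_closed)

lemma emeasure_empirical:
  assumes "A \<in> sets borel"
  shows "emeasure (empirical x t) A = (\<Sum>i=1..t. indicator A (x i)) / of_nat t"
proof -
  let ?f = "\<lambda>A. (\<Sum>i=1..t. emeasure (return borel (x i)) A) / of_nat t"
  have "countably_additive (sets borel) ?f"
  proof (rule countably_additiveI)
    fix A :: "nat \<Rightarrow> 'a set"
    assume A: "range A \<subseteq> sets borel" "disjoint_family A" "(\<Union>i. A i) \<in> sets borel"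
    have "(\<Sum>n. ?f (A n)) = (\<Sum>n. \<Sum>i=1..t. emeasure (return borel (x i)) (A n)) / of_nat t"
      by (simp add: divide_ennreal_def)
    also have "(\<Sum>n. \<Sum>i=1..t. emeasure (return borel (x i)) (A n))
        = (\<Sum>i=1..t. \<Sum>n. emeasure (return borel (x i)) (A n))"
      by (rule suminf_sum) simp
    also have "\<dots> = (\<Sum>i=1..t. emeasure (return borel (x i)) (\<Union>n. A n))"
      using A by (intro sum.cong refl suminf_emeasure) simp_all
    finally show "(\<Sum>n. ?f (A n)) = ?f (\<Union>n. A n)" .
  qed
  moreover have "positive (sets borel) ?f"
    by (simp add: positive_def)
  ultimately have "emeasure (empirical x t) A = ?f A"
    using assms sets.sigma_algebra_axioms[of "borel :: 'a measure"]
    by (intro emeasure_measure_of_sigma[of UNIV "sets borel" ?f A, folded empirical_def]) simp_all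
  with assms show ?thesis
    by (simp add: emeasure_return)
qed

definition c_const :: "nat \<Rightarrow> real \<Rightarrow> real \<Rightarrow> real" where
  "c_const d \<tau> \<sigma> = sqrt 2 * (1 / sqrt 2 + \<tau> / \<sigma>) powr (real d / 2) * exp (3 * real d / 16)"

definition C_const :: "nat \<Rightarrow> real \<Rightarrow> real \<Rightarrow> real" where
  "C_const d \<tau> \<sigma> = 2 * sqrt (real d * \<sigma>\<^sup>2) * (1 / sqrt 2 + \<tau> / \<sigma>) * c_const d \<tau> \<sigma>"

end

theory Submission
  imports Defs
begin

text \<open>
  Both distances are convex in the empirical measure, so along the sample they satisfy a leave-one-out
  inequality and \<open>exp (\<lambda> D\<^sub>t)\<close> is a reverse submartingale for the exchangeable filtration. A maximal
  inequality on each dyadic epoch \<open>2\<^sup>j \<le> t < 2\<^sup>j\<^sup>+\<^sup>1\<close> together with sub-Gaussianity of \<open>D\<close> at the left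
  endpoint costs \<open>\<delta> / \<ell>(j + 1)\<close>, and these terms sum to at most \<open>\<delta>\<close>.

  Sub-Gaussianity follows by integrating out one coordinate at a time from Hoeffding's lemma (total
  variation) or from the transport inequality applied to Lipschitz functions (\<open>W\<^sub>1\<close>). The mean is bounded by
  the variance of the smoothed empirical density, weighted by the inverse of a Gaussian density of
  variance \<open>2\<tau>\<^sup>2 + \<sigma>\<^sup>2\<close>.
\<close>

subsection \<open>Sub-Gaussian variables and product measures\<close>

text \<open>No conditional expectation is ever formed. A transposition of two coordinates preserves
  the product measure, so the reverse submartingale property is only tested on events that such
  transpositions leave fixed, and this is all that the maximal inequality asks for.

  The constants are dictated by the epochs. On an epoch the threshold is frozen and the statistic is
  evaluated at the left endpoint \<open>n = 2 ^ j\<close>, although the claim concerns every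
  \<open>t\<close> up to \<open>2 * n\<close>. For the mean this costs the \<open>sqrt 2\<close> in
  \<open>c_const\<close>. For the deviation it costs the 2 in front of the square root, which turns
  the Chernoff exponent into \<open>ln (l (real (Suc j))) + ln (1 / \<delta>)\<close> without any
  loss.

  The distances are suprema or infima over uncountable families, so even measurability in the sample
  needs an argument. Total variation becomes an integral over densities. For the transport distance
  it follows from Lipschitz continuity in the sample points, and the same estimate gives the
  concentration.\<close>

lemma sub_gaussian_mono:
  assumes "sub_gaussian M Y v" "v \<le> w"
  shows "sub_gaussian M Y w"
proof -
  have "exp ((norm u)\<^sup>2 * v / 2) \<le> exp ((norm u)\<^sup>2 * w / 2)" for u :: 'b
    using assms(2) by (simp add: mult_left_mono)
  then show ?thesis
    using assms(1) unfolding sub_gaussian_def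
    by (auto intro: order_trans ennreal_leI)
qed

lemma sub_gaussian_real_iff:
  fixes Y :: "'a \<Rightarrow> real"
  shows "sub_gaussian M Y v \<longleftrightarrow> integrable M Y \<and>
     (\<forall>u. (\<integral>\<^sup>+\<omega>. ennreal (exp (u * (Y \<omega> - (LINT \<omega>'|M. Y \<omega>')))) \<partial>M) \<le> ennreal (exp (u\<^sup>2 * v / 2)))"
  by (simp add: sub_gaussian_def inner_real_def)

lemma abs_le_exp_add_exp: "\<bar>s\<bar> \<le> exp s + exp (- s)" for s :: real
  using exp_ge_add_one_self[of s] exp_ge_add_one_self[of "-s"] exp_gt_zero[of s] exp_gt_zero[of "-s"]
  by linarith

lemma sub_gaussian_nn_integral_abs:
  fixes Y :: "'a \<Rightarrow> real"
  assumes "sub_gaussian M Y v"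
  shows "(\<integral>\<^sup>+\<omega>. ennreal \<bar>Y \<omega> - (LINT \<omega>'|M. Y \<omega>')\<bar> \<partial>M) \<le> ennreal (2 * exp (v / 2))"
proof -
  let ?m = "LINT \<omega>'|M. Y \<omega>'"
  have [measurable]: "Y \<in> borel_measurable M"
    using assms by (auto simp: sub_gaussian_def)
  have "(\<integral>\<^sup>+\<omega>. ennreal \<bar>Y \<omega> - ?m\<bar> \<partial>M)
      \<le> (\<integral>\<^sup>+\<omega>. ennreal (exp (1 * (Y \<omega> - ?m))) + ennreal (exp ((-1) * (Y \<omega> - ?m))) \<partial>M)"
    using abs_le_exp_add_exp[of "Y _ - ?m"] by (intro nn_integral_mono) (simp flip: ennreal_plus)
  also have "\<dots> = (\<integral>\<^sup>+\<omega>. ennreal (exp (1 * (Y \<omega> - ?m))) \<partial>M) + (\<integral>\<^sup>+\<omega>. ennreal (exp ((-1) * (Y \<omega> - ?m))) \<partial>M)"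
    by (intro nn_integral_add) auto
  also have "\<dots> \<le> ennreal (exp (1\<^sup>2 * v / 2)) + ennreal (exp ((-1)\<^sup>2 * v / 2))"
    using assms unfolding sub_gaussian_real_iff by (intro add_mono) blast+
  also have "\<dots> = ennreal (2 * exp (v / 2))"
    by (simp flip: ennreal_plus)
  finally show ?thesis .
qed

text \<open>With all coordinates but one frozen, the function is sub-Gaussian with proxy
  \<open>v\<close>. Averaging that coordinate out keeps the oscillation bounds in the others, so the
  induction hypothesis applies to the average and the exponents add. The bound \<open>c y y'\<close>
  depends on both points so that one statement serves bounded differences (constant
  \<open>c\<close>) and Lipschitz dependence (\<open>c\<close> a multiple of the distance).\<close>

lemma sub_gaussian_PiM:
  fixes F :: "('i \<Rightarrow> 'a) \<Rightarrow> real" and c :: "'a \<Rightarrow> 'a \<Rightarrow> real"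
  assumes P: "prob_space P" and I: "finite I"
    and base: "\<And>f. f \<in> borel_measurable P \<Longrightarrow>
      (\<And>y y'. y \<in> space P \<Longrightarrow> y' \<in> space P \<Longrightarrow> \<bar>f y - f y'\<bar> \<le> c y y') \<Longrightarrow> sub_gaussian P f v"
    and F: "F \<in> borel_measurable (Pi\<^sub>M I (\<lambda>_. P))"
    and osc: "\<And>x i y y'. i \<in> I \<Longrightarrow> x \<in> space (Pi\<^sub>M I (\<lambda>_. P)) \<Longrightarrow> y \<in> space P \<Longrightarrow> y' \<in> space P \<Longrightarrow>
      \<bar>F (x(i := y)) - F (x(i := y'))\<bar> \<le> c y y'"
  shows "sub_gaussian (Pi\<^sub>M I (\<lambda>_. P)) F (real (card I) * v)"
  using I F osc
proof (induction I arbitrary: F rule: finite_induct)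
  case empty
  show ?case
    by (simp add: sub_gaussian_real_iff PiM_empty integrable_count_space lebesgue_integral_count_space_finite
        nn_integral_count_space_finite)
next
  case (insert i I)
  interpret P: prob_space P by fact
  let ?I = "Pi\<^sub>M I (\<lambda>_. P)" and ?J = "Pi\<^sub>M (insert i I) (\<lambda>_. P)"
  interpret I: prob_space ?I by (intro prob_space_PiM P)
  interpret J: prob_space ?J by (intro prob_space_PiM P)
  interpret product_sigma_finite "\<lambda>_. P" ..
  note F [measurable] = insert.prems(1)
  have upd: "x(i := y) \<in> space ?J" if "x \<in> space ?I" "y \<in> space P" for x y
    using that by (auto simp: space_PiM PiE_def extensional_def)
  define F1 where "F1 x = (LINT y|P. F (x(i := y)))" for x
  have F1 [measurable]: "F1 \<in> borel_measurable ?I"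
    unfolding F1_def by measurable
  have sg: "sub_gaussian P (\<lambda>y. F (x(i := y))) v" if x: "x \<in> space ?I" for x
  proof (rule base)
    show "(\<lambda>y. F (x(i := y))) \<in> borel_measurable P"
      using measurable_comp[OF measurable_component_update[OF x insert.hyps(2)] F] by (simp add: comp_def)
    fix y y' assume y: "y \<in> space P" "y' \<in> space P"
    then show "\<bar>F (x(i := y)) - F (x(i := y'))\<bar> \<le> c y y'"
      using insert.prems(2)[of i "x(i := y)" y y'] upd[OF x] by (simp del: fun_upd_apply)
  qed
  have sg1: "sub_gaussian ?I F1 (real (card I) * v)"
  proof (rule insert.IH)
    show "F1 \<in> borel_measurable ?I" by fact
    fix x j y y' assume *: "j \<in> I" "x \<in> space ?I" "y \<in> space P" "y' \<in> space P"
    have ji: "j \<noteq> i" using * insert.hyps by auto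
    have xj: "x(j := y) \<in> space ?I" if "y \<in> space P" for y
      using that * by (auto simp: space_PiM PiE_def extensional_def)
    have int: "integrable P (\<lambda>z. F (x(j := y, i := z)))" if "y \<in> space P" for y
      using sg[OF xj[OF that]] by (simp add: sub_gaussian_def)
    have "\<bar>F1 (x(j := y)) - F1 (x(j := y'))\<bar> = \<bar>LINT z|P. F (x(j := y, i := z)) - F (x(j := y', i := z))\<bar>"
      unfolding F1_def using int * by simp
    also have "\<dots> \<le> (LINT z|P. \<bar>F (x(j := y, i := z)) - F (x(j := y', i := z))\<bar>)"
      by (rule integral_abs_bound)
    also have "\<dots> \<le> (LINT z|P. c y y')"
    proof (rule integral_mono)
      fix z assume "z \<in> space P"
      then show "\<bar>F (x(j := y, i := z)) - F (x(j := y', i := z))\<bar> \<le> c y y'"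
        using insert.prems(2)[of j "x(i := z)" y y'] upd[of x z] * ji by (simp add: fun_upd_twist[of j i] del: fun_upd_apply)
    qed (use int * in auto)
    finally show "\<bar>F1 (x(j := y)) - F1 (x(j := y'))\<bar> \<le> c y y'"
      by (simp add: P.prob_space)
  qed
  have intF1: "integrable ?I F1"
    using sg1 by (simp add: sub_gaussian_def)
  have "(\<integral>\<^sup>+x. ennreal (norm (F x)) \<partial>?J) = (\<integral>\<^sup>+x. \<integral>\<^sup>+y. ennreal (norm (F (x(i := y)))) \<partial>P \<partial>?I)"
    by (rule product_nn_integral_insert) (use insert.hyps in auto)
  also have "\<dots> \<le> (\<integral>\<^sup>+x. ennreal (2 * exp (v / 2)) + ennreal (norm (F1 x)) \<partial>?I)"
  proof (rule nn_integral_mono)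
    fix x assume x: "x \<in> space ?I"
    have [measurable]: "(\<lambda>y. F (x(i := y))) \<in> borel_measurable P"
      using sg[OF x] by (auto simp: sub_gaussian_def)
    have "(\<integral>\<^sup>+y. ennreal (norm (F (x(i := y)))) \<partial>P)
        \<le> (\<integral>\<^sup>+y. ennreal \<bar>F (x(i := y)) - F1 x\<bar> + ennreal (norm (F1 x)) \<partial>P)"
      by (intro nn_integral_mono) (simp flip: ennreal_plus)
    also have "\<dots> = (\<integral>\<^sup>+y. ennreal \<bar>F (x(i := y)) - F1 x\<bar> \<partial>P) + ennreal (norm (F1 x))"
      by (subst nn_integral_add) (auto simp: P.emeasure_space_1)
    also have "\<dots> \<le> ennreal (2 * exp (v / 2)) + ennreal (norm (F1 x))"
      using sub_gaussian_nn_integral_abs[OF sg[OF x]] by (intro add_right_mono) (simp add: F1_def)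
    finally show "(\<integral>\<^sup>+y. ennreal (norm (F (x(i := y)))) \<partial>P) \<le> \<dots>" .
  qed
  also have "\<dots> = ennreal (2 * exp (v / 2)) + (\<integral>\<^sup>+x. ennreal (norm (F1 x)) \<partial>?I)"
    by (subst nn_integral_add) (auto simp: I.emeasure_space_1)
  also have "\<dots> < \<infinity>"
    using intF1 by (simp add: integrable_iff_bounded)
  finally have intF: "integrable ?J F"
    by (simp add: integrable_iff_bounded)
  define m where "m = integral\<^sup>L ?J F"
  have m: "m = integral\<^sup>L ?I F1"
    unfolding m_def F1_def using insert.hyps intF by (intro product_integral_insert) auto
  have "(\<integral>\<^sup>+x. ennreal (exp (u * (F x - m))) \<partial>?J) \<le> ennreal (exp (u\<^sup>2 * (real (card (insert i I)) * v) / 2))" for u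
  proof -
    have "(\<integral>\<^sup>+x. ennreal (exp (u * (F x - m))) \<partial>?J) = (\<integral>\<^sup>+x. \<integral>\<^sup>+y. ennreal (exp (u * (F (x(i := y)) - m))) \<partial>P \<partial>?I)"
      by (rule product_nn_integral_insert) (use insert.hyps in auto)
    also have "\<dots> \<le> (\<integral>\<^sup>+x. ennreal (exp (u * (F1 x - m))) * ennreal (exp (u\<^sup>2 * v / 2)) \<partial>?I)"
    proof (rule nn_integral_mono)
      fix x assume x: "x \<in> space ?I"
      have [measurable]: "(\<lambda>y. F (x(i := y))) \<in> borel_measurable P"
        using sg[OF x] by (auto simp: sub_gaussian_def)
      have "(\<integral>\<^sup>+y. ennreal (exp (u * (F (x(i := y)) - m))) \<partial>P)
          = (\<integral>\<^sup>+y. ennreal (exp (u * (F1 x - m))) * ennreal (exp (u * (F (x(i := y)) - F1 x))) \<partial>P)"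
        by (intro nn_integral_cong) (simp add: right_diff_distrib flip: ennreal_mult exp_add)
      also have "\<dots> = ennreal (exp (u * (F1 x - m))) * (\<integral>\<^sup>+y. ennreal (exp (u * (F (x(i := y)) - F1 x))) \<partial>P)"
        by (rule nn_integral_cmult) measurable
      also have "\<dots> \<le> ennreal (exp (u * (F1 x - m))) * ennreal (exp (u\<^sup>2 * v / 2))"
        using sg[OF x] unfolding sub_gaussian_real_iff F1_def[symmetric] by (intro mult_left_mono) auto
      finally show "(\<integral>\<^sup>+y. ennreal (exp (u * (F (x(i := y)) - m))) \<partial>P) \<le> \<dots>" .
    qed
    also have "\<dots> = (\<integral>\<^sup>+x. ennreal (exp (u * (F1 x - m))) \<partial>?I) * ennreal (exp (u\<^sup>2 * v / 2))"
      by (rule nn_integral_multc) measurable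
    also have "\<dots> \<le> ennreal (exp (u\<^sup>2 * (real (card I) * v) / 2)) * ennreal (exp (u\<^sup>2 * v / 2))"
      using sg1 unfolding sub_gaussian_real_iff m[symmetric] by (intro mult_right_mono) auto
    also have "\<dots> = ennreal (exp (u\<^sup>2 * (real (card (insert i I)) * v) / 2))"
    proof -
      have "u\<^sup>2 * (real (card I) * v) / 2 + u\<^sup>2 * v / 2 = u\<^sup>2 * (real (card (insert i I)) * v) / 2"
        using insert.hyps by (simp add: field_simps)
      then show ?thesis
        by (simp flip: ennreal_mult exp_add)
    qed
    finally show ?thesis .
  qed
  then show ?case
    using intF unfolding sub_gaussian_real_iff m_def by blast
qed

subsection \<open>A maximal inequality for exchangeable statistics\<close>

abbreviation swap :: "'a \<Rightarrow> 'a \<Rightarrow> 'a \<Rightarrow> 'a" where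
  "swap \<equiv> Transposition.transpose"

text \<open>Points of a product over \<open>I\<close> are extensional, and reindexing of products is
  phrased with \<open>restrict\<close>. A swap of two indices of \<open>I\<close> leaves the
  \<open>undefined\<close> part alone, so plain composition can be used instead.\<close>

lemma comp_swap_eq_restrict:
  assumes "i \<in> I" "j \<in> I" "x \<in> extensional I"
  shows "x \<circ> swap i j = (\<lambda>n\<in>I. x (swap i j n))"
proof
  fix n
  show "(x \<circ> swap i j) n = (\<lambda>n\<in>I. x (swap i j n)) n"
    using assms by (auto simp: extensional_def Transposition.transpose_def)
qed

lemma measurable_comp_swap:
  assumes ij: "i \<in> I" "j \<in> I"
  shows "(\<lambda>x. x \<circ> swap i j) \<in> measurable (Pi\<^sub>M I (\<lambda>_. P)) (Pi\<^sub>M I (\<lambda>_. P))"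
proof -
  have "(\<lambda>x. \<lambda>n\<in>I. x (swap i j n)) \<in> measurable (Pi\<^sub>M I (\<lambda>_. P)) (Pi\<^sub>M I (\<lambda>_. P))"
    by (intro measurable_restrict measurable_component_singleton)
       (use ij in \<open>auto simp: Transposition.transpose_def\<close>)
  moreover have "(\<lambda>n\<in>I. x (swap i j n)) = x \<circ> swap i j" if "x \<in> space (Pi\<^sub>M I (\<lambda>_. P))" for x
    using comp_swap_eq_restrict[OF ij, of x] that by (simp add: space_PiM PiE_def)
  ultimately show ?thesis
    by (simp cong: measurable_cong)
qed

text \<open>Exchangeability of the coordinates, the substitute for conditional expectations in the
  maximal inequality.\<close>

lemma nn_integral_PiM_swap:
  fixes f :: "('i \<Rightarrow> 'a) \<Rightarrow> ennreal"
  assumes P: "prob_space P" and ij: "i \<in> I" "j \<in> I"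
    and f: "f \<in> borel_measurable (Pi\<^sub>M I (\<lambda>_. P))"
  shows "(\<integral>\<^sup>+x. f (x \<circ> swap i j) \<partial>Pi\<^sub>M I (\<lambda>_. P)) = (\<integral>\<^sup>+x. f x \<partial>Pi\<^sub>M I (\<lambda>_. P))"
proof -
  let ?D = "Pi\<^sub>M I (\<lambda>_. P)"
  have "distr ?D ?D (\<lambda>x. \<lambda>n\<in>I. x (swap i j n)) = ?D"
    by (rule distr_PiM_reindex[of I "\<lambda>_. P" "swap i j" I])
       (use P ij in \<open>auto simp: Transposition.transpose_def intro: inj_on_subset[OF inj_transpose]\<close>)
  also have "distr ?D ?D (\<lambda>x. \<lambda>n\<in>I. x (swap i j n)) = distr ?D ?D (\<lambda>x. x \<circ> swap i j)"
    by (intro distr_cong comp_swap_eq_restrict[OF ij, symmetric]) (auto simp: space_PiM PiE_def)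
  finally have D: "distr ?D ?D (\<lambda>x. x \<circ> swap i j) = ?D" .
  show ?thesis
    using nn_integral_distr[OF measurable_comp_swap[OF ij, of P], of f] f D by simp
qed

text \<open>The leave-one-out condition makes \<open>H n\<close>, \<open>H (n + 1)\<close>, \<dots> a reverse submartingale for the
  exchangeable filtration. Stopping at the last index that exceeds \<open>c\<close> gives an event that is
  still symmetric in the earlier coordinates.\<close>
lemma reverse_maximal_inequality:
  fixes H :: "nat \<Rightarrow> (nat \<Rightarrow> 'a) \<Rightarrow> ennreal"
  assumes P: "prob_space P" and I: "{1..N} \<subseteq> I" and n: "1 \<le> n" "n \<le> N"
    and meas: "\<And>t. n \<le> t \<Longrightarrow> t \<le> N \<Longrightarrow> H t \<in> borel_measurable (Pi\<^sub>M I (\<lambda>_. P))"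
    and sym: "\<And>s t i x. i \<in> {1..t} \<Longrightarrow> t \<le> s \<Longrightarrow> H s (x \<circ> swap i t) = H s x"
    and loo: "\<And>t x. n < t \<Longrightarrow> H t x \<le> (\<Sum>i=1..t. H (t - 1) (x \<circ> swap i t)) / of_nat t"
  shows "c * emeasure (Pi\<^sub>M I (\<lambda>_. P)) {x \<in> space (Pi\<^sub>M I (\<lambda>_. P)). \<exists>t\<in>{n..N}. c \<le> H t x}
    \<le> (\<integral>\<^sup>+x. H n x \<partial>Pi\<^sub>M I (\<lambda>_. P))"
proof -
  let ?D = "Pi\<^sub>M I (\<lambda>_. P)"
  define B where "B t = {x \<in> space ?D. c \<le> H t x \<and> (\<forall>s\<in>{t<..N}. H s x < c)}" for t
  note meas [measurable]
  have B [measurable]: "B t \<in> sets ?D" if "n \<le> t" "t \<le> N" for t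
  proof -
    have "Measurable.pred ?D (\<lambda>x. c \<le> H t x \<and> (\<forall>s\<in>{t<..N}. H s x < c))"
    proof (intro pred_intros_logic pred_intros_finite)
      show "Measurable.pred ?D (\<lambda>x. c \<le> H t x)" using that by simp
      show "Measurable.pred ?D (\<lambda>x. H s x < c)" if "s \<in> {t<..N}" for s
      proof -
        have [measurable]: "H s \<in> borel_measurable ?D" using that \<open>n \<le> t\<close> by auto
        show ?thesis by measurable
      qed
    qed auto
    then show ?thesis unfolding B_def pred_def by simp
  qed
  \<comment> \<open>The backward submartingale step, tested on \<open>B t\<close>. Since
    \<open>k \<le> t\<close>, the event involves only \<open>H s\<close> with
    \<open>s \<ge> k\<close> and is invariant under \<open>swap i k\<close>. After the swap all
    leave-one-out terms have the same integral, and the average of \<open>k\<close> equal numbers is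
    that number.\<close>
  have one_step: "(\<integral>\<^sup>+x. H k x * indicator (B t) x \<partial>?D) \<le> (\<integral>\<^sup>+x. H (k - 1) x * indicator (B t) x \<partial>?D)"
    if k: "n < k" "k \<le> t" and t: "t \<le> N" for k t
  proof -
    have ik: "i \<in> I" "k \<in> I" if "i \<in> {1..k}" for i
      using that I k t by auto
    have tr: "x \<circ> swap i k \<in> space ?D \<longleftrightarrow> x \<in> space ?D" if "i \<in> {1..k}" for x i
      using measurable_space[OF measurable_comp_swap[OF ik[OF that], of P], of x]
        measurable_space[OF measurable_comp_swap[OF ik[OF that], of P], of "x \<circ> swap i k"]
      by (auto simp: comp_assoc)
    have ind: "indicator (B t) (x \<circ> swap i k) = (indicator (B t) x :: ennreal)"
      if "i \<in> {1..k}" for x i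
    proof -
      have "x \<circ> swap i k \<in> B t \<longleftrightarrow> x \<in> B t"
        unfolding B_def using tr[OF that] sym[of i k _ x] that k by auto
      then show ?thesis by (simp add: indicator_def)
    qed
    have [measurable]: "H (k - 1) \<in> borel_measurable ?D" using k t by (intro meas) auto
    have [measurable]: "B t \<in> sets ?D" using k t by auto
    have [measurable]: "(\<lambda>x. H (k - 1) (x \<circ> swap i k)) \<in> borel_measurable ?D" if "i \<in> {1..k}" for i
      using measurable_comp_swap[OF ik[OF that], of P] by measurable
    let ?W = "\<lambda>i x. H (k - 1) (x \<circ> swap i k) * indicator (B t) x"
    have "(\<integral>\<^sup>+x. H k x * indicator (B t) x \<partial>?D)
        \<le> (\<integral>\<^sup>+x. (\<Sum>i=1..k. H (k - 1) (x \<circ> swap i k)) / of_nat k * indicator (B t) x \<partial>?D)"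
      using loo[OF k(1)] by (intro nn_integral_mono mult_right_mono) auto
    also have "\<dots> = (\<integral>\<^sup>+x. (\<Sum>i=1..k. ?W i x) * inverse (of_nat k) \<partial>?D)"
      by (simp only: divide_ennreal_def sum_distrib_right[symmetric] mult.assoc mult.commute[of "inverse _"])
    also have "\<dots> = (\<integral>\<^sup>+x. (\<Sum>i=1..k. ?W i x) \<partial>?D) * inverse (of_nat k)"
      by (intro nn_integral_multc borel_measurable_sum) measurable
    also have "(\<integral>\<^sup>+x. (\<Sum>i=1..k. ?W i x) \<partial>?D)
        = (\<Sum>i=1..k. \<integral>\<^sup>+x. ?W i x \<partial>?D)"
      by (intro nn_integral_sum) measurable
    also have "(\<Sum>i=1..k. \<integral>\<^sup>+x. ?W i x \<partial>?D)
        = (\<Sum>i=1..k. \<integral>\<^sup>+x. H (k - 1) x * indicator (B t) x \<partial>?D)"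
    proof (rule sum.cong[OF refl])
      fix i assume i: "i \<in> {1..k}"
      have "(\<integral>\<^sup>+x. ?W i x \<partial>?D)
          = (\<integral>\<^sup>+x. H (k - 1) (x \<circ> swap i k) * indicator (B t) (x \<circ> swap i k) \<partial>?D)"
        using ind[OF i] by simp
      also have "\<dots> = (\<integral>\<^sup>+x. H (k - 1) x * indicator (B t) x \<partial>?D)"
        using i I k t by (intro nn_integral_PiM_swap[OF P, where f = "\<lambda>x. H (k - 1) x * indicator (B t) x"]) auto
      finally show "(\<integral>\<^sup>+x. ?W i x \<partial>?D) = \<dots>" .
    qed
    also have "\<dots> * inverse (of_nat k) = (\<integral>\<^sup>+x. H (k - 1) x * indicator (B t) x \<partial>?D)"
    proof -
      have "(of_nat k :: ennreal) * inverse (of_nat k) = 1"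
        using k(1) by (simp add: ennreal_divide_self of_nat_less_top flip: divide_ennreal_def)
      then show ?thesis
        by (simp add: mult.assoc[symmetric] mult.commute[of _ "inverse _"])
    qed
    finally show ?thesis .
  qed
  have down: "(\<integral>\<^sup>+x. H t x * indicator (B t) x \<partial>?D) \<le> (\<integral>\<^sup>+x. H n x * indicator (B t) x \<partial>?D)"
    if t: "n \<le> t" "t \<le> N" for t
  proof -
    have "(\<integral>\<^sup>+x. H t x * indicator (B t) x \<partial>?D) \<le> (\<integral>\<^sup>+x. H k x * indicator (B t) x \<partial>?D)"
      if "n \<le> k" "k \<le> t" for k
      using that(2,1)
    proof (induction k rule: inc_induct)
      case (step k)
      then show ?case
        using one_step[of "Suc k" t] \<open>t \<le> N\<close> by (auto intro: order_trans)
    qed simp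
    from this[of n] t show ?thesis by simp
  qed
  have disj: "disjoint_family_on B {n..N}"
    unfolding disjoint_family_on_def B_def by (auto simp: not_le[symmetric])
  have Un: "{x \<in> space ?D. \<exists>t\<in>{n..N}. c \<le> H t x} = (\<Union>t\<in>{n..N}. B t)"
  proof (intro equalityI subsetI)
    fix x assume "x \<in> {x \<in> space ?D. \<exists>t\<in>{n..N}. c \<le> H t x}"
    then have x: "x \<in> space ?D" and ne: "{t \<in> {n..N}. c \<le> H t x} \<noteq> {}" by auto
    let ?t = "Max {t \<in> {n..N}. c \<le> H t x}"
    have t: "?t \<in> {t \<in> {n..N}. c \<le> H t x}" using ne by (intro Max_in) auto
    have "H s x < c" if "s \<in> {?t<..N}" for s
    proof (rule ccontr)
      assume "\<not> H s x < c"
      then have "s \<in> {t \<in> {n..N}. c \<le> H t x}" using that t by auto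
      then have "s \<le> ?t" by (intro Max_ge) auto
      then show False using that by simp
    qed
    then show "x \<in> (\<Union>t\<in>{n..N}. B t)" using x t unfolding B_def by blast
  qed (auto simp: B_def)
  \<comment> \<open>Markov's inequality on each disjoint event; \<open>down\<close> then moves every
    integrand to the common index \<open>n\<close>, where the events add up.\<close>
  have "c * emeasure ?D (\<Union>t\<in>{n..N}. B t) = (\<Sum>t\<in>{n..N}. c * emeasure ?D (B t))"
    using disj by (subst sum_emeasure[symmetric]) (auto simp: sum_distrib_left)
  also have "\<dots> \<le> (\<Sum>t\<in>{n..N}. \<integral>\<^sup>+x. H n x * indicator (B t) x \<partial>?D)"
  proof (rule sum_mono)
    fix t assume t: "t \<in> {n..N}"
    then have [measurable]: "B t \<in> sets ?D" by auto
    have "c * emeasure ?D (B t) = (\<integral>\<^sup>+x. c * indicator (B t) x \<partial>?D)"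
      by (simp add: nn_integral_cmult)
    also have "\<dots> \<le> (\<integral>\<^sup>+x. H t x * indicator (B t) x \<partial>?D)"
      by (intro nn_integral_mono) (auto simp: B_def indicator_def)
    also note down
    finally show "c * emeasure ?D (B t) \<le> (\<integral>\<^sup>+x. H n x * indicator (B t) x \<partial>?D)" using t by auto
  qed
  also have "\<dots> = (\<integral>\<^sup>+x. (\<Sum>t\<in>{n..N}. H n x * indicator (B t) x) \<partial>?D)"
    using n by (intro nn_integral_sum[symmetric]) auto
  also have "\<dots> = (\<integral>\<^sup>+x. H n x * indicator (\<Union>t\<in>{n..N}. B t) x \<partial>?D)"
    using disj by (intro nn_integral_cong) (simp add: indicator_UN_disjoint sum_distrib_left)
  also have "\<dots> \<le> (\<integral>\<^sup>+x. H n x \<partial>?D)"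
    by (intro nn_integral_mono) (auto simp: indicator_def)
  finally show ?thesis by (simp add: Un)
qed

section \<open>From product spaces to an i.i.d. sample\<close>

text \<open>Off \<open>I\<close> the points of the smaller product are \<open>undefined\<close>,
  which need not lie in \<open>space P\<close>. Filling these coordinates with a fixed
  \<open>p\<close> maps into the full product, and a function that reads only \<open>J\<close> does
  not see the filling.\<close>

lemma measurable_PiM_local:
  fixes G :: "(nat \<Rightarrow> 'a) \<Rightarrow> 'b"
  assumes G: "G \<in> measurable (Pi\<^sub>M UNIV (\<lambda>_. P)) N" and P: "space P \<noteq> {}"
    and loc: "\<And>x y. (\<And>i. i \<in> J \<Longrightarrow> x i = y i) \<Longrightarrow> G x = G y" and J: "J \<subseteq> I"
  shows "G \<in> measurable (Pi\<^sub>M I (\<lambda>_. P)) N"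
proof -
  obtain p where p: "p \<in> space P" using P by auto
  let ?e = "\<lambda>x i. if i \<in> I then x i else p"
  have "?e \<in> measurable (Pi\<^sub>M I (\<lambda>_. P)) (Pi\<^sub>M UNIV (\<lambda>_. P))"
  proof (rule measurable_PiM_single')
    show "(\<lambda>x. ?e x i) \<in> measurable (Pi\<^sub>M I (\<lambda>_. P)) P" for i
      using p by (cases "i \<in> I") auto
    show "?e \<in> space (Pi\<^sub>M I (\<lambda>_. P)) \<rightarrow> (\<Pi>\<^sub>E i\<in>UNIV. space P)"
      using p by (auto simp: space_PiM)
  qed
  from measurable_compose[OF this G] have "(\<lambda>x. G (?e x)) \<in> measurable (Pi\<^sub>M I (\<lambda>_. P)) N" .
  moreover have "G (?e x) = G x" for x
    using J by (intro loc) auto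
  ultimately show ?thesis by simp
qed

lemma distr_restrict_PiM:
  assumes M: "prob_space M" and I: "I \<noteq> {}"
    and indep: "prob_space.indep_vars M (\<lambda>_. borel) X I"
    and law: "\<And>i. i \<in> I \<Longrightarrow> distr M borel (X i) = P"
  shows "distr M (Pi\<^sub>M I (\<lambda>_. borel)) (\<lambda>\<omega>. \<lambda>i\<in>I. X i \<omega>) = Pi\<^sub>M I (\<lambda>_. P)"
proof -
  interpret prob_space M by fact
  have "random_variable borel (X i)" if "i \<in> I" for i
    using indep that by (simp add: indep_vars_def)
  then have "distr M (Pi\<^sub>M I (\<lambda>_. borel)) (\<lambda>\<omega>. \<lambda>i\<in>I. X i \<omega>) = Pi\<^sub>M I (\<lambda>i. distr M borel (X i))"
    using indep indep_vars_iff_distr_eq_PiM'[OF I, where M'="\<lambda>_. borel" and X=X] by simp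
  also have "\<dots> = Pi\<^sub>M I (\<lambda>_. P)"
    using law by (intro PiM_cong) auto
  finally show ?thesis .
qed

text \<open>The estimate for one epoch. Jensen's inequality carries the leave-one-out condition from
  \<open>G\<close> to its exponential, and the maximal inequality then controls the whole window by
  the moment generating function at the left end \<open>n\<close>. This is why the bound is free of
  \<open>N\<close>.\<close>

lemma reverse_chernoff:
  fixes G :: "nat \<Rightarrow> (nat \<Rightarrow> 'a::topological_space) \<Rightarrow> real" and M :: "'w measure"
  assumes M: "prob_space M"
    and indep: "prob_space.indep_vars M (\<lambda>_. borel) X {1..}"
    and law: "\<And>i. i \<ge> 1 \<Longrightarrow> distr M borel (X i) = P"
    and meas: "\<And>t. G t \<in> borel_measurable (Pi\<^sub>M UNIV (\<lambda>_. borel))"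
    and loc: "\<And>t x y. (\<And>i. i \<in> {1..t} \<Longrightarrow> x i = y i) \<Longrightarrow> G t x = G t y"
    and sym: "\<And>s t i x. i \<in> {1..t} \<Longrightarrow> t \<le> s \<Longrightarrow> G s (x \<circ> swap i t) = G s x"
    and loo: "\<And>t x. 2 \<le> t \<Longrightarrow> G t x \<le> (\<Sum>i=1..t. G (t - 1) (x \<circ> swap i t)) / real t"
    and sub: "sub_gaussian M (\<lambda>\<omega>. G n (\<lambda>i. X i \<omega>)) (v / real n)"
    and mean: "(LINT \<omega>|M. G n (\<lambda>i. X i \<omega>)) \<le> m"
    and n: "1 \<le> n" and v: "v > 0" and s: "s \<ge> 0"
  shows "{\<omega> \<in> space M. \<exists>t\<in>{n..N}. m + s \<le> G t (\<lambda>i. X i \<omega>)} \<in> sets M"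
    and "measure M {\<omega> \<in> space M. \<exists>t\<in>{n..N}. m + s \<le> G t (\<lambda>i. X i \<omega>)} \<le> exp (- (s\<^sup>2 * real n / (2 * v)))"
proof -
  interpret M: prob_space M by fact
  \<comment> \<open>Nothing is assumed about \<open>X 0\<close>, so the product is indexed from
    1.\<close>
  define I where "I = {1::nat..}"
  let ?D = "Pi\<^sub>M I (\<lambda>_. P)"
  let ?X = "\<lambda>\<omega>. \<lambda>i\<in>I. X i \<omega>"
  let ?E = "{\<omega> \<in> space M. \<exists>t\<in>{n..N}. m + s \<le> G t (\<lambda>i. X i \<omega>)}"
  have setsP: "sets P = sets borel" using law[of 1] by auto
  then have spP: "space P = UNIV" using sets_eq_imp_space_eq by fastforce
  have P: "prob_space P"
    using M.prob_space_distr[of "X 1" borel] indep law[of 1] by (auto simp: M.indep_vars_def)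
  have D: "distr M (Pi\<^sub>M I (\<lambda>_. borel)) ?X = ?D"
    by (rule distr_restrict_PiM) (use M indep law in \<open>auto simp: I_def\<close>)
  have X [measurable]: "?X \<in> measurable M (Pi\<^sub>M I (\<lambda>_. borel))"
    using indep by (intro measurable_restrict) (auto simp: M.indep_vars_def I_def)
  have mG [measurable]: "G t \<in> borel_measurable (Pi\<^sub>M I (\<lambda>_. borel))" for t
    by (rule measurable_PiM_local[OF meas _ loc, of "{1..t}"]) (auto simp: I_def)
  have setsD: "sets ?D = sets (Pi\<^sub>M I (\<lambda>_. borel))"
    using setsP by (intro sets_PiM_cong) auto
  have GX: "G t (?X \<omega>) = G t (\<lambda>i. X i \<omega>)" for t \<omega>
    by (rule loc) (auto simp: I_def)
  have mGX [measurable]: "(\<lambda>\<omega>. G t (\<lambda>i. X i \<omega>)) \<in> borel_measurable M" for t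
    unfolding GX[symmetric] by measurable
  show E: "?E \<in> sets M" by measurable
  \<comment> \<open>The minimiser of the Chernoff exponent
    \<open>lam\<^sup>2 * v / (2 * n) - lam * s\<close>.\<close>
  define lam where "lam = s * real n / v"
  have lam: "lam \<ge> 0" unfolding lam_def using s v by auto
  define H where "H t x = ennreal (exp (lam * (G t x - m)))" for t x
  let ?c = "ennreal (exp (lam * s))"
  have "measure M ?E \<le> exp (- (s\<^sup>2 * real n / (2 * v)))"
  proof (cases "n \<le> N")
    case False
    then have "?E = {}" by auto
    then show ?thesis by (simp only: measure_empty) simp
  next
    case nN: True
    have mH [measurable]: "H t \<in> borel_measurable (Pi\<^sub>M I (\<lambda>_. borel))" for t
      unfolding H_def by measurable
    have mH' [measurable]: "H t \<in> borel_measurable ?D" for t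
      unfolding measurable_cong_sets[OF setsD refl] by measurable
    define A where "A = {x \<in> space ?D. \<exists>t\<in>{n..N}. ?c \<le> H t x}"
    have "A \<in> sets ?D"
      unfolding A_def by measurable
    then have A: "A \<in> sets (Pi\<^sub>M I (\<lambda>_. borel))"
      by (simp add: setsD)
    have "emeasure M ?E \<le> emeasure M (?X -` A \<inter> space M)"
    proof (rule emeasure_mono)
      show "?E \<subseteq> ?X -` A \<inter> space M"
        using lam measurable_space[OF X]
        by (auto simp: A_def H_def GX sets_eq_imp_space_eq[OF setsD] intro!: bexI mult_left_mono)
      show "?X -` A \<inter> space M \<in> sets M"
        by (rule measurable_sets[OF X A])
    qed
    also have "\<dots> = emeasure ?D A"
      using emeasure_distr[OF X A] by (simp only: D)
    finally have "?c * emeasure M ?E \<le> ?c * emeasure ?D A"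
      by (intro mult_left_mono) auto
    also have "?c * emeasure ?D A \<le> (\<integral>\<^sup>+x. H n x \<partial>?D)"
      unfolding A_def
    proof (rule reverse_maximal_inequality[OF P _ n nN])
      show "{1..N} \<subseteq> I" by (auto simp: I_def)
      show "H t \<in> borel_measurable ?D" for t
        by measurable
      show "H s (x \<circ> swap i t) = H s x" if "i \<in> {1..t}" "t \<le> s" for s t i x
        unfolding H_def using sym[OF that] by simp
      fix t x assume t: "n < t"
      have "lam * (G t x - m) \<le> lam * ((\<Sum>i=1..t. G (t - 1) (x \<circ> swap i t)) / real t - m)"
        using t n lam by (intro mult_left_mono diff_right_mono loo) auto
      also have "\<dots> = (\<Sum>i=1..t. (1 / real t) *\<^sub>R (lam * (G (t - 1) (x \<circ> swap i t) - m)))"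
        using t by (simp add: sum_divide_distrib[symmetric] sum_distrib_left[symmetric] sum_subtractf field_simps)
      finally have "exp (lam * (G t x - m)) \<le> exp (\<Sum>i=1..t. (1 / real t) *\<^sub>R (lam * (G (t - 1) (x \<circ> swap i t) - m)))"
        by simp
      also have "\<dots> \<le> (\<Sum>i=1..t. (1 / real t) * exp (lam * (G (t - 1) (x \<circ> swap i t) - m)))"
        using t by (intro convex_on_sum[OF _ _ convex_on_exp[of 1, simplified]]) auto
      finally have "H t x \<le> ennreal (\<Sum>i=1..t. (1 / real t) * exp (lam * (G (t - 1) (x \<circ> swap i t) - m)))"
        unfolding H_def by (rule ennreal_leI)
      also have "\<dots> = ennreal ((\<Sum>i=1..t. exp (lam * (G (t - 1) (x \<circ> swap i t) - m))) / real t)"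
        by (simp add: sum_divide_distrib)
      also have "\<dots> = (\<Sum>i=1..t. H (t - 1) (x \<circ> swap i t)) / of_nat t"
        unfolding H_def using t
        by (subst divide_ennreal[symmetric]) (auto simp: sum_nonneg ennreal_of_nat_eq_real_of_nat)
      finally show "H t x \<le> (\<Sum>i=1..t. H (t - 1) (x \<circ> swap i t)) / of_nat t" .
    qed
    also have "(\<integral>\<^sup>+x. H n x \<partial>?D) = (\<integral>\<^sup>+\<omega>. H n (?X \<omega>) \<partial>M)"
      unfolding D[symmetric] by (rule nn_integral_distr) measurable
    \<comment> \<open>The mean is known only to be at most \<open>m\<close>;
      \<open>lam \<ge> 0\<close> makes the replacement go in the right direction.\<close>
    also have "\<dots> \<le> (\<integral>\<^sup>+\<omega>. ennreal (exp (lam * (G n (\<lambda>i. X i \<omega>) - (LINT \<omega>|M. G n (\<lambda>i. X i \<omega>))))) \<partial>M)"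
      using lam mean unfolding H_def GX by (intro nn_integral_mono ennreal_leI) (auto intro!: mult_left_mono)
    also have "\<dots> \<le> ennreal (exp (lam\<^sup>2 * (v / real n) / 2))"
      using sub by (simp add: sub_gaussian_def inner_real_def)
    finally have "?c * emeasure M ?E \<le> ennreal (exp (lam\<^sup>2 * (v / real n) / 2))" .
    then have "exp (lam * s) * measure M ?E \<le> exp (lam\<^sup>2 * (v / real n) / 2)"
      by (simp add: M.emeasure_eq_measure flip: ennreal_mult)
    then have "measure M ?E \<le> exp (lam\<^sup>2 * (v / real n) / 2) / exp (lam * s)"
      by (simp add: field_simps)
    also have "\<dots> = exp (- (s\<^sup>2 * real n / (2 * v)))"
    proof -
      have "lam\<^sup>2 * (v / real n) / 2 - lam * s = - (s\<^sup>2 * real n / (2 * v))"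
        unfolding lam_def using v n by (simp add: field_simps power2_eq_square)
      then show ?thesis by (simp flip: exp_diff)
    qed
    finally show ?thesis .
  qed
  then show "measure M ?E \<le> exp (- (s\<^sup>2 * real n / (2 * v)))" .
qed


section \<open>Stitching the dyadic epochs\<close>

text \<open>The mean hypothesis carries \<open>sqrt (2 * real t)\<close> because it is used at
  \<open>t = 2 ^ j\<close>, where it must lie below \<open>C / sqrt (real t)\<close> for every later
  \<open>t \<le> 2 ^ Suc j\<close>.\<close>

lemma stitched_bound:
  fixes G :: "nat \<Rightarrow> (nat \<Rightarrow> 'a::topological_space) \<Rightarrow> real" and M :: "'w measure"
    and l :: "real \<Rightarrow> real"
  assumes M: "prob_space M"
    and indep: "prob_space.indep_vars M (\<lambda>_. borel) X {1..}"
    and law: "\<And>i. i \<ge> 1 \<Longrightarrow> distr M borel (X i) = P"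
    and meas: "\<And>t. G t \<in> borel_measurable (Pi\<^sub>M UNIV (\<lambda>_. borel))"
    and loc: "\<And>t x y. (\<And>i. i \<in> {1..t} \<Longrightarrow> x i = y i) \<Longrightarrow> G t x = G t y"
    and sym: "\<And>s t i x. i \<in> {1..t} \<Longrightarrow> t \<le> s \<Longrightarrow> G s (x \<circ> swap i t) = G s x"
    and loo: "\<And>t x. 2 \<le> t \<Longrightarrow> G t x \<le> (\<Sum>i=1..t. G (t - 1) (x \<circ> swap i t)) / real t"
    and sub: "\<And>t. 1 \<le> t \<Longrightarrow> sub_gaussian M (\<lambda>\<omega>. G t (\<lambda>i. X i \<omega>)) (v / real t)"
    and mean: "\<And>t. 1 \<le> t \<Longrightarrow> (LINT \<omega>|M. G t (\<lambda>i. X i \<omega>)) \<le> C / sqrt (2 * real t)"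
    and v: "v > 0" and C: "C \<ge> 0"
    and \<delta>: "0 < \<delta>" "\<delta> < 1"
    and l_ge1: "\<And>x. x \<ge> 0 \<Longrightarrow> l x \<ge> 1"
    and l_sum: "summable (\<lambda>j. 1 / l (real (Suc j)))" "(\<Sum>j. 1 / l (real (Suc j))) \<le> 1"
    and l_const: "\<And>x. x \<in> {0..1} \<Longrightarrow> l x = l 1"
    and l_decr: "\<And>u v. 1 \<le> u \<Longrightarrow> u \<le> v \<Longrightarrow> 2 powr (- v) * ln (l v) \<le> 2 powr (- u) * ln (l u)"
  defines "E \<equiv> {\<omega> \<in> space M. \<exists>t\<ge>1. C / sqrt (real t)
      + 2 * sqrt (v / real t * (ln (l (log 2 (real t))) + ln (1 / \<delta>))) \<le> G t (\<lambda>i. X i \<omega>)}"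
  shows "E \<in> sets M" "measure M E \<le> \<delta>"
proof -
  interpret M: prob_space M by fact
  have mGX [measurable]: "(\<lambda>\<omega>. G t (\<lambda>i. X i \<omega>)) \<in> borel_measurable M" for t
  proof (cases "t = 0")
    case True
    \<comment> \<open>Sub-Gaussianity yields measurability only for \<open>t \<ge> 1\<close>. At
      \<open>t = 0\<close> locality over an empty index set makes \<open>G t\<close>
      constant.\<close>
    have "G t (\<lambda>i. X i \<omega>) = G t (\<lambda>_. undefined)" for \<omega>
      using True by (intro loc) auto
    then show ?thesis by simp
  next
    case False
    then show ?thesis using sub[of t] by (auto simp: sub_gaussian_def)
  qed
  show E: "E \<in> sets M" unfolding E_def by measurable
  define L where "L j = ln (l (real (Suc j))) + ln (1 / \<delta>)" for j
  \<comment> \<open>The radicand uses \<open>2 ^ Suc j\<close>, the right end of the epoch, so that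
    \<open>s j\<close> lies below the claimed deviation at each of its times. The leading 2 makes
    the exponent \<open>(s j)\<^sup>2 * 2 ^ j / (2 * v)\<close> equal to \<open>L j\<close>.\<close>
  define s where "s j = 2 * sqrt (v / 2 ^ Suc j * L j)" for j
  define B where "B j = {\<omega> \<in> space M. \<exists>t\<in>{2 ^ j..2 ^ Suc j}. C / sqrt (2 * real (2 ^ j)) + s j \<le> G t (\<lambda>i. X i \<omega>)}" for j
  have lpos: "l x > 0" if "x \<ge> 0" for x using l_ge1[OF that] by simp
  have L: "L j \<ge> 0" for j
    unfolding L_def using l_ge1[of "real (Suc j)"] \<delta> by (intro add_nonneg_nonneg ln_ge_zero) auto
  have s: "s j \<ge> 0" for j
    unfolding s_def using L v by simp
  have B [measurable]: "B j \<in> sets M" for j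
    unfolding B_def by measurable
  have PB: "measure M (B j) \<le> \<delta> * (1 / l (real (Suc j)))" for j
  proof -
    have "measure M (B j) \<le> exp (- ((s j)\<^sup>2 * real (2 ^ j) / (2 * v)))"
      unfolding B_def
      by (rule reverse_chernoff(2)[OF M indep law meas loc sym loo sub mean _ v s]) auto
    also have "(s j)\<^sup>2 * real (2 ^ j) / (2 * v) = L j"
      using v L[of j] unfolding s_def by (simp add: power_mult_distrib field_simps)
    also have "exp (- L j) = \<delta> * (1 / l (real (Suc j)))"
      using \<delta> lpos[of "real (Suc j)"] unfolding L_def
      by (simp add: exp_diff ln_div ln_inverse exp_minus field_simps exp_add)
    finally show ?thesis .
  qed
  have sub: "E \<subseteq> (\<Union>j. B j)"
  proof
    fix \<omega> assume "\<omega> \<in> E"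
    then obtain t where \<omega>: "\<omega> \<in> space M" and t: "t \<ge> 1"
      and G: "C / sqrt (real t) + 2 * sqrt (v / real t * (ln (l (log 2 (real t))) + ln (1 / \<delta>))) \<le> G t (\<lambda>i. X i \<omega>)"
      unfolding E_def by auto
    obtain j where j: "2 ^ j \<le> t" "t < 2 ^ Suc j"
      using ex_power_ivl1[of 2 t] t by auto
    have tj: "real t \<le> 2 ^ Suc j"
      using j(2) by (metis less_imp_le of_nat_le_iff of_nat_numeral of_nat_power)
    let ?u = "log 2 (real t)"
    have u: "?u \<ge> 0" "?u \<le> real (Suc j)"
      using t log2_of_power_le[of t "Suc j"] j(2) by auto
    \<comment> \<open>The decrease of \<open>2 powr (- u) * ln (l u)\<close> compares
      \<open>?u\<close> with \<open>Suc j\<close>, but it is available only from 1 on. Below 1 the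
      only time is \<open>t = 1\<close>, which lies in epoch 0, and there \<open>l 0 = l 1\<close>
      finishes the comparison.\<close>
    have "(1 / 2 ^ Suc j) * ln (l (real (Suc j))) \<le> (1 / real t) * ln (l ?u)"
    proof (cases "?u \<ge> 1")
      case True
      have "2 powr (- real (Suc j)) * ln (l (real (Suc j))) \<le> 2 powr (- ?u) * ln (l ?u)"
        using True u by (intro l_decr) auto
      then show ?thesis
        using t by (simp add: powr_minus powr_realpow divide_inverse del: power_Suc of_nat_Suc)
    next
      case False
      then have "real t < 2" using t by (simp add: log_less_iff)
      then have t1: "t = 1" using t by simp
      then have "(2::nat) ^ j \<le> 2 ^ 0" using j by simp
      then have "j = 0" by (simp only: power_increasing_iff)
      moreover have "l 0 = l 1" using l_const[of 0] by simp
      moreover have "ln (l 1) \<ge> 0" using l_ge1[of 1] by simp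
      ultimately show ?thesis using t1 by simp
    qed
    moreover have "(1 / 2 ^ Suc j) * ln (1 / \<delta>) \<le> (1 / real t) * ln (1 / \<delta>)"
      using \<delta> tj t by (intro mult_right_mono divide_left_mono) auto
    ultimately have "(1 / 2 ^ Suc j) * L j \<le> (1 / real t) * (ln (l ?u) + ln (1 / \<delta>))"
      unfolding L_def by (simp add: distrib_left)
    then have "v * ((1 / 2 ^ Suc j) * L j) \<le> v * ((1 / real t) * (ln (l ?u) + ln (1 / \<delta>)))"
      using v by (intro mult_left_mono) auto
    then have "s j \<le> 2 * sqrt (v / real t * (ln (l ?u) + ln (1 / \<delta>)))"
      unfolding s_def by simp
    moreover have "C / sqrt (2 * real (2 ^ j)) \<le> C / sqrt (real t)"
      using C tj t by (intro divide_left_mono) auto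
    ultimately have "\<omega> \<in> B j"
      unfolding B_def using G \<omega> j by (auto intro!: bexI[of _ t])
    then show "\<omega> \<in> (\<Union>j. B j)" by blast
  qed
  have summ: "summable (\<lambda>j. \<delta> * (1 / l (real (Suc j))))"
    using l_sum(1) by (rule summable_mult)
  have summB: "summable (\<lambda>j. measure M (B j))"
    by (rule summable_comparison_test'[OF summ, of 0]) (use PB in auto)
  have "measure M E \<le> measure M (\<Union>j. B j)"
    using sub by (intro M.finite_measure_mono) auto
  also have "\<dots> \<le> (\<Sum>j. measure M (B j))"
    using summB by (intro M.finite_measure_subadditive_countably) auto
  also have "\<dots> \<le> (\<Sum>j. \<delta> * (1 / l (real (Suc j))))"
    using PB summ summB by (intro suminf_le) auto
  also have "\<dots> = \<delta> * (\<Sum>j. 1 / l (real (Suc j)))"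
    using l_sum(1) by (rule suminf_mult)
  also have "\<dots> \<le> \<delta> * 1"
    using l_sum(2) \<delta> by (intro mult_left_mono) auto
  finally show "measure M E \<le> \<delta>" by simp
qed

subsection \<open>Gaussian integrals\<close>

definition gauss_dens :: "real \<Rightarrow> real ^ 'd \<Rightarrow> real" where
  "gauss_dens \<sigma> x = exp (- (norm x)\<^sup>2 / (2 * \<sigma>\<^sup>2)) / sqrt (2 * pi * \<sigma>\<^sup>2) ^ CARD('d)"

lemma gaussian_eq: "gaussian \<sigma> = density lborel (\<lambda>x. ennreal (gauss_dens \<sigma> x))"
  by (simp add: gaussian_def gauss_dens_def)

lemma gauss_dens_pos: "\<sigma> > 0 \<Longrightarrow> gauss_dens \<sigma> x > 0"
  by (simp add: gauss_dens_def)

lemma gauss_dens_nonneg [simp]: "gauss_dens \<sigma> x \<ge> 0"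
  by (simp add: gauss_dens_def)

lemma gauss_dens_measurable [measurable]: "gauss_dens \<sigma> \<in> borel_measurable borel"
  unfolding gauss_dens_def by measurable

text \<open>Completing the square: the integrand is a multiple of the normal density with mean
  \<open>b / (2 * \<alpha>)\<close> and variance \<open>1 / (2 * \<alpha>)\<close>.\<close>

lemma nn_integral_exp_quadratic_real:
  fixes \<alpha> b :: real
  assumes "\<alpha> > 0"
  shows "(\<integral>\<^sup>+s. ennreal (exp (- \<alpha> * s\<^sup>2 + b * s)) \<partial>lborel) = ennreal (sqrt (pi / \<alpha>) * exp (b\<^sup>2 / (4 * \<alpha>)))"
proof -
  define m where "m = b / (2 * \<alpha>)"
  define \<sigma> where "\<sigma> = 1 / sqrt (2 * \<alpha>)"
  have \<sigma>: "\<sigma> > 0" "\<sigma>\<^sup>2 = 1 / (2 * \<alpha>)"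
    using assms by (auto simp: \<sigma>_def power_divide)
  have "exp (- \<alpha> * s\<^sup>2 + b * s) = (sqrt (pi / \<alpha>) * exp (b\<^sup>2 / (4 * \<alpha>))) * normal_density m \<sigma> s" for s
  proof -
    have "- \<alpha> * s\<^sup>2 + b * s = b\<^sup>2 / (4 * \<alpha>) + - (s - m)\<^sup>2 / (2 * \<sigma>\<^sup>2)"
      using assms unfolding \<sigma>(2) m_def by (simp add: field_simps power2_eq_square)
    then have "exp (- \<alpha> * s\<^sup>2 + b * s) = exp (b\<^sup>2 / (4 * \<alpha>)) * exp (- (s - m)\<^sup>2 / (2 * \<sigma>\<^sup>2))"
      by (simp only: exp_add)
    moreover have "2 * pi * \<sigma>\<^sup>2 = pi / \<alpha>"
      unfolding \<sigma>(2) by simp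
    ultimately show ?thesis
      unfolding normal_density_def using assms by simp
  qed
  then have "(\<integral>\<^sup>+s. ennreal (exp (- \<alpha> * s\<^sup>2 + b * s)) \<partial>lborel)
      = (\<integral>\<^sup>+s. ennreal (sqrt (pi / \<alpha>) * exp (b\<^sup>2 / (4 * \<alpha>))) * ennreal (normal_density m \<sigma> s) \<partial>lborel)"
    using assms by (simp add: ennreal_mult)
  also have "\<dots> = ennreal (sqrt (pi / \<alpha>) * exp (b\<^sup>2 / (4 * \<alpha>))) * (\<integral>\<^sup>+s. ennreal (normal_density m \<sigma> s) \<partial>lborel)"
    by (rule nn_integral_cmult) measurable
  also have "(\<integral>\<^sup>+s. ennreal (normal_density m \<sigma> s) \<partial>lborel) = 1"
    using prob_space.emeasure_space_1[OF prob_space_normal_density[OF \<sigma>(1), of m]]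
    by (simp add: emeasure_density)
  finally show ?thesis by simp
qed

text \<open>With \<open>b = 0\<close> this is a normalisation. Read from right to left it linearises
  the exponential of a squared norm, and with general \<open>b\<close> it integrates products of
  Gaussians that have different centres.\<close>

lemma nn_integral_exp_quadratic:
  fixes b :: "real ^ 'd"
  assumes "\<alpha> > 0"
  shows "(\<integral>\<^sup>+z. ennreal (exp (- \<alpha> * (norm z)\<^sup>2 + b \<bullet> z)) \<partial>lborel)
    = ennreal (sqrt (pi / \<alpha>) ^ CARD('d) * exp ((norm b)\<^sup>2 / (4 * \<alpha>)))"
proof -
  have nsq: "(norm z)\<^sup>2 = (\<Sum>k\<in>Basis. (z \<bullet> k)\<^sup>2)" for z :: "real ^ 'd"
    unfolding power2_norm_eq_inner euclidean_inner[of z z] by (simp only: power2_eq_square)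
  let ?f = "\<lambda>k s. ennreal (exp (- \<alpha> * s\<^sup>2 + (b \<bullet> k) * s))"
  have "ennreal (exp (- \<alpha> * (norm z)\<^sup>2 + b \<bullet> z)) = (\<Prod>k\<in>Basis. ?f k (z \<bullet> k))" for z :: "real ^ 'd"
  proof -
    have "- \<alpha> * (norm z)\<^sup>2 + b \<bullet> z = (\<Sum>k\<in>Basis. - \<alpha> * (z \<bullet> k)\<^sup>2 + (b \<bullet> k) * (z \<bullet> k))"
      unfolding nsq euclidean_inner[of b z] by (simp only: sum_distrib_left sum.distrib)
    then show ?thesis
      by (simp only: exp_sum[OF finite_Basis] prod_ennreal[OF exp_ge_zero])
  qed
  then have "(\<integral>\<^sup>+z. ennreal (exp (- \<alpha> * (norm z)\<^sup>2 + b \<bullet> z)) \<partial>lborel)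
      = (\<integral>\<^sup>+z. (\<Prod>k\<in>Basis. ?f k (z \<bullet> k)) \<partial>lborel)"
    by simp
  also have "\<dots> = (\<Prod>k\<in>Basis. \<integral>\<^sup>+s. ?f k s \<partial>lborel)"
    by (rule nn_integral_lborel_prod) auto
  also have "\<dots> = (\<Prod>k\<in>Basis. ennreal (sqrt (pi / \<alpha>) * exp ((b \<bullet> k)\<^sup>2 / (4 * \<alpha>))))"
    by (intro prod.cong refl nn_integral_exp_quadratic_real assms)
  also have "\<dots> = ennreal (\<Prod>k\<in>Basis. sqrt (pi / \<alpha>) * exp ((b \<bullet> k)\<^sup>2 / (4 * \<alpha>)))"
    using assms by (intro prod_ennreal) auto
  also have "(\<Prod>k\<in>Basis. sqrt (pi / \<alpha>) * exp ((b \<bullet> k)\<^sup>2 / (4 * \<alpha>)))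
      = sqrt (pi / \<alpha>) ^ CARD('d) * exp ((norm b)\<^sup>2 / (4 * \<alpha>))"
    unfolding nsq by (simp add: prod.distrib exp_sum[symmetric] sum_divide_distrib)
  finally show ?thesis .
qed

lemma nn_integral_gauss_dens:
  assumes "\<sigma> > 0"
  shows "(\<integral>\<^sup>+z. ennreal (gauss_dens \<sigma> (z :: real ^ 'd)) \<partial>lborel) = 1"
proof -
  let ?K = "sqrt (2 * pi * \<sigma>\<^sup>2) ^ CARD('d)"
  have "(\<integral>\<^sup>+z. ennreal (gauss_dens \<sigma> (z :: real ^ 'd)) \<partial>lborel)
      = (\<integral>\<^sup>+z. ennreal (1 / ?K) * ennreal (exp (- (1 / (2 * \<sigma>\<^sup>2)) * (norm (z :: real ^ 'd))\<^sup>2 + 0 \<bullet> z)) \<partial>lborel)"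
    unfolding gauss_dens_def by (intro nn_integral_cong) (simp flip: ennreal_mult)
  also have "\<dots> = ennreal (1 / ?K) * ennreal (sqrt (pi / (1 / (2 * \<sigma>\<^sup>2))) ^ CARD('d) * exp 0)"
    using assms
    by (subst nn_integral_cmult, measurable)
       (subst nn_integral_exp_quadratic, simp_all)
  also have "\<dots> = 1"
    using assms by (simp flip: ennreal_mult add: mult_ac)
  finally show ?thesis .
qed

text \<open>The second moment is estimated through \<open>x \<le> exp (x - 1)\<close>; the resulting factor 2 is
  absorbed by the slack in the constants of the theorem.\<close>
lemma nn_integral_norm_sq_gauss_dens:
  assumes a: "a > 0"
  shows "(\<integral>\<^sup>+z. ennreal ((norm z)\<^sup>2 * gauss_dens a (z :: real ^ 'd)) \<partial>lborel) \<le> ennreal (2 * real CARD('d) * a\<^sup>2)"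
proof -
  define d where "d = real CARD('d)"
  have d: "d \<ge> 1" unfolding d_def using zero_less_card_finite[where 'a='d] by linarith
  let ?K = "sqrt (2 * pi * a\<^sup>2) ^ CARD('d)"
  \<comment> \<open>The bound obtained is (1 - 2 c a^2)^(-d/2) / (c e). This \<open>c\<close> makes
    2 c a^2 equal to 2/(3d), so that Bernoulli's inequality bounds the power by sqrt 3 in every
    dimension, \<open>d = 1\<close> included; then 3 sqrt 3 / e < 2.\<close>
  define c where "c = 1 / (3 * d * a\<^sup>2)"
  define \<alpha> where "\<alpha> = 1 / (2 * a\<^sup>2) - c"
  have c: "c > 0" unfolding c_def using a d by simp
  have \<alpha>eq: "\<alpha> = (1 - 2 / (3 * d)) / (2 * a\<^sup>2)"
    unfolding \<alpha>_def c_def using a d by (simp add: field_simps)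
  have \<alpha>: "\<alpha> > 0" unfolding \<alpha>eq using a d by (simp add: field_simps)
  have pw: "(norm z)\<^sup>2 * gauss_dens a z \<le> (1 / (c * exp 1 * ?K)) * exp (- \<alpha> * (norm z)\<^sup>2 + 0 \<bullet> z)" for z :: "real ^ 'd"
  proof -
    have "c * (norm z)\<^sup>2 \<le> exp (c * (norm z)\<^sup>2 - 1)"
      using exp_ge_add_one_self[of "c * (norm z)\<^sup>2 - 1"] by simp
    then have "c * (norm z)\<^sup>2 * exp 1 \<le> exp (c * (norm z)\<^sup>2)"
      by (simp add: exp_diff field_simps)
    then have "c * (norm z)\<^sup>2 * exp 1 * exp (- (norm z)\<^sup>2 / (2 * a\<^sup>2)) \<le> exp (c * (norm z)\<^sup>2) * exp (- (norm z)\<^sup>2 / (2 * a\<^sup>2))"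
      by (intro mult_right_mono) auto
    also have "\<dots> = exp (- \<alpha> * (norm z)\<^sup>2)"
      unfolding exp_add[symmetric] \<alpha>_def by (simp add: algebra_simps)
    finally show ?thesis
      using a c unfolding gauss_dens_def by (simp add: field_simps)
  qed
  have "(\<integral>\<^sup>+z. ennreal ((norm z)\<^sup>2 * gauss_dens a (z :: real ^ 'd)) \<partial>lborel)
      \<le> (\<integral>\<^sup>+z. ennreal (1 / (c * exp 1 * ?K)) * ennreal (exp (- \<alpha> * (norm (z :: real ^ 'd))\<^sup>2 + 0 \<bullet> z)) \<partial>lborel)"
    using pw a c by (intro nn_integral_mono) (simp add: ennreal_mult[symmetric])
  also have "\<dots> = ennreal (1 / (c * exp 1 * ?K)) * ennreal (sqrt (pi / \<alpha>) ^ CARD('d) * exp 0)"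
    using \<alpha> by (subst nn_integral_cmult, measurable) (subst nn_integral_exp_quadratic, simp_all)
  also have "\<dots> = ennreal (sqrt (pi / \<alpha>) ^ CARD('d) / (c * exp 1 * ?K))"
    using a c \<alpha> by (simp flip: ennreal_mult)
  also have "\<dots> \<le> ennreal (2 * d * a\<^sup>2)"
  proof (rule ennreal_leI)
    have q: "1 - 2 / (3 * d) > 0" using d by (simp add: field_simps)
    have "sqrt (pi / \<alpha>) ^ CARD('d) / ?K = (1 / sqrt (1 - 2 / (3 * d))) ^ CARD('d)"
      unfolding power_divide[symmetric] \<alpha>eq using a q
      by (simp add: real_sqrt_divide real_sqrt_mult field_simps)
    also have "\<dots> \<le> sqrt 3"
    proof -
      have dq: "2 / (3 * d) \<le> 1" using d by (simp add: field_simps)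
      have "1 / 3 = 1 + d * (- (2 / (3 * d)))" using d by (simp add: field_simps)
      also have "\<dots> \<le> (1 + (- (2 / (3 * d)))) ^ CARD('d)"
        unfolding d_def using dq by (intro Bernoulli_inequality) (simp add: d_def)
      finally have "sqrt (1 / 3) \<le> sqrt (1 - 2 / (3 * d)) ^ CARD('d)"
        by (simp flip: real_sqrt_power)
      then show ?thesis
        using q by (simp add: power_divide real_sqrt_divide field_simps)
    qed
    finally have "sqrt (pi / \<alpha>) ^ CARD('d) / ?K * (3 * d * a\<^sup>2 / exp 1) \<le> sqrt 3 * (3 * d * a\<^sup>2 / exp 1)"
      using d by (intro mult_right_mono) auto
    also have "\<dots> = (3 * sqrt 3 / exp 1) * (d * a\<^sup>2)" by simp
    also have "\<dots> \<le> 2 * (d * a\<^sup>2)"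
    proof (intro mult_right_mono)
      have "sqrt 3 \<le> (1.7321 :: real)" by (rule real_le_lsqrt) (auto simp: power2_eq_square)
      moreover have "exp 1 \<ge> (2.6 :: real)"
        using e_approx_32 by (simp add: abs_if split: if_split_asm)
      ultimately show "3 * sqrt 3 / exp 1 \<le> (2::real)"
        by (simp add: field_simps)
    qed (use d in auto)
    finally show "sqrt (pi / \<alpha>) ^ CARD('d) / (c * exp 1 * ?K) \<le> 2 * d * a\<^sup>2"
      using a d unfolding c_def by (simp add: field_simps)
  qed
  finally show ?thesis unfolding d_def .
qed

subsection \<open>Mean deviation of the smoothed empirical density\<close>

lemma nn_integral_lborel_shift:
  fixes f :: "'a::euclidean_space \<Rightarrow> ennreal"
  assumes [measurable]: "f \<in> borel_measurable borel"
  shows "(\<integral>\<^sup>+z. f (z + c) \<partial>lborel) = (\<integral>\<^sup>+z. f z \<partial>lborel)"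
proof -
  have "(\<integral>\<^sup>+z. f z \<partial>lborel) = (\<integral>\<^sup>+z. f z \<partial>distr lborel borel ((+) c))"
    by (simp add: lborel_distr_plus)
  also have "\<dots> = (\<integral>\<^sup>+z. f (c + z) \<partial>lborel)"
    by (subst nn_integral_distr) auto
  finally show ?thesis by (simp add: add.commute)
qed

text \<open>The exponential is linearised by a Gaussian integral over an auxiliary direction \<open>z\<close>.\<close>
lemma sub_gaussian_exp_norm_sq:
  fixes P :: "(real ^ 'd) measure"
  assumes P: "prob_space P" "sets P = sets borel" and sub: "sub_gaussian P (\<lambda>x. x) (\<tau>\<^sup>2)"
    and \<eta>: "\<eta> > 0" "2 * \<eta> * \<tau>\<^sup>2 < 1"
  defines "m \<equiv> (LINT x|P. x)"
  shows "(\<integral>\<^sup>+x. ennreal (exp (\<eta> * (norm (x - m))\<^sup>2)) \<partial>P) \<le> ennreal ((1 / sqrt (1 - 2 * \<eta> * \<tau>\<^sup>2)) ^ CARD('d))"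
proof -
  interpret P: prob_space P by fact
  interpret pair_sigma_finite P "lborel :: (real ^ 'd) measure" ..
  note [measurable_cong] = P(2)
  \<comment> \<open>Chosen so that the auxiliary integral has exponent
    \<open>(norm y)\<^sup>2 / (4 * \<alpha>)\<close>, which is
    \<open>\<eta> * (norm y)\<^sup>2\<close>. The sub-Gaussian bound lowers the quadratic
    coefficient to \<open>\<beta>\<close>, positive exactly when
    \<open>2 * \<eta> * \<tau>\<^sup>2 < 1\<close>.\<close>
  define \<alpha> where "\<alpha> = 1 / (4 * \<eta>)"
  define \<beta> where "\<beta> = \<alpha> - \<tau>\<^sup>2 / 2"
  have \<alpha>: "\<alpha> > 0" using \<eta> by (simp add: \<alpha>_def)
  have \<beta>: "\<beta> > 0" using \<eta> by (simp add: \<alpha>_def \<beta>_def field_simps)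
  let ?K = "sqrt (pi / \<alpha>) ^ CARD('d)"
  have K: "?K > 0" using \<alpha> by simp
  have "exp (\<eta> * (norm y)\<^sup>2) = exp ((norm y)\<^sup>2 / (4 * \<alpha>))" for y :: "real ^ 'd"
    using \<eta> by (simp add: \<alpha>_def mult.commute)
  then have lin: "ennreal ?K * ennreal (exp (\<eta> * (norm y)\<^sup>2)) = (\<integral>\<^sup>+z. ennreal (exp (- \<alpha> * (norm z)\<^sup>2 + y \<bullet> z)) \<partial>lborel)"
    for y :: "real ^ 'd"
    using nn_integral_exp_quadratic[OF \<alpha>, of y] K by (simp add: ennreal_mult[symmetric])
  have "ennreal ?K * (\<integral>\<^sup>+x. ennreal (exp (\<eta> * (norm (x - m))\<^sup>2)) \<partial>P)
      = (\<integral>\<^sup>+x. ennreal ?K * ennreal (exp (\<eta> * (norm (x - m))\<^sup>2)) \<partial>P)"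
    by (rule nn_integral_cmult[symmetric]) measurable
  also have "\<dots> = (\<integral>\<^sup>+x. \<integral>\<^sup>+z. ennreal (exp (- \<alpha> * (norm z)\<^sup>2 + (x - m) \<bullet> z)) \<partial>lborel \<partial>P)"
    by (simp only: lin)
  also have "\<dots> = (\<integral>\<^sup>+z. \<integral>\<^sup>+x. ennreal (exp (- \<alpha> * (norm z)\<^sup>2 + (x - m) \<bullet> z)) \<partial>P \<partial>lborel)"
    by (rule Fubini'[symmetric]) measurable
  also have "\<dots> = (\<integral>\<^sup>+z. ennreal (exp (- \<alpha> * (norm z)\<^sup>2)) * (\<integral>\<^sup>+x. ennreal (exp (z \<bullet> (x - m))) \<partial>P) \<partial>lborel)"
    by (simp only: exp_add ennreal_mult[OF exp_ge_zero exp_ge_zero] inner_commute[of "_ - m"])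
       (intro nn_integral_cong nn_integral_cmult, measurable)
  also have "\<dots> \<le> (\<integral>\<^sup>+z. ennreal (exp (- \<alpha> * (norm (z :: real ^ 'd))\<^sup>2)) * ennreal (exp ((norm z)\<^sup>2 * \<tau>\<^sup>2 / 2)) \<partial>lborel)"
    using sub unfolding sub_gaussian_def m_def by (intro nn_integral_mono mult_left_mono) auto
  also have "\<dots> = (\<integral>\<^sup>+z. ennreal (exp (- \<beta> * (norm (z :: real ^ 'd))\<^sup>2 + 0 \<bullet> z)) \<partial>lborel)"
    unfolding \<beta>_def by (intro nn_integral_cong) (simp add: ennreal_mult[symmetric] exp_add[symmetric] algebra_simps)
  also have "\<dots> = ennreal (sqrt (pi / \<beta>) ^ CARD('d))"
    using nn_integral_exp_quadratic[OF \<beta>, of "0 :: real ^ 'd"] by simp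
  also have "\<dots> = ennreal ?K * ennreal ((1 / sqrt (1 - 2 * \<eta> * \<tau>\<^sup>2)) ^ CARD('d))"
  proof -
    have "pi / \<beta> = pi / \<alpha> * (1 / (1 - 2 * \<eta> * \<tau>\<^sup>2))"
      using \<eta> by (simp add: \<alpha>_def \<beta>_def field_simps)
    then have "sqrt (pi / \<beta>) = sqrt (pi / \<alpha>) * (1 / sqrt (1 - 2 * \<eta> * \<tau>\<^sup>2))"
      by (simp only: real_sqrt_mult real_sqrt_divide real_sqrt_one)
    then show ?thesis
      using K \<eta> by (simp add: power_mult_distrib power_divide ennreal_mult[symmetric])
  qed
  finally have "ennreal ?K * (\<integral>\<^sup>+x. ennreal (exp (\<eta> * (norm (x - m))\<^sup>2)) \<partial>P)
      \<le> ennreal ?K * ennreal ((1 / sqrt (1 - 2 * \<eta> * \<tau>\<^sup>2)) ^ CARD('d))" .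
  then show ?thesis
    using \<alpha> by (subst (asm) ennreal_mult_le_mult_iff) auto
qed

text \<open>The quotient is again an exponential of a quadratic, with leading coefficient
  \<open>- D / (2 * a\<^sup>2 * \<sigma>\<^sup>2)\<close>; positivity of \<open>D\<close> is what
  makes it integrable. The growth \<open>exp ((norm y)\<^sup>2 / D)\<close> in the centre is the
  reason for the exponential moment of the squared norm above.\<close>

lemma nn_integral_gauss_dens_sq_divide:
  fixes y :: "real ^ 'd"
  assumes \<sigma>: "\<sigma> > 0" and a: "a > 0" "2 * a\<^sup>2 > \<sigma>\<^sup>2"
  defines "D \<equiv> 2 * a\<^sup>2 - \<sigma>\<^sup>2"
  shows "(\<integral>\<^sup>+z. ennreal ((gauss_dens \<sigma> (z - y))\<^sup>2 / gauss_dens a z) \<partial>lborel)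
    = ennreal ((a\<^sup>2 / (\<sigma> * sqrt D)) ^ CARD('d) * exp ((norm y)\<^sup>2 / D))"
proof -
  have D: "D > 0" using a by (simp add: D_def)
  define \<alpha> where "\<alpha> = D / (2 * a\<^sup>2 * \<sigma>\<^sup>2)"
  have \<alpha>: "\<alpha> > 0" using D a \<sigma> by (simp add: \<alpha>_def)
  define b where "b = (2 / \<sigma>\<^sup>2) *\<^sub>R y"
  let ?k = "sqrt (2 * pi * a\<^sup>2) / (2 * pi * \<sigma>\<^sup>2)"
  define K where "K = ?k ^ CARD('d) * exp (- (norm y)\<^sup>2 / \<sigma>\<^sup>2)"
  have K: "K \<ge> 0" by (simp add: K_def)
  have pw: "(gauss_dens \<sigma> (z - y))\<^sup>2 / gauss_dens a z = K * exp (- \<alpha> * (norm z)\<^sup>2 + b \<bullet> z)" for z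
  proof -
    have e: "2 * (- (norm (z - y))\<^sup>2 / (2 * \<sigma>\<^sup>2)) - - (norm z)\<^sup>2 / (2 * a\<^sup>2)
        = - (norm y)\<^sup>2 / \<sigma>\<^sup>2 + (- \<alpha> * (norm z)\<^sup>2 + b \<bullet> z)"
    proof -
      have n: "(norm (z - y))\<^sup>2 = (norm z)\<^sup>2 - 2 * (y \<bullet> z) + (norm y)\<^sup>2"
        by (simp add: power2_norm_eq_inner inner_diff inner_commute)
      show ?thesis
        unfolding n \<alpha>_def b_def D_def using \<sigma> a by (simp add: field_simps)
    qed
    have "(gauss_dens \<sigma> (z - y))\<^sup>2 / gauss_dens a z
      = exp (2 * (- (norm (z - y))\<^sup>2 / (2 * \<sigma>\<^sup>2)) - - (norm z)\<^sup>2 / (2 * a\<^sup>2)) * ?k ^ CARD('d)"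
      unfolding gauss_dens_def exp_diff exp_double power_divide using \<sigma>
      by (simp add: power_mult[symmetric] mult.commute[of _ 2] power_mult)
    then show ?thesis
      unfolding e K_def by (simp only: exp_add mult_ac)
  qed
  have "(\<integral>\<^sup>+z. ennreal ((gauss_dens \<sigma> (z - y))\<^sup>2 / gauss_dens a z) \<partial>lborel)
      = ennreal K * (\<integral>\<^sup>+z. ennreal (exp (- \<alpha> * (norm z)\<^sup>2 + b \<bullet> z)) \<partial>lborel)"
    unfolding pw using K by (subst nn_integral_cmult[symmetric]) (auto simp: ennreal_mult)
  also have "\<dots> = ennreal (K * (sqrt (pi / \<alpha>) ^ CARD('d) * exp ((norm b)\<^sup>2 / (4 * \<alpha>))))"
    unfolding nn_integral_exp_quadratic[OF \<alpha>] using K \<alpha> by (simp add: ennreal_mult)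
  also have "K * (sqrt (pi / \<alpha>) ^ CARD('d) * exp ((norm b)\<^sup>2 / (4 * \<alpha>)))
      = (?k * sqrt (pi / \<alpha>)) ^ CARD('d) * exp (- (norm y)\<^sup>2 / \<sigma>\<^sup>2 + (norm b)\<^sup>2 / (4 * \<alpha>))"
    unfolding K_def by (simp only: power_mult_distrib exp_add mult_ac)
  also have "- (norm y)\<^sup>2 / \<sigma>\<^sup>2 + (norm b)\<^sup>2 / (4 * \<alpha>) = (norm y)\<^sup>2 / D"
  proof -
    have "(norm b)\<^sup>2 = 4 * (norm y)\<^sup>2 / \<sigma>\<^sup>2 ^ 2"
      unfolding b_def using \<sigma> by (simp add: power_divide power_mult_distrib)
    then have "- (norm y)\<^sup>2 / \<sigma>\<^sup>2 + (norm b)\<^sup>2 / (4 * \<alpha>) = (norm y)\<^sup>2 * ((2 * a\<^sup>2 - D) / (\<sigma>\<^sup>2 * D))"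
      unfolding \<alpha>_def using \<sigma> a D by (simp add: field_simps power2_eq_square)
    also have "(2 * a\<^sup>2 - D) / (\<sigma>\<^sup>2 * D) = 1 / D"
      unfolding D_def using \<sigma> by simp
    finally show ?thesis by simp
  qed
  also have "?k * sqrt (pi / \<alpha>) = a\<^sup>2 / (\<sigma> * sqrt D)"
  proof -
    have "sqrt (2 * pi * a\<^sup>2) * sqrt (pi / \<alpha>) = sqrt ((2 * pi * a\<^sup>2 * \<sigma>)\<^sup>2 / D)"
      unfolding real_sqrt_mult[symmetric] \<alpha>_def using a \<sigma> by (simp add: field_simps power2_eq_square)
    also have "\<dots> = 2 * pi * a\<^sup>2 * \<sigma> / sqrt D"
      using a \<sigma> by (simp add: real_sqrt_divide)
    finally show ?thesis
      using \<sigma> D by (simp add: field_simps power2_eq_square)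
  qed
  finally show ?thesis .
qed

text \<open>For a general reference deviation \<open>a\<close> the two preceding estimates give, per
  coordinate, the factor a^2 / (sigma sqrt(2 a^2 - sigma^2 - 2 tau^2)). It is smallest at
  \<open>a\<^sup>2 = 2 * \<tau>\<^sup>2 + \<sigma>\<^sup>2\<close>, where its value is
  \<open>a / \<sigma>\<close>. This is the origin of the reference variance.\<close>

lemma nn_integral_chi_square:
  fixes P :: "(real ^ 'd) measure"
  assumes P: "prob_space P" "sets P = sets borel" and sub: "sub_gaussian P (\<lambda>x. x) (\<tau>\<^sup>2)"
    and \<sigma>: "\<sigma> > 0" and \<tau>: "\<tau> > 0" and a: "a > 0" "a\<^sup>2 = 2 * \<tau>\<^sup>2 + \<sigma>\<^sup>2"
  defines "m \<equiv> (LINT x|P. x)"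
  shows "(\<integral>\<^sup>+z. \<integral>\<^sup>+x. ennreal ((gauss_dens \<sigma> (z - x))\<^sup>2 / gauss_dens a (z - m)) \<partial>P \<partial>lborel) \<le> ennreal ((a / \<sigma>) ^ CARD('d))"
proof -
  interpret P: prob_space P by fact
  interpret pair_sigma_finite P "lborel :: (real ^ 'd) measure" ..
  note [measurable_cong] = P(2)
  define D where "D = 2 * a\<^sup>2 - \<sigma>\<^sup>2"
  have D: "D = 4 * \<tau>\<^sup>2 + \<sigma>\<^sup>2" "D > 0" using a \<sigma> by (simp_all add: D_def add_pos_nonneg)
  have aD: "2 * a\<^sup>2 > \<sigma>\<^sup>2" using D by (simp add: D_def)
  let ?K = "(a\<^sup>2 / (\<sigma> * sqrt D)) ^ CARD('d)"
  have "(\<integral>\<^sup>+z. \<integral>\<^sup>+x. ennreal ((gauss_dens \<sigma> (z - x))\<^sup>2 / gauss_dens a (z - m)) \<partial>P \<partial>lborel)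
      = (\<integral>\<^sup>+x. \<integral>\<^sup>+z. ennreal ((gauss_dens \<sigma> (z - x))\<^sup>2 / gauss_dens a (z - m)) \<partial>lborel \<partial>P)"
    by (rule Fubini') measurable
  also have "\<dots> = (\<integral>\<^sup>+x. ennreal ?K * ennreal (exp (1 / D * (norm (x - m))\<^sup>2)) \<partial>P)"
  proof (rule nn_integral_cong)
    fix x
    have "(\<integral>\<^sup>+z. ennreal ((gauss_dens \<sigma> (z - x))\<^sup>2 / gauss_dens a (z - m)) \<partial>lborel)
        = (\<integral>\<^sup>+z. ennreal ((gauss_dens \<sigma> (z + m - x))\<^sup>2 / gauss_dens a (z + m - m)) \<partial>lborel)"
      by (rule nn_integral_lborel_shift[symmetric]) measurable
    also have "\<dots> = (\<integral>\<^sup>+z. ennreal ((gauss_dens \<sigma> (z - (x - m)))\<^sup>2 / gauss_dens a z) \<partial>lborel)"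
      by (simp add: algebra_simps)
    also have "\<dots> = ennreal (?K * exp ((norm (x - m))\<^sup>2 / D))"
      unfolding D_def by (rule nn_integral_gauss_dens_sq_divide[OF \<sigma> a(1) aD])
    finally show "(\<integral>\<^sup>+z. ennreal ((gauss_dens \<sigma> (z - x))\<^sup>2 / gauss_dens a (z - m)) \<partial>lborel)
        = ennreal ?K * ennreal (exp (1 / D * (norm (x - m))\<^sup>2))"
      using \<sigma> D by (simp add: ennreal_mult)
  qed
  also have "\<dots> = ennreal ?K * (\<integral>\<^sup>+x. ennreal (exp (1 / D * (norm (x - m))\<^sup>2)) \<partial>P)"
    by (rule nn_integral_cmult) measurable
  \<comment> \<open>The exponent \<open>1 / D\<close> is admissible because
    \<open>D = 4 * \<tau>\<^sup>2 + \<sigma>\<^sup>2\<close> exceeds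
    \<open>2 * \<tau>\<^sup>2\<close>.\<close>
  also have "\<dots> \<le> ennreal ?K * ennreal ((1 / sqrt (1 - 2 * (1 / D) * \<tau>\<^sup>2)) ^ CARD('d))"
    unfolding m_def using D \<sigma> \<tau>
    by (intro mult_left_mono sub_gaussian_exp_norm_sq P sub) (auto simp: field_simps add_pos_pos)
  also have "\<dots> = ennreal ((a / \<sigma>) ^ CARD('d))"
  proof -
    have "1 - 2 * (1 / D) * \<tau>\<^sup>2 = a\<^sup>2 / D"
      using D a by (simp add: field_simps)
    then have q: "1 / sqrt (1 - 2 * (1 / D) * \<tau>\<^sup>2) = sqrt D / a"
      using a(1) by (simp only: real_sqrt_divide real_sqrt_abs abs_of_pos divide_divide_eq_right mult_1)
    have "a\<^sup>2 / (\<sigma> * sqrt D) * (1 / sqrt (1 - 2 * (1 / D) * \<tau>\<^sup>2)) = a / \<sigma>"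
      unfolding q using D(2) a(1) by (simp add: field_simps power2_eq_square)
    then have "?K * (1 / sqrt (1 - 2 * (1 / D) * \<tau>\<^sup>2)) ^ CARD('d) = (a / \<sigma>) ^ CARD('d)"
      by (simp only: power_mult_distrib[symmetric])
    moreover have "(1 / sqrt (1 - 2 * (1 / D) * \<tau>\<^sup>2)) ^ CARD('d) \<ge> 0"
      using \<open>1 - 2 * (1 / D) * \<tau>\<^sup>2 = a\<^sup>2 / D\<close> D by (simp add: zero_le_divide_iff)
    ultimately show ?thesis
      using \<sigma> D by (simp add: ennreal_mult[symmetric])
  qed
  finally show ?thesis .
qed

text \<open>Pairwise independence removes the off-diagonal terms, and a variance is at most the
  second moment. Boundedness of \<open>h\<close> supplies all integrability; the Gaussian kernels to
  which the bound is applied are bounded.\<close>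

lemma nn_integral_empirical_variance:
  fixes h :: "'a::topological_space \<Rightarrow> real" and M :: "'w measure"
  assumes M: "prob_space M"
    and indep: "prob_space.indep_vars M (\<lambda>_. borel) X {1..}"
    and law: "\<And>i. i \<ge> 1 \<Longrightarrow> distr M borel (X i) = P"
    and h [measurable]: "h \<in> borel_measurable borel" and bdd: "\<And>x. \<bar>h x\<bar> \<le> K" and t: "t \<ge> 1"
  shows "(\<integral>\<^sup>+\<omega>. ennreal (((\<Sum>i=1..t. h (X i \<omega>)) / real t - (LINT x|P. h x))\<^sup>2) \<partial>M)
    \<le> (\<integral>\<^sup>+x. ennreal ((h x)\<^sup>2) \<partial>P) / of_nat t"
proof -
  interpret M: prob_space M by fact
  have X [measurable]: "X i \<in> measurable M borel" if "i \<in> {1..t}" for i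
    using indep that by (auto simp: M.indep_vars_def)
  have setsP [measurable_cong]: "sets P = sets borel" using law[of 1] by auto
  interpret P: prob_space P
    using M.prob_space_distr[of "X 1" borel] X[of 1] t law[of 1] by simp
  define \<mu> where "\<mu> = (LINT x|P. h x)"
  define Y where "Y i \<omega> = h (X i \<omega>) - \<mu>" for i \<omega>
  let ?E = "\<lambda>i j. LINT \<omega>|M. Y i \<omega> * Y j \<omega>"
    and ?S = "\<lambda>\<omega>. \<Sum>i=1..t. \<Sum>j=1..t. Y i \<omega> * Y j \<omega>"
  have K: "K \<ge> 0" using bdd[of undefined] by simp
  have inth: "integrable P h"
    by (rule P.integrable_const_bound[where B = K]) (use bdd in auto)
  have inth2: "integrable P (\<lambda>x. (h x)\<^sup>2)"
  proof (rule P.integrable_const_bound[where B = "K\<^sup>2"])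
    show "AE x in P. norm ((h x)\<^sup>2) \<le> K\<^sup>2"
      using bdd by (auto simp: abs_le_square_iff[symmetric] K power2_le_iff_abs_le)
  qed measurable
  have Yb: "\<bar>Y i \<omega>\<bar> \<le> K + \<bar>\<mu>\<bar>" for i \<omega>
    unfolding Y_def using bdd[of "X i \<omega>"] by linarith
  have Ym [measurable]: "Y i \<in> borel_measurable M" if "i \<in> {1..t}" for i
    using X[OF that] unfolding Y_def by measurable
  have intY: "integrable M (Y i)" if "i \<in> {1..t}" for i
    by (rule M.integrable_const_bound[where B = "K + \<bar>\<mu>\<bar>"]) (use Yb that in auto)
  have intYY: "integrable M (\<lambda>\<omega>. Y i \<omega> * Y j \<omega>)" if "i \<in> {1..t}" "j \<in> {1..t}" for i j
  proof (rule M.integrable_const_bound[where B = "(K + \<bar>\<mu>\<bar>) * (K + \<bar>\<mu>\<bar>)"])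
    show "AE \<omega> in M. norm (Y i \<omega> * Y j \<omega>) \<le> (K + \<bar>\<mu>\<bar>) * (K + \<bar>\<mu>\<bar>)"
      unfolding real_norm_def abs_mult by (intro always_eventually allI mult_mono Yb) (use K in auto)
  qed (use that in measurable)
  have EY: "(LINT \<omega>|M. Y i \<omega>) = 0" if "i \<in> {1..t}" for i
  proof -
    have "(LINT \<omega>|M. Y i \<omega>) = (LINT x|P. h x - \<mu>)"
      using that unfolding Y_def law[of i, symmetric, OF atLeastAtMost_iff[THEN iffD1, THEN conjunct1, OF that]]
      by (subst integral_distr) auto
    also have "\<dots> = 0" using inth by (simp add: \<mu>_def P.prob_space)
    finally show ?thesis .
  qed
  have EY2: "?E i i \<le> (LINT x|P. (h x)\<^sup>2)" if "i \<in> {1..t}" for i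
  proof -
    have "?E i i = (LINT x|P. (h x - \<mu>) * (h x - \<mu>))"
      using that unfolding Y_def law[of i, symmetric, OF atLeastAtMost_iff[THEN iffD1, THEN conjunct1, OF that]]
      by (subst integral_distr) auto
    also have "\<dots> = (LINT x|P. (h x)\<^sup>2 - (2 * \<mu>) * h x + \<mu>\<^sup>2)"
      by (simp add: power2_eq_square algebra_simps)
    also have "\<dots> = (LINT x|P. (h x)\<^sup>2) - \<mu>\<^sup>2"
      using inth inth2 by (simp add: P.prob_space \<mu>_def power2_eq_square)
    finally show ?thesis by simp
  qed
  have EYY: "?E i j = 0" if ij: "i \<in> {1..t}" "j \<in> {1..t}" "i \<noteq> j" for i j
  proof -
    have "M.indep_vars (\<lambda>_. borel) Y {1..}"
      unfolding Y_def by (rule M.indep_vars_compose2[OF indep]) auto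
    then have "M.indep_vars (\<lambda>_. borel) Y {i, j}"
      by (rule M.indep_vars_subset) (use ij in auto)
    then have "(LINT \<omega>|M. (\<Prod>k\<in>{i, j}. Y k \<omega>)) = (\<Prod>k\<in>{i, j}. (LINT \<omega>|M. Y k \<omega>))"
      using intY ij by (intro M.indep_vars_lebesgue_integral) auto
    then show ?thesis using EY ij by simp
  qed
  have eq: "(\<Sum>i=1..t. h (X i \<omega>)) / real t - \<mu> = (\<Sum>i=1..t. Y i \<omega>) / real t" for \<omega>
    unfolding Y_def using t by (simp add: sum_subtractf field_simps)
  have eq2: "((\<Sum>i=1..t. Y i \<omega>) / real t)\<^sup>2 = ?S \<omega> / (real t)\<^sup>2" for \<omega>
    by (simp add: power_divide power2_eq_square sum_product)
  have int: "integrable M (\<lambda>\<omega>. ?S \<omega> / (real t)\<^sup>2)"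
    using intYY by (intro integrable_divide Bochner_Integration.integrable_sum) auto
  have "(\<integral>\<^sup>+\<omega>. ennreal (((\<Sum>i=1..t. h (X i \<omega>)) / real t - \<mu>)\<^sup>2) \<partial>M)
      = ennreal (LINT \<omega>|M. ?S \<omega> / (real t)\<^sup>2)"
    unfolding eq eq2 by (rule nn_integral_eq_integral[OF int]) (simp only: eq2[symmetric] zero_le_power2 eventually_True)
  also have "(LINT \<omega>|M. ?S \<omega> / (real t)\<^sup>2)
      = (\<Sum>i=1..t. \<Sum>j=1..t. ?E i j) / (real t)\<^sup>2"
    using intYY by (simp only: integral_divide_zero)
      (subst Bochner_Integration.integral_sum, force, rule arg_cong[where f="\<lambda>x. x / _"],
       intro sum.cong refl Bochner_Integration.integral_sum, auto)
  also have "(\<Sum>i=1..t. \<Sum>j=1..t. ?E i j) = (\<Sum>i=1..t. ?E i i)"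
  proof (rule sum.cong[OF refl])
    fix i assume i: "i \<in> {1..t}"
    have "(\<Sum>j=1..t. ?E i j) = (\<Sum>j=1..t. if j = i then ?E i i else 0)"
      using EYY i by (intro sum.cong) auto
    then show "(\<Sum>j=1..t. ?E i j) = ?E i i"
      using i by simp
  qed
  also have "ennreal (\<dots> / (real t)\<^sup>2) \<le> ennreal ((\<Sum>i=1..t. (LINT x|P. (h x)\<^sup>2)) / (real t)\<^sup>2)"
    by (intro ennreal_leI divide_right_mono sum_mono EY2) auto
  also have "\<dots> = ennreal ((LINT x|P. (h x)\<^sup>2) / real t)"
    using t by (simp add: power2_eq_square)
  also have "\<dots> = (\<integral>\<^sup>+x. ennreal ((h x)\<^sup>2) \<partial>P) / of_nat t"
    using t inth2 by (subst nn_integral_eq_integral) (auto simp: divide_ennreal ennreal_of_nat_eq_real_of_nat)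
  finally show ?thesis unfolding \<mu>_def .
qed


text \<open>The weight \<open>w\<close> is split off by the AM-GM inequality against the reference density
  \<open>gauss_dens a\<close>, which leaves a weighted chi-square functional of the empirical density.\<close>
lemma nn_integral_weighted_density_deviation:
  fixes P :: "(real ^ 'd) measure" and M :: "'w measure" and w :: "real ^ 'd \<Rightarrow> real"
  assumes M: "prob_space M"
    and indep: "prob_space.indep_vars M (\<lambda>_. borel) X {1..}"
    and law: "\<And>i. i \<ge> 1 \<Longrightarrow> distr M borel (X i) = P"
    and sub: "sub_gaussian P (\<lambda>x. x) (\<tau>\<^sup>2)"
    and \<sigma>: "\<sigma> > 0" and \<tau>: "\<tau> > 0" and a: "a > 0" "a\<^sup>2 = 2 * \<tau>\<^sup>2 + \<sigma>\<^sup>2" and t: "t \<ge> 1"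
    and w [measurable]: "w \<in> borel_measurable borel" and w0: "\<And>z. w z \<ge> 0" and A: "A > 0"
  defines "m \<equiv> (LINT x|P. x)"
  assumes wA: "(\<integral>\<^sup>+z. ennreal ((w z)\<^sup>2 * gauss_dens a (z - m)) \<partial>lborel) \<le> ennreal A"
  shows "(\<integral>\<^sup>+\<omega>. \<integral>\<^sup>+z. ennreal (w z * \<bar>(\<Sum>i=1..t. gauss_dens \<sigma> (z - X i \<omega>)) / real t
      - (LINT x|P. gauss_dens \<sigma> (z - x))\<bar>) \<partial>lborel \<partial>M) \<le> ennreal (sqrt (A * (a / \<sigma>) ^ CARD('d) / real t))"
proof -
  interpret M: prob_space M by fact
  interpret pair_sigma_finite M "lborel :: (real ^ 'd) measure" ..
  have X [measurable]: "X i \<in> measurable M borel" if "i \<in> {1..t}" for i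
    using indep that by (auto simp: M.indep_vars_def)
  have setsP [measurable_cong]: "sets P = sets borel" using law[of 1] by auto
  interpret P: prob_space P
    using M.prob_space_distr[of "X 1" borel] X[of 1] t law[of 1] by simp
  let ?q = "\<lambda>\<omega> z. (\<Sum>i=1..t. gauss_dens \<sigma> (z - X i \<omega>)) / real t - (LINT x|P. gauss_dens \<sigma> (z - x))"
  have mX [measurable]: "(\<lambda>(\<omega>, z). \<Sum>i=1..t. gauss_dens \<sigma> (z - X i \<omega>)) \<in> borel_measurable (M \<Otimes>\<^sub>M lborel)"
    unfolding split_def by (intro borel_measurable_sum) measurable
  have mq: "(\<lambda>(\<omega>, z). ?q \<omega> z) \<in> borel_measurable (M \<Otimes>\<^sub>M lborel)"
    using mX unfolding split_def by measurable
  have mq' [measurable]: "(\<lambda>x. ?q (fst x) (snd x)) \<in> borel_measurable (M \<Otimes>\<^sub>M lborel)"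
    using mq by (simp add: split_def)
  have mq1 [measurable]: "(\<lambda>z. ?q \<omega> z) \<in> borel_measurable lborel" for \<omega>
    by measurable
  have mq2 [measurable]: "(\<lambda>\<omega>. ?q \<omega> z) \<in> borel_measurable M" for z
    by (intro borel_measurable_diff borel_measurable_divide borel_measurable_sum) measurable
  let ?B = "(a / \<sigma>) ^ CARD('d)"
  let ?f = "\<lambda>z. gauss_dens a (z - m)"
  have B: "?B > 0" using a \<sigma> by simp
  \<comment> \<open>Balances the AM-GM split: both terms become half of
    \<open>sqrt (A * ?B / real t)\<close>.\<close>
  define \<epsilon> where "\<epsilon> = sqrt (?B / (real t * A))"
  have \<epsilon>: "\<epsilon> > 0" unfolding \<epsilon>_def using B A t by simp
  have f: "?f z > 0" for z using gauss_dens_pos[OF a(1)] .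
  have amgm: "w z * \<bar>q\<bar> \<le> \<epsilon> / 2 * ((w z)\<^sup>2 * ?f z) + 1 / (2 * \<epsilon>) * (q\<^sup>2 / ?f z)" for z q
  proof -
    have "0 \<le> (\<epsilon> * w z * ?f z - \<bar>q\<bar>)\<^sup>2 / (2 * \<epsilon> * ?f z)"
      using \<epsilon> f[of z] by simp
    also have "\<dots> = \<epsilon> / 2 * ((w z)\<^sup>2 * ?f z) + 1 / (2 * \<epsilon>) * (q\<^sup>2 / ?f z) - w z * \<bar>q\<bar>"
      using \<epsilon> f[of z] by (simp add: power2_diff power_mult_distrib field_simps) (simp add: power2_eq_square)
    finally show ?thesis by simp
  qed
  \<comment> \<open>At a fixed \<open>z\<close> the squared deviation is the variance of an average
    of bounded kernels. Integrating over \<open>z\<close> against the reciprocal of the reference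
    density leaves the chi-square integral divided by \<open>t\<close>.\<close>
  have chi: "(\<integral>\<^sup>+z. \<integral>\<^sup>+\<omega>. ennreal ((?q \<omega> z)\<^sup>2 / ?f z) \<partial>M \<partial>lborel) \<le> ennreal (?B / real t)"
  proof -
    have "(\<integral>\<^sup>+z. \<integral>\<^sup>+\<omega>. ennreal ((?q \<omega> z)\<^sup>2 / ?f z) \<partial>M \<partial>lborel)
        \<le> (\<integral>\<^sup>+z. (\<integral>\<^sup>+x. ennreal ((gauss_dens \<sigma> (z - x))\<^sup>2 / ?f z) \<partial>P) / of_nat t \<partial>lborel)"
    proof (rule nn_integral_mono)
      fix z :: "real ^ 'd"
      have bdd: "\<bar>gauss_dens \<sigma> (z - x)\<bar> \<le> 1 / sqrt (2 * pi * \<sigma>\<^sup>2) ^ CARD('d)" for x :: "real ^ 'd"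
        using \<sigma> unfolding gauss_dens_def by (simp add: divide_right_mono)
      have "(\<integral>\<^sup>+\<omega>. ennreal ((?q \<omega> z)\<^sup>2 / ?f z) \<partial>M) = (\<integral>\<^sup>+\<omega>. ennreal ((?q \<omega> z)\<^sup>2) * ennreal (1 / ?f z) \<partial>M)"
        using f[of z] by (intro nn_integral_cong) (simp flip: ennreal_mult)
      also have "\<dots> = (\<integral>\<^sup>+\<omega>. ennreal ((?q \<omega> z)\<^sup>2) \<partial>M) * ennreal (1 / ?f z)"
        by (rule nn_integral_multc) measurable
      also have "\<dots> \<le> ((\<integral>\<^sup>+x. ennreal ((gauss_dens \<sigma> (z - x))\<^sup>2) \<partial>P) / of_nat t) * ennreal (1 / ?f z)"
        by (intro mult_right_mono nn_integral_empirical_variance[OF M indep law, where h="\<lambda>x. gauss_dens \<sigma> (z - x)", OF _ _ bdd t]) auto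
      also have "\<dots> = ((\<integral>\<^sup>+x. ennreal ((gauss_dens \<sigma> (z - x))\<^sup>2) \<partial>P) * ennreal (1 / ?f z)) / of_nat t"
        by (simp add: divide_ennreal_def mult_ac)
      also have "(\<integral>\<^sup>+x. ennreal ((gauss_dens \<sigma> (z - x))\<^sup>2) \<partial>P) * ennreal (1 / ?f z)
          = (\<integral>\<^sup>+x. ennreal ((gauss_dens \<sigma> (z - x))\<^sup>2) * ennreal (1 / ?f z) \<partial>P)"
        by (rule nn_integral_multc[symmetric]) measurable
      also have "\<dots> = (\<integral>\<^sup>+x. ennreal ((gauss_dens \<sigma> (z - x))\<^sup>2 / ?f z) \<partial>P)"
        using f[of z] by (intro nn_integral_cong) (simp flip: ennreal_mult)
      finally show "(\<integral>\<^sup>+\<omega>. ennreal ((?q \<omega> z)\<^sup>2 / ?f z) \<partial>M) \<le> \<dots> / of_nat t" .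
    qed
    also have "\<dots> = (\<integral>\<^sup>+z. \<integral>\<^sup>+x. ennreal ((gauss_dens \<sigma> (z - x))\<^sup>2 / ?f z) \<partial>P \<partial>lborel) / of_nat t"
      by (rule nn_integral_divide) measurable
    also have "\<dots> \<le> ennreal ?B / of_nat t"
      unfolding m_def
      by (intro divide_right_mono_ennreal nn_integral_chi_square[OF P.prob_space_axioms setsP sub \<sigma> \<tau> a])
    also have "\<dots> = ennreal (?B / real t)"
      using t B by (simp add: divide_ennreal ennreal_of_nat_eq_real_of_nat)
    finally show ?thesis .
  qed
  have "(\<integral>\<^sup>+\<omega>. \<integral>\<^sup>+z. ennreal (w z * \<bar>?q \<omega> z\<bar>) \<partial>lborel \<partial>M)
      \<le> (\<integral>\<^sup>+\<omega>. \<integral>\<^sup>+z. ennreal (\<epsilon> / 2) * ennreal ((w z)\<^sup>2 * ?f z)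
            + ennreal (1 / (2 * \<epsilon>)) * ennreal ((?q \<omega> z)\<^sup>2 / ?f z) \<partial>lborel \<partial>M)"
    using amgm \<epsilon> f by (intro nn_integral_mono) (simp add: less_imp_le flip: ennreal_mult ennreal_plus)
  also have "\<dots> = (\<integral>\<^sup>+\<omega>. ennreal (\<epsilon> / 2) * (\<integral>\<^sup>+z. ennreal ((w z)\<^sup>2 * ?f z) \<partial>lborel)
            + ennreal (1 / (2 * \<epsilon>)) * (\<integral>\<^sup>+z. ennreal ((?q \<omega> z)\<^sup>2 / ?f z) \<partial>lborel) \<partial>M)"
    by (subst nn_integral_add) (auto simp: nn_integral_cmult)
  also have "\<dots> = ennreal (\<epsilon> / 2) * (\<integral>\<^sup>+z. ennreal ((w z)\<^sup>2 * ?f z) \<partial>lborel)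
            + ennreal (1 / (2 * \<epsilon>)) * (\<integral>\<^sup>+\<omega>. \<integral>\<^sup>+z. ennreal ((?q \<omega> z)\<^sup>2 / ?f z) \<partial>lborel \<partial>M)"
    by (subst nn_integral_add) (auto simp: nn_integral_cmult M.emeasure_space_1)
  also have "(\<integral>\<^sup>+\<omega>. \<integral>\<^sup>+z. ennreal ((?q \<omega> z)\<^sup>2 / ?f z) \<partial>lborel \<partial>M)
      = (\<integral>\<^sup>+z. \<integral>\<^sup>+\<omega>. ennreal ((?q \<omega> z)\<^sup>2 / ?f z) \<partial>M \<partial>lborel)"
    by (rule Fubini'[symmetric]) (unfold split_def, measurable)
  also have "ennreal (\<epsilon> / 2) * (\<integral>\<^sup>+z. ennreal ((w z)\<^sup>2 * ?f z) \<partial>lborel) + ennreal (1 / (2 * \<epsilon>)) * \<dots>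
      \<le> ennreal (\<epsilon> / 2) * ennreal A + ennreal (1 / (2 * \<epsilon>)) * ennreal (?B / real t)"
    by (intro add_mono mult_left_mono wA chi) auto
  also have "\<dots> = ennreal (\<epsilon> / 2 * A + 1 / (2 * \<epsilon>) * (?B / real t))"
    using \<epsilon> A B by (simp add: less_imp_le flip: ennreal_mult ennreal_plus)
  also have "\<epsilon> / 2 * A + 1 / (2 * \<epsilon>) * (?B / real t) = sqrt (A * ?B / real t)"
  proof -
    have "\<epsilon>\<^sup>2 = ?B / (real t * A)"
      unfolding \<epsilon>_def using B A t by simp
    then have e2: "?B / real t = \<epsilon>\<^sup>2 * A"
      using A t by (simp add: field_simps)
    then have "\<epsilon> / 2 * A + 1 / (2 * \<epsilon>) * (?B / real t) = \<epsilon> * A"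
      using \<epsilon> by (simp add: field_simps power2_eq_square)
    also have "\<epsilon> * A = sqrt ((\<epsilon> * A)\<^sup>2)" using \<epsilon> A by simp
    also have "(\<epsilon> * A)\<^sup>2 = A * (?B / real t)"
      unfolding e2 by (simp add: power2_eq_square)
    finally show ?thesis by simp
  qed
  finally show ?thesis .
qed

section \<open>Sub-Gaussian statistics of an i.i.d. sample\<close>

lemma sub_gaussian_distr:
  fixes F :: "'b \<Rightarrow> 'c::euclidean_space"
  assumes T: "T \<in> measurable M N" and F: "F \<in> borel_measurable N" and sub: "sub_gaussian (distr M N T) F v"
  shows "sub_gaussian M (\<lambda>\<omega>. F (T \<omega>)) v"
  using sub T F by (simp add: sub_gaussian_def integrable_distr_eq integral_distr nn_integral_distr)

text \<open>The values lie within \<open>c\<close> of \<open>f y0\<close>, an interval of length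
  \<open>2 * c\<close>, so Hoeffding's lemma gives the proxy (2c)^2 / 4. A factor 4 is lost against
  the best interval of length \<open>c\<close>; the constant in the total variation bound has room
  for it. Negative \<open>u\<close> is the lemma for the negated function.\<close>

lemma sub_gaussian_bounded_oscillation:
  assumes P: "prob_space P" and f: "f \<in> borel_measurable P"
    and osc: "\<And>y y'. y \<in> space P \<Longrightarrow> y' \<in> space P \<Longrightarrow> \<bar>f y - f y'\<bar> \<le> c"
  shows "sub_gaussian P f (c\<^sup>2)"
proof -
  interpret P: prob_space P by fact
  obtain y0 where y0: "y0 \<in> space P" using P.not_empty by blast
  interpret A: interval_bounded_random_variable P f "f y0 - c" "f y0 + c"
  proof
    show "AE x in P. f x \<in> {f y0 - c..f y0 + c}"
      using osc[OF _ y0] by (intro AE_I2) (auto simp: abs_le_iff algebra_simps)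
  qed (fact f)
  interpret B: interval_bounded_random_variable P "\<lambda>x. - f x" "- f y0 - c" "- f y0 + c"
  proof
    show "AE x in P. - f x \<in> {- f y0 - c..- f y0 + c}"
      using osc[OF _ y0] by (intro AE_I2) (auto simp: abs_le_iff algebra_simps)
  qed (use f in measurable)
  have "(\<integral>\<^sup>+x. ennreal (exp (u * (f x - (LINT x|P. f x)))) \<partial>P) \<le> ennreal (exp (u\<^sup>2 * c\<^sup>2 / 2))" for u
  proof -
    consider "u > 0" | "u < 0" | "u = 0" by linarith
    then show ?thesis
    proof cases
      case 1
      from A.Hoeffdings_lemma_nn_integral[OF this] show ?thesis
        by (simp add: power_mult_distrib mult.commute)
    next
      case 2
      then have "- u > 0" by simp
      from B.Hoeffdings_lemma_nn_integral[OF this] show ?thesis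
        by (simp add: power_mult_distrib mult.commute algebra_simps)
    qed (simp add: P.emeasure_space_1)
  qed
  then show ?thesis
    using A.integrable by (simp add: sub_gaussian_real_iff)
qed

text \<open>Tensorization read through the joint law of the first \<open>t\<close> variables;
  \<open>loc\<close> allows \<open>F\<close>, a function of whole sequences, to be evaluated on the
  finite product.\<close>

lemma sub_gaussian_iid:
  fixes F :: "(nat \<Rightarrow> 'a::topological_space) \<Rightarrow> real" and M :: "'w measure"
  assumes M: "prob_space M"
    and indep: "prob_space.indep_vars M (\<lambda>_. borel) X {1..}"
    and law: "\<And>i. i \<ge> 1 \<Longrightarrow> distr M borel (X i) = P"
    and base: "\<And>f. f \<in> borel_measurable P \<Longrightarrow> (\<And>y y'. \<bar>f y - f y'\<bar> \<le> c y y') \<Longrightarrow> sub_gaussian P f v"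
    and F: "F \<in> borel_measurable (Pi\<^sub>M UNIV (\<lambda>_. borel))"
    and loc: "\<And>x y. (\<And>i. i \<in> {1..t} \<Longrightarrow> x i = y i) \<Longrightarrow> F x = F y"
    and osc: "\<And>x i y y'. i \<in> {1..t} \<Longrightarrow> \<bar>F (x(i := y)) - F (x(i := y'))\<bar> \<le> c y y'"
    and t: "t \<ge> 1"
  shows "sub_gaussian M (\<lambda>\<omega>. F (\<lambda>i. X i \<omega>)) (real t * v)"
proof -
  interpret M: prob_space M by fact
  define I where "I = {1..t}"
  have I: "finite I" "I \<noteq> {}" "card I = t" "I \<subseteq> {1..}" using t by (auto simp: I_def)
  have setsP: "sets P = sets borel" using law[of 1] by auto
  then have spP: "space P = UNIV" using sets_eq_imp_space_eq by fastforce
  have X: "X i \<in> measurable M borel" if "i \<in> I" for i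
    using indep I that by (auto simp: M.indep_vars_def)
  have P: "prob_space P"
    using M.prob_space_distr[of "X 1" borel] X[of 1] t law[of 1] by (simp add: I_def)
  let ?X = "\<lambda>\<omega>. \<lambda>i\<in>I. X i \<omega>"
  have D: "distr M (Pi\<^sub>M I (\<lambda>_. borel)) ?X = Pi\<^sub>M I (\<lambda>_. P)"
    by (rule distr_restrict_PiM[OF M I(2) M.indep_vars_subset[OF indep I(4)]]) (use law I in auto)
  have FI: "F \<in> borel_measurable (Pi\<^sub>M I (\<lambda>_. borel))"
    by (rule measurable_PiM_local[OF F _ loc, of I]) (auto simp: I_def)
  have setsD: "sets (Pi\<^sub>M I (\<lambda>_. P)) = sets (Pi\<^sub>M I (\<lambda>_. borel))"
    using setsP by (intro sets_PiM_cong) auto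
  have sg: "sub_gaussian (Pi\<^sub>M I (\<lambda>_. P)) F (real (card I) * v)"
  proof (rule sub_gaussian_PiM[OF P I(1), where c = c])
    show "F \<in> borel_measurable (Pi\<^sub>M I (\<lambda>_. P))"
      using FI by (simp add: measurable_cong_sets[OF setsD refl])
    show "sub_gaussian P f v" if "f \<in> borel_measurable P"
      "\<And>y y'. y \<in> space P \<Longrightarrow> y' \<in> space P \<Longrightarrow> \<bar>f y - f y'\<bar> \<le> c y y'" for f
      by (rule base[OF that(1)], rule that(2)) (simp_all add: spP)
    show "\<bar>F (x(i := y)) - F (x(i := y'))\<bar> \<le> c y y'" if "i \<in> I" for x i y y'
      using that unfolding I_def by (rule osc)
  qed
  have mX: "?X \<in> measurable M (Pi\<^sub>M I (\<lambda>_. borel))"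
    by (intro measurable_restrict X)
  have "sub_gaussian (distr M (Pi\<^sub>M I (\<lambda>_. borel)) ?X) F (real t * v)"
    using sg by (simp only: D I(3))
  then have "sub_gaussian M (\<lambda>\<omega>. F (?X \<omega>)) (real t * v)"
    by (rule sub_gaussian_distr[OF mX FI])
  also have "(\<lambda>\<omega>. F (?X \<omega>)) = (\<lambda>\<omega>. F (\<lambda>i. X i \<omega>))"
    by (intro ext loc) (auto simp: I_def)
  finally show ?thesis .
qed

section \<open>Empirical measures and smoothed densities\<close>

text \<open>The empirical measure is the law of the sample read at a uniformly random index, so
  total mass and integrals come from the uniform distribution on \<open>{1..t}\<close>.\<close>

lemma empirical_eq_distr:
  assumes "t \<ge> 1"
  shows "empirical x t = distr (measure_pmf (pmf_of_set {1..t})) borel x"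
proof (rule measure_eqI)
  fix A assume "A \<in> sets (empirical x t)"
  then have A: "A \<in> sets borel" by simp
  have "emeasure (distr (measure_pmf (pmf_of_set {1..t})) borel x) A
      = (\<integral>\<^sup>+i. indicator A (x i) \<partial>measure_pmf (pmf_of_set {1..t}))"
    using A by (subst emeasure_distr) (auto simp: indicator_vimage[symmetric] simp del: nn_integral_indicator simp flip: nn_integral_indicator)
  also have "\<dots> = (\<Sum>i=1..t. indicator A (x i)) / of_nat t"
    using assms by (subst nn_integral_pmf_of_set) auto
  finally show "emeasure (empirical x t) A = emeasure (distr (measure_pmf (pmf_of_set {1..t})) borel x) A"
    using emeasure_empirical[OF A] by simp
qed simp

lemma prob_space_empirical: "t \<ge> 1 \<Longrightarrow> prob_space (empirical x t)"
  by (simp add: empirical_eq_distr prob_space.prob_space_distr measure_pmf.prob_space_axioms)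

lemma integral_empirical:
  fixes h :: "'a::topological_space \<Rightarrow> real"
  assumes "t \<ge> 1" and h: "h \<in> borel_measurable borel"
  shows "(LINT y|empirical x t. h y) = (\<Sum>i=1..t. h (x i)) / real t"
  using assms by (simp add: empirical_eq_distr integral_distr integral_pmf_of_set)

definition smooth_dens :: "real \<Rightarrow> (real ^ 'd) measure \<Rightarrow> real ^ 'd \<Rightarrow> real" where
  "smooth_dens \<sigma> \<mu> z = (LINT x|\<mu>. gauss_dens \<sigma> (z - x))"

lemma smooth_dens_nonneg [simp]: "smooth_dens \<sigma> \<mu> z \<ge> 0"
  by (simp add: smooth_dens_def)

lemma gauss_dens_le: "\<sigma> > 0 \<Longrightarrow> gauss_dens \<sigma> (x :: real ^ 'd) \<le> 1 / sqrt (2 * pi * \<sigma>\<^sup>2) ^ CARD('d)"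
  unfolding gauss_dens_def by (simp add: divide_right_mono)

lemma smooth_dens_measurable:
  assumes "prob_space \<mu>" and [measurable_cong]: "sets \<mu> = sets borel"
  shows "smooth_dens \<sigma> \<mu> \<in> borel_measurable borel"
proof -
  interpret prob_space \<mu> by fact
  show ?thesis unfolding smooth_dens_def by measurable
qed

lemma ennreal_smooth_dens:
  assumes \<sigma>: "\<sigma> > 0" and \<mu>: "prob_space \<mu>" and [measurable_cong]: "sets \<mu> = sets borel"
  shows "ennreal (smooth_dens \<sigma> \<mu> z) = (\<integral>\<^sup>+x. ennreal (gauss_dens \<sigma> (z - x)) \<partial>\<mu>)"
proof -
  interpret \<mu>: prob_space \<mu> by fact
  show ?thesis
    unfolding smooth_dens_def
    by (rule nn_integral_eq_integral[symmetric])
       (auto intro!: \<mu>.integrable_const_bound[where B = "1 / sqrt (2 * pi * \<sigma>\<^sup>2) ^ CARD('a)"] gauss_dens_le \<sigma>)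
qed

text \<open>Tonelli after a translation of \<open>lborel\<close>. With densities at hand, total
  variation is half an L1 distance and the transport distance is bounded by a weighted one, so that
  both means reduce to the deviation of the smoothed empirical density.\<close>

lemma smooth_eq_density:
  assumes \<sigma>: "\<sigma> > 0" and \<mu>: "prob_space \<mu>" "sets \<mu> = sets borel"
  shows "smooth \<sigma> \<mu> = density lborel (\<lambda>z. ennreal (smooth_dens \<sigma> \<mu> z))"
proof (rule measure_eqI)
  show "sets (smooth \<sigma> \<mu>) = sets (density lborel (\<lambda>z. ennreal (smooth_dens \<sigma> \<mu> z)))"
    by (simp add: smooth_def)
  interpret \<mu>: prob_space \<mu> by fact
  note \<mu>(2) [measurable_cong]
  interpret pair_sigma_finite \<mu> "lborel :: (real ^ 'a) measure" ..
  have [measurable]: "smooth_dens \<sigma> \<mu> \<in> borel_measurable borel"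
    by (rule smooth_dens_measurable[OF \<mu>])
  have sg: "sets (gaussian \<sigma> :: (real ^ 'a) measure) = sets borel" by (simp add: gaussian_eq)
  have fin: "finite_measure (gaussian \<sigma> :: (real ^ 'a) measure)"
    by (rule finite_measureI) (simp add: gaussian_eq emeasure_density nn_integral_gauss_dens[OF \<sigma>])
  fix A assume "A \<in> sets (smooth \<sigma> \<mu>)"
  then have A [measurable]: "A \<in> sets borel" by (simp add: smooth_def)
  have "emeasure (smooth \<sigma> \<mu>) A = (\<integral>\<^sup>+x. \<integral>\<^sup>+y. indicator A (x + y) \<partial>gaussian \<sigma> \<partial>\<mu>)"
    unfolding smooth_def using fin sg \<mu> by (intro convolution_emeasure') (auto simp: \<mu>.finite_measure_axioms)
  also have "\<dots> = (\<integral>\<^sup>+x. \<integral>\<^sup>+z. ennreal (gauss_dens \<sigma> (z - x)) * indicator A z \<partial>lborel \<partial>\<mu>)"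
  proof (rule nn_integral_cong)
    fix x
    have "(\<integral>\<^sup>+y. indicator A (x + y) \<partial>gaussian \<sigma>) = (\<integral>\<^sup>+y. ennreal (gauss_dens \<sigma> y) * indicator A (x + y) \<partial>lborel)"
      unfolding gaussian_eq by (subst nn_integral_density) auto
    also have "\<dots> = (\<integral>\<^sup>+y. ennreal (gauss_dens \<sigma> (y + x - x)) * indicator A (y + x) \<partial>lborel)"
      by (simp add: add.commute)
    also have "\<dots> = (\<integral>\<^sup>+z. ennreal (gauss_dens \<sigma> (z - x)) * indicator A z \<partial>lborel)"
      by (rule nn_integral_lborel_shift) measurable
    finally show "(\<integral>\<^sup>+y. indicator A (x + y) \<partial>gaussian \<sigma>) = \<dots>" .
  qed
  also have "\<dots> = (\<integral>\<^sup>+z. \<integral>\<^sup>+x. ennreal (gauss_dens \<sigma> (z - x)) * indicator A z \<partial>\<mu> \<partial>lborel)"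
    by (rule Fubini'[symmetric]) measurable
  also have "\<dots> = (\<integral>\<^sup>+z. ennreal (smooth_dens \<sigma> \<mu> z) * indicator A z \<partial>lborel)"
    unfolding ennreal_smooth_dens[OF assms] by (intro nn_integral_cong nn_integral_multc) measurable
  also have "\<dots> = emeasure (density lborel (\<lambda>z. ennreal (smooth_dens \<sigma> \<mu> z))) A"
    by (simp add: emeasure_density)
  finally show "emeasure (smooth \<sigma> \<mu>) A = \<dots>" .
qed

lemma nn_integral_smooth_dens:
  assumes \<sigma>: "\<sigma> > 0" and \<mu>: "prob_space \<mu>" "sets \<mu> = sets borel"
  shows "(\<integral>\<^sup>+z. ennreal (smooth_dens \<sigma> \<mu> z) \<partial>lborel) = 1"
proof -
  interpret \<mu>: prob_space \<mu> by fact
  have fin: "finite_measure (gaussian \<sigma> :: (real ^ 'a) measure)"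
    by (rule finite_measureI) (simp add: gaussian_eq emeasure_density nn_integral_gauss_dens[OF \<sigma>])
  have sg: "sets (gaussian \<sigma> :: (real ^ 'a) measure) = sets borel" by (simp add: gaussian_eq)
  have "(\<integral>\<^sup>+z. ennreal (smooth_dens \<sigma> \<mu> z) \<partial>lborel) = emeasure (smooth \<sigma> \<mu>) UNIV"
    unfolding smooth_eq_density[OF assms] using smooth_dens_measurable[OF \<mu>] by (simp add: emeasure_density)
  also have "\<dots> = (\<integral>\<^sup>+x. \<integral>\<^sup>+y. 1 \<partial>(gaussian \<sigma> :: (real ^ 'a) measure) \<partial>\<mu>)"
    unfolding smooth_def using fin sg \<mu> by (subst convolution_emeasure') (auto simp: \<mu>.finite_measure_axioms)
  also have "\<dots> = 1"
    by (simp add: gaussian_eq emeasure_density nn_integral_gauss_dens[OF \<sigma>] \<mu>.emeasure_space_1)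
  finally show ?thesis .
qed

lemma smooth_dens_empirical:
  "t \<ge> 1 \<Longrightarrow> smooth_dens \<sigma> (empirical x t) z = (\<Sum>i=1..t. gauss_dens \<sigma> (z - x i)) / real t"
  unfolding smooth_dens_def by (rule integral_empirical) measurable

text \<open>The two sides differ by the integral of \<open>p - q\<close>, which vanishes. This
  equality of excess masses serves the total variation formula as well as the transport of one
  excess to the other.\<close>

lemma integral_positive_parts_eq:
  fixes p q :: "'a \<Rightarrow> real"
  assumes "integrable N p" "integrable N q" "(LINT x|N. p x) = (LINT x|N. q x)"
  shows "(LINT x|N. max 0 (p x - q x)) = (LINT x|N. max 0 (q x - p x))"
proof -
  have "(LINT x|N. max 0 (p x - q x)) - (LINT x|N. max 0 (q x - p x))
      = (LINT x|N. max 0 (p x - q x) - max 0 (q x - p x))"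
    using assms by (intro Bochner_Integration.integral_diff[symmetric]) auto
  also have "\<dots> = (LINT x|N. p x - q x)"
    by (intro Bochner_Integration.integral_cong) auto
  finally show ?thesis using assms by simp
qed

text \<open>The signed mass of any set is bounded by the integral of the positive or of the negative
  part, and both integrals are half the L1 distance. The supremum is attained on the set where
  \<open>p\<close> exceeds \<open>q\<close>.\<close>

lemma tv_dist_density:
  fixes p q :: "'a::topological_space \<Rightarrow> real"
  assumes N: "sets N = sets borel"
    and p: "p \<in> borel_measurable N" "\<And>x. p x \<ge> 0" "(\<integral>\<^sup>+x. ennreal (p x) \<partial>N) = 1"
    and q: "q \<in> borel_measurable N" "\<And>x. q x \<ge> 0" "(\<integral>\<^sup>+x. ennreal (q x) \<partial>N) = 1"
  shows "tv_dist (density N (\<lambda>x. ennreal (p x))) (density N (\<lambda>x. ennreal (q x))) = (LINT x|N. \<bar>p x - q x\<bar>) / 2"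
proof -
  let ?P = "density N (\<lambda>x. ennreal (p x))" and ?Q = "density N (\<lambda>x. ennreal (q x))"
  have ip: "integrable N p" and iq: "integrable N q"
    using p q by (auto intro!: integrableI_nonneg)
  have Ep: "(LINT x|N. p x) = 1" and Eq: "(LINT x|N. q x) = 1"
    using p q by (simp_all add: integral_eq_nn_integral)
  define S where "S = (LINT x|N. max 0 (p x - q x))"
  have iS: "integrable N (\<lambda>x. max 0 (p x - q x))" "integrable N (\<lambda>x. max 0 (q x - p x))"
    using ip iq by auto
  have S': "S = (LINT x|N. max 0 (q x - p x))"
    unfolding S_def using ip iq Ep Eq by (intro integral_positive_parts_eq) auto
  have "(LINT x|N. \<bar>p x - q x\<bar>) = (LINT x|N. max 0 (p x - q x) + max 0 (q x - p x))"
    by (intro Bochner_Integration.integral_cong) auto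
  also have "\<dots> = 2 * S"
    using iS S' by (simp add: S_def)
  finally have S2: "S = (LINT x|N. \<bar>p x - q x\<bar>) / 2" by simp
  have meas: "measure (density N (\<lambda>x. ennreal (f x))) A = (LINT x|N. f x * indicator A x)"
    if "integrable N f" "\<And>x. f x \<ge> 0" "A \<in> sets borel" for f A
  proof -
    have "integrable N (\<lambda>x. f x * indicator A x)"
      using that N by (intro integrable_mult_indicator[of A N f, simplified mult.commute real_scaleR_def]) auto
    moreover have "emeasure (density N (\<lambda>x. ennreal (f x))) A = (\<integral>\<^sup>+x. ennreal (f x * indicator A x) \<partial>N)"
      using that N by (subst emeasure_density) (auto simp: ennreal_mult ennreal_indicator intro!: nn_integral_cong)
    ultimately show ?thesis
      using that by (subst integral_eq_nn_integral) (auto simp: measure_def)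
  qed
  have int: "integrable N (\<lambda>x. f x * indicator A x)" if "integrable N f" "A \<in> sets borel" for A and f :: "'a \<Rightarrow> real"
    using that N integrable_mult_indicator[of A N f] by (simp add: mult.commute)
  have diff: "measure ?P A - measure ?Q A
      = (LINT x|N. (p x - q x) * indicator A x)" if "A \<in> sets borel" for A
    using meas[OF ip p(2) that] meas[OF iq q(2) that] int[OF ip that] int[OF iq that]
    by (simp add: left_diff_distrib)
  have le: "\<bar>measure ?P A - measure ?Q A\<bar> \<le> S"
    if A: "A \<in> sets borel" for A
  proof -
    have "(LINT x|N. (p x - q x) * indicator A x) \<le> S"
      unfolding S_def using iS int[OF Bochner_Integration.integrable_diff[OF ip iq] A]
      by (intro integral_mono) (auto simp: indicator_def)
    moreover have "- (LINT x|N. (p x - q x) * indicator A x) \<le> S"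
      unfolding S' Bochner_Integration.integral_minus[symmetric]
      using iS int[OF Bochner_Integration.integrable_diff[OF ip iq] A]
      by (intro integral_mono) (auto simp: indicator_def)
    ultimately show ?thesis unfolding diff[OF A] by simp
  qed
  have "{x \<in> space N. q x < p x} \<in> sets N" using p(1) q(1) by measurable
  then have B: "{x \<in> space N. q x < p x} \<in> sets borel" (is "?B \<in> _") by (simp add: N)
  have "S = \<bar>measure ?P ?B - measure ?Q ?B\<bar>"
  proof -
    have "S = (LINT x|N. (p x - q x) * indicator ?B x)"
      unfolding S_def by (intro Bochner_Integration.integral_cong) (auto simp: indicator_def)
    moreover have "S \<ge> 0" unfolding S_def by simp
    ultimately show ?thesis unfolding diff[OF B] by simp
  qed
  also have "\<dots> \<le> tv_dist ?P ?Q"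
    unfolding tv_dist_def using le by (intro cSUP_upper B bdd_aboveI2)
  finally have "S \<le> tv_dist ?P ?Q" .
  moreover have "tv_dist ?P ?Q \<le> S"
    unfolding tv_dist_def using le by (intro cSUP_least) auto
  ultimately show ?thesis using S2 by simp
qed

section \<open>Leave-one-out averages\<close>

lemma sum_comp_swap:
  fixes h :: "'a \<Rightarrow> 'b::comm_monoid_add" and i t s :: nat
  assumes "i \<in> {1..t}" "t \<le> s"
  shows "(\<Sum>k=1..s. h ((x \<circ> swap i t) k)) = (\<Sum>k=1..s. h (x k))"
proof -
  have "bij_betw (swap i t) {1..s} {1..s}"
    by (rule bij_betw_transpose_iff) (use assms in auto)
  from sum.reindex_bij_betw[OF this, of "\<lambda>k. h (x k)"] show ?thesis by simp
qed

text \<open>Composition with \<open>swap i t\<close> stores \<open>x t\<close> in slot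
  \<open>i\<close> and hides \<open>x i\<close> in slot \<open>t\<close>, so the first
  \<open>t - 1\<close> entries are the sample without \<open>x i\<close>. Each point survives in
  \<open>t - 1\<close> of the \<open>t\<close> reduced samples.\<close>

lemma leave_one_out_average:
  fixes h :: "'a \<Rightarrow> real" and t :: nat
  assumes t: "2 \<le> t"
  shows "(\<Sum>i=1..t. (\<Sum>k=1..t - 1. h ((x \<circ> swap i t) k)) / real (t - 1)) / real t = (\<Sum>k=1..t. h (x k)) / real t"
proof -
  have "(\<Sum>k=1..t - 1. h ((x \<circ> swap i t) k)) = (\<Sum>k=1..t. h (x k)) - h (x i)" if "i \<in> {1..t}" for i
  proof -
    have "{1..t} = insert t {1..t - 1}" "t \<notin> {1..t - 1}" using t by auto
    then have "(\<Sum>k=1..t. h ((x \<circ> swap i t) k)) = h (x i) + (\<Sum>k=1..t - 1. h ((x \<circ> swap i t) k))"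
      by simp
    then show ?thesis using sum_comp_swap[OF that order_refl, of h x] by simp
  qed
  then have "(\<Sum>i=1..t. (\<Sum>k=1..t - 1. h ((x \<circ> swap i t) k)) / real (t - 1))
      = (\<Sum>i=1..t. ((\<Sum>k=1..t. h (x k)) - h (x i)) / real (t - 1))"
    by (intro sum.cong) auto
  also have "\<dots> = (\<Sum>k=1..t. h (x k))"
    using t by (simp add: sum_divide_distrib[symmetric] sum_subtractf of_nat_diff field_simps)
  finally show ?thesis by simp
qed


section \<open>Constants in the mean bounds\<close>

text \<open>The exponent 3/4 is large enough because 1 + 3/4 + (3/4)^2 / 2 already exceeds 2. Raised
  to the power d/4 it becomes the factor \<open>exp (3 * d / 16)\<close> of
  \<open>c_const\<close>.\<close>

lemma one_plus_sq_le:
  fixes r :: real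
  assumes "r \<ge> 0"
  shows "1 + 2 * r\<^sup>2 \<le> (1 / sqrt 2 + r)\<^sup>2 * exp (3 / 4)"
proof -
  have "exp (3 / 4 :: real) \<ge> 2"
    using exp_lower_Taylor_quadratic[of "3 / 4 :: real"] by (simp add: power2_eq_square)
  then have "(1 / sqrt 2 + r)\<^sup>2 * 2 \<le> (1 / sqrt 2 + r)\<^sup>2 * exp (3 / 4)"
    by (intro mult_left_mono) auto
  moreover have "(1 / sqrt 2 + r)\<^sup>2 * 2 = 1 + 2 * r\<^sup>2 + 4 * (r / sqrt 2)"
    by (simp add: power2_sum power_divide algebra_simps)
  moreover have "4 * (r / sqrt 2) \<ge> 0" using assms by simp
  ultimately show ?thesis by linarith
qed

text \<open>The division by \<open>sqrt 2\<close> leaves in reserve the factor that the stitching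
  over an epoch consumes.\<close>

lemma sqrt_ratio_le_c_const:
  assumes \<sigma>: "\<sigma> > 0" and \<tau>: "\<tau> > 0" and a: "a > 0" "a\<^sup>2 = 2 * \<tau>\<^sup>2 + \<sigma>\<^sup>2"
  shows "sqrt ((a / \<sigma>) ^ d) \<le> c_const d \<tau> \<sigma> / sqrt 2"
proof -
  let ?b = "1 / sqrt 2 + \<tau> / \<sigma>"
  have b: "?b > 0" using \<sigma> \<tau> by (simp add: add_pos_pos)
  have "(a / \<sigma>)\<^sup>2 = 1 + 2 * (\<tau> / \<sigma>)\<^sup>2"
    using \<sigma> a by (simp add: power_divide field_simps)
  also have "\<dots> \<le> ?b\<^sup>2 * exp (3 / 4)"
    using \<sigma> \<tau> by (intro one_plus_sq_le) auto
  also have "\<dots> = (?b * exp (3 / 8))\<^sup>2"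
    by (simp add: power_mult_distrib flip: exp_of_nat_mult exp_double)
  finally have "a / \<sigma> \<le> ?b * exp (3 / 8)"
    using b by (intro power2_le_imp_le[of "a / \<sigma>"]) auto
  then have "(a / \<sigma>) ^ d \<le> (?b * exp (3 / 8)) ^ d"
    using a \<sigma> by (intro power_mono) auto
  then have "sqrt ((a / \<sigma>) ^ d) \<le> sqrt ((?b * exp (3 / 8)) ^ d)"
    by simp
  also have "\<dots> = (?b * exp (3 / 8)) powr (real d / 2)"
    using b by (simp add: powr_half_sqrt[symmetric] powr_realpow[symmetric] powr_powr)
  also have "\<dots> = ?b powr (real d / 2) * exp (3 * real d / 16)"
    using b by (simp add: powr_mult exp_powr_real mult_ac)
  also have "\<dots> = c_const d \<tau> \<sigma> / sqrt 2"
    unfolding c_const_def by simp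
  finally show ?thesis .
qed

subsection \<open>Total variation\<close>

lemma integrable_gauss_dens_shift:
  assumes "\<sigma> > 0"
  shows "integrable lborel (\<lambda>z. gauss_dens \<sigma> (z - (y :: real ^ 'd)))"
    and "(\<integral>\<^sup>+z. ennreal (gauss_dens \<sigma> (z - y)) \<partial>lborel) = 1"
    and "(LINT z|lborel. gauss_dens \<sigma> (z - y)) = 1"
proof -
  show *: "(\<integral>\<^sup>+z. ennreal (gauss_dens \<sigma> (z - y)) \<partial>lborel) = 1"
    using nn_integral_lborel_shift[of "\<lambda>z. ennreal (gauss_dens \<sigma> z)" "- y"] nn_integral_gauss_dens[OF assms, where 'd='d]
    by simp
  then show "integrable lborel (\<lambda>z. gauss_dens \<sigma> (z - y))"
    by (intro integrableI_nonneg) auto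
  show "(LINT z|lborel. gauss_dens \<sigma> (z - y)) = 1"
    using * by (subst integral_eq_nn_integral) auto
qed

lemma integrable_smooth_dens:
  assumes "\<sigma> > 0" "prob_space \<mu>" "sets \<mu> = sets borel"
  shows "integrable lborel (smooth_dens \<sigma> \<mu>)"
  using nn_integral_smooth_dens[OF assms] smooth_dens_measurable[OF assms(2,3)]
  by (intro integrableI_nonneg) auto

lemma tv_smooth_empirical:
  assumes \<sigma>: "\<sigma> > 0" and P: "prob_space P" "sets P = sets borel" and t: "t \<ge> 1"
  shows "tv_smooth \<sigma> (empirical x t) P
    = (LINT z|lborel. \<bar>(\<Sum>i=1..t. gauss_dens \<sigma> (z - x i)) / real t - smooth_dens \<sigma> P z\<bar>) / 2"
proof -
  note E = prob_space_empirical[OF t, of x] sets_empirical[of x t]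
  show ?thesis
    unfolding tv_smooth_def smooth_eq_density[OF \<sigma> E] smooth_eq_density[OF \<sigma> P] smooth_dens_empirical[OF t, symmetric]
    using smooth_dens_measurable[OF E] smooth_dens_measurable[OF P] nn_integral_smooth_dens[OF \<sigma> E] nn_integral_smooth_dens[OF \<sigma> P]
    by (intro tv_dist_density) auto
qed

lemma tv_time_uniform:
  fixes P :: "(real ^ 'd) measure" and M :: "'w measure" and l :: "real \<Rightarrow> real"
  assumes M: "prob_space M"
    and indep: "prob_space.indep_vars M (\<lambda>_. borel) X {1..}"
    and law: "\<And>i. i \<ge> 1 \<Longrightarrow> distr M borel (X i) = P"
    and sub: "sub_gaussian P (\<lambda>x. x) (\<tau>\<^sup>2)"
    and \<sigma>: "\<sigma> > 0" and \<tau>: "\<tau> > 0"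
    and \<delta>: "0 < \<delta>" "\<delta> < 1"
    and l_ge1: "\<And>x. x \<ge> 0 \<Longrightarrow> l x \<ge> 1"
    and l_sum: "summable (\<lambda>j. 1 / l (real (Suc j)))" "(\<Sum>j. 1 / l (real (Suc j))) \<le> 1"
    and l_const: "\<And>x. x \<in> {0..1} \<Longrightarrow> l x = l 1"
    and l_decr: "\<And>u v. 1 \<le> u \<Longrightarrow> u \<le> v \<Longrightarrow> 2 powr (- v) * ln (l v) \<le> 2 powr (- u) * ln (l u)"
  defines "E \<equiv> {\<omega> \<in> space M. \<exists>t\<ge>1. tv_smooth \<sigma> (empirical (\<lambda>i. X i \<omega>) t) P
                    \<ge> c_const CARD('d) \<tau> \<sigma> / sqrt (real t)
                      + 4 * sqrt (2 / real t * (ln (l (log 2 (real t))) + ln (1 / \<delta>)))}"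
  shows "E \<in> sets M" "measure M E \<le> \<delta>"
proof -
  interpret M: prob_space M by fact
  have X1 [measurable]: "X i \<in> measurable M borel" if "i \<ge> 1" for i
    using indep that by (auto simp: M.indep_vars_def)
  have setsP: "sets P = sets borel" using law[of 1] by auto
  have P: "prob_space P"
    using M.prob_space_distr[of "X 1" borel] X1[of 1] law[of 1] by simp
  let ?g = "\<lambda>z y. gauss_dens \<sigma> (z - y)"
  define p where "p = smooth_dens \<sigma> P"
  have p [measurable]: "p \<in> borel_measurable borel"
    unfolding p_def by (rule smooth_dens_measurable[OF P setsP])
  have ip: "integrable lborel p"
    unfolding p_def by (rule integrable_smooth_dens[OF \<sigma> P setsP])
  note ig = integrable_gauss_dens_shift[OF \<sigma>]
  define G where "G t x = (LINT z|lborel. \<bar>(\<Sum>i=1..t. ?g z (x i)) / real t - p z\<bar>) / 2" for t x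
  have iG: "integrable lborel (\<lambda>z. (\<Sum>i=1..t. ?g z (x i)) / real t - p z)" for t and x :: "nat \<Rightarrow> real ^ 'd"
    by (intro Bochner_Integration.integrable_diff integrable_divide Bochner_Integration.integrable_sum ig ip)
  have meas: "G t \<in> borel_measurable (Pi\<^sub>M UNIV (\<lambda>_. borel))" for t
    unfolding G_def by measurable
  have loc: "G t x = G t y" if "\<And>i. i \<in> {1..t} \<Longrightarrow> x i = y i" for t x y
  proof -
    have "(\<Sum>i=1..t. ?g z (x i)) = (\<Sum>i=1..t. ?g z (y i))" for z
      using that by (intro sum.cong) auto
    then show ?thesis unfolding G_def by (simp only:)
  qed
  have sym: "G s (x \<circ> swap i t) = G s x" if "i \<in> {1..t}" "t \<le> s" for s t i x
    unfolding G_def by (simp only: sum_comp_swap[OF that, of "?g _"])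
  have loo: "G t x \<le> (\<Sum>i=1..t. G (t - 1) (x \<circ> swap i t)) / real t" if t: "2 \<le> t" for t x
  proof -
    let ?A = "\<lambda>i z. (\<Sum>k=1..t - 1. ?g z ((x \<circ> swap i t) k)) / real (t - 1) - p z"
    have eq: "(\<Sum>i=1..t. ?g z (x i)) / real t - p z = (\<Sum>i=1..t. ?A i z) / real t" for z
      using leave_one_out_average[OF t, of "?g z" x] t by (simp add: sum_subtractf diff_divide_distrib)
    have "(LINT z|lborel. \<bar>(\<Sum>i=1..t. ?g z (x i)) / real t - p z\<bar>) \<le> (LINT z|lborel. (\<Sum>i=1..t. \<bar>?A i z\<bar>) / real t)"
    proof (rule integral_mono)
      show "integrable lborel (\<lambda>z. (\<Sum>i=1..t. \<bar>?A i z\<bar>) / real t)"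
        by (intro integrable_divide Bochner_Integration.integrable_sum integrable_abs iG)
      show "\<bar>(\<Sum>i=1..t. ?g z (x i)) / real t - p z\<bar> \<le> (\<Sum>i=1..t. \<bar>?A i z\<bar>) / real t" for z
        unfolding eq abs_divide by (auto intro!: divide_right_mono sum_abs)
    qed (intro integrable_abs iG)
    also have "\<dots> = (\<Sum>i=1..t. (LINT z|lborel. \<bar>?A i z\<bar>)) / real t"
      by (simp only: integral_divide_zero)
         (intro arg_cong[where f="\<lambda>x. x / _"] Bochner_Integration.integral_sum integrable_abs iG)
    finally show ?thesis
      unfolding G_def by (simp add: sum_divide_distrib[symmetric] field_simps)
  qed
  \<comment> \<open>The argument yields the proxy \<open>1 / t\<close>. It is relaxed to
    \<open>8 / t\<close> because \<open>2 * sqrt (8 / t * y)\<close> is the claimed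
    \<open>4 * sqrt (2 / t * y)\<close>.\<close>
  have sg: "sub_gaussian M (\<lambda>\<omega>. G t (\<lambda>i. X i \<omega>)) (8 / real t)" if t: "1 \<le> t" for t
  proof -
    have "sub_gaussian M (\<lambda>\<omega>. G t (\<lambda>i. X i \<omega>)) (real t * (1 / real t)\<^sup>2)"
    proof (rule sub_gaussian_iid[OF M indep law _ meas loc _ t, where c = "\<lambda>_ _. 1 / real t"])
      show "sub_gaussian P f ((1 / real t)\<^sup>2)" if "f \<in> borel_measurable P" "\<And>y y'. \<bar>f y - f y'\<bar> \<le> 1 / real t" for f
        using that by (intro sub_gaussian_bounded_oscillation[OF P])
      \<comment> \<open>Exchanging one sample point alters the averaged density by
        \<open>(?g z y - ?g z y') / real t\<close>, whose L1 norm is at most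
        \<open>2 / real t\<close>; total variation takes half of it.\<close>
      fix x :: "nat \<Rightarrow> real ^ 'd" and i y y' assume i: "i \<in> {1..t}"
      have s: "(\<Sum>k=1..t. ?g z ((x(i := v)) k)) = ?g z v + (\<Sum>k\<in>{1..t} - {i}. ?g z (x k))" for z v
        using i by (subst sum.remove[of _ i]) (auto intro!: sum.cong)
      define U where "U v z = \<bar>(\<Sum>k=1..t. ?g z ((x(i := v)) k)) / real t - p z\<bar>" for v z
      have iU: "integrable lborel (U v)" for v
        unfolding U_def by (intro integrable_abs iG)
      have "\<bar>G t (x(i := y)) - G t (x(i := y'))\<bar> = \<bar>(LINT z|lborel. U y z) / 2 - (LINT z|lborel. U y' z) / 2\<bar>"
        unfolding G_def U_def ..
      also have "\<dots> = \<bar>LINT z|lborel. U y z - U y' z\<bar> / 2"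
        using iU by (simp add: Bochner_Integration.integral_diff flip: diff_divide_distrib)
      also have "\<dots> \<le> (LINT z|lborel. \<bar>U y z - U y' z\<bar>) / 2"
        by (intro divide_right_mono integral_abs_bound) auto
      also have "\<dots> \<le> (LINT z|lborel. (?g z y + ?g z y') / real t) / 2"
      proof (intro divide_right_mono integral_mono)
        show "integrable lborel (\<lambda>z. \<bar>U y z - U y' z\<bar>)"
          by (intro integrable_abs Bochner_Integration.integrable_diff iU)
        show "integrable lborel (\<lambda>z. (?g z y + ?g z y') / real t)"
          by (intro integrable_divide Bochner_Integration.integrable_add ig)
        fix z
        have "\<bar>U y z - U y' z\<bar> \<le> \<bar>(?g z y - ?g z y') / real t\<bar>"
          unfolding U_def s add_divide_distrib diff_divide_distrib by linarith
        also have "\<dots> \<le> (?g z y + ?g z y') / real t"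
          unfolding abs_divide by (intro frac_le) (use t in \<open>auto simp: abs_le_iff\<close>)
        finally show "\<bar>U y z - U y' z\<bar> \<le> (?g z y + ?g z y') / real t" .
      qed simp
      also have "\<dots> = 1 / real t"
        by (simp add: Bochner_Integration.integral_add[OF ig(1) ig(1)] ig(3))
      finally show "\<bar>G t (x(i := y)) - G t (x(i := y'))\<bar> \<le> 1 / real t" .
    qed
    then show ?thesis
      by (rule sub_gaussian_mono) (use t in \<open>simp add: power2_eq_square divide_right_mono\<close>)
  qed
  define a where "a = sqrt (2 * \<tau>\<^sup>2 + \<sigma>\<^sup>2)"
  have pos: "2 * \<tau>\<^sup>2 + \<sigma>\<^sup>2 > 0" using \<sigma> \<tau> by (simp add: add_pos_pos)
  have a: "a > 0" "a\<^sup>2 = 2 * \<tau>\<^sup>2 + \<sigma>\<^sup>2"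
    using pos by (simp_all add: a_def)
  have mean: "(LINT \<omega>|M. G t (\<lambda>i. X i \<omega>)) \<le> c_const CARD('d) \<tau> \<sigma> / sqrt (2 * real t)" if t: "1 \<le> t" for t
  proof -
    let ?q = "\<lambda>\<omega> z. \<bar>(\<Sum>i=1..t. ?g z (X i \<omega>)) / real t - p z\<bar>"
    have "ennreal (LINT \<omega>|M. G t (\<lambda>i. X i \<omega>)) = (\<integral>\<^sup>+\<omega>. ennreal (G t (\<lambda>i. X i \<omega>)) \<partial>M)"
      using sg[OF t] by (intro nn_integral_eq_integral[symmetric]) (auto simp: sub_gaussian_def G_def)
    \<comment> \<open>The weight is 1, so the weighted bound applies with \<open>A = 1\<close>. The
      factor 1/2 in \<open>G\<close> is given away.\<close>
    also have "\<dots> \<le> (\<integral>\<^sup>+\<omega>. \<integral>\<^sup>+z. ennreal (1 * ?q \<omega> z) \<partial>lborel \<partial>M)"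
    proof (rule nn_integral_mono)
      fix \<omega>
      have "ennreal (G t (\<lambda>i. X i \<omega>)) \<le> ennreal (LINT z|lborel. ?q \<omega> z)"
        unfolding G_def by (intro ennreal_leI) (simp add: integral_nonneg_AE)
      also have "\<dots> = (\<integral>\<^sup>+z. ennreal (1 * ?q \<omega> z) \<partial>lborel)"
        unfolding mult_1 by (rule nn_integral_eq_integral[symmetric, OF integrable_abs[OF iG]]) simp
      finally show "ennreal (G t (\<lambda>i. X i \<omega>)) \<le> \<dots>" .
    qed
    also have "\<dots> \<le> ennreal (sqrt (1 * (a / \<sigma>) ^ CARD('d) / real t))"
      unfolding p_def smooth_dens_def
      by (rule nn_integral_weighted_density_deviation[OF M indep law sub \<sigma> \<tau> a t])
         (simp_all add: integrable_gauss_dens_shift(2)[OF a(1)])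
    finally have "(LINT \<omega>|M. G t (\<lambda>i. X i \<omega>)) \<le> sqrt ((a / \<sigma>) ^ CARD('d) / real t)"
      using a \<sigma> by (subst (asm) ennreal_le_iff) auto
    also have "\<dots> = sqrt ((a / \<sigma>) ^ CARD('d)) / sqrt (real t)"
      by (simp add: real_sqrt_divide)
    also have "\<dots> \<le> (c_const CARD('d) \<tau> \<sigma> / sqrt 2) / sqrt (real t)"
      by (intro divide_right_mono sqrt_ratio_le_c_const \<sigma> \<tau> a) auto
    finally show ?thesis by (simp add: real_sqrt_mult)
  qed
  have C0: "c_const CARD('d) \<tau> \<sigma> \<ge> 0" by (simp add: c_const_def)
  have v8: "(8::real) > 0" by simp
  have eq: "2 * sqrt (8 / real t * y) = 4 * sqrt (2 / real t * y)" for t y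
  proof -
    have "8 / real t * y = 2\<^sup>2 * (2 / real t * y)" by simp
    then have "sqrt (8 / real t * y) = 2 * sqrt (2 / real t * y)"
      by (simp only: real_sqrt_mult real_sqrt_abs abs_numeral)
    then show ?thesis by simp
  qed
  have tvG: "tv_smooth \<sigma> (empirical x t) P = G t x" if "t \<ge> 1" for t x
    unfolding G_def p_def using tv_smooth_empirical[OF \<sigma> P setsP that] .
  have Eeq: "E = {\<omega> \<in> space M. \<exists>t\<ge>1. c_const CARD('d) \<tau> \<sigma> / sqrt (real t)
      + 2 * sqrt (8 / real t * (ln (l (log 2 (real t))) + ln (1 / \<delta>))) \<le> G t (\<lambda>i. X i \<omega>)}"
    unfolding E_def eq by (simp add: tvG cong: conj_cong)
  show "E \<in> sets M" "measure M E \<le> \<delta>"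
    unfolding Eeq
    using stitched_bound[OF M indep law meas loc sym loo sg mean v8 C0 \<delta> l_ge1 l_sum l_const l_decr] by blast+
qed

subsection \<open>Transport inequalities and Lipschitz functions\<close>

text \<open>The easy half of Kantorovich duality: the difference of the two integrals is one
  integral against any coupling, where the Lipschitz bound applies pointwise.\<close>

lemma W1_lower_bound:
  fixes f :: "'a::{real_normed_vector, second_countable_topology} \<Rightarrow> real"
  assumes \<mu>: "prob_space \<mu>" "sets \<mu> = sets borel" and \<nu>: "sets \<nu> = sets borel"
    and f [measurable]: "f \<in> borel_measurable borel" and lip: "\<And>x y. \<bar>f x - f y\<bar> \<le> norm (x - y)"
    and int: "integrable \<mu> f" "integrable \<nu> f"
  shows "ennreal ((LINT x|\<mu>. f x) - (LINT x|\<nu>. f x)) \<le> W1 \<mu> \<nu>"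
  unfolding W1_def
proof (rule INF_greatest)
  fix \<pi> assume "\<pi> \<in> couplings \<mu> \<nu>"
  then have sets: "sets \<pi> = sets (borel \<Otimes>\<^sub>M borel)" and d: "distr \<pi> borel fst = \<mu>" "distr \<pi> borel snd = \<nu>"
    by (auto simp: couplings_def)
  note sets [measurable_cong]
  have m: "fst \<in> measurable \<pi> borel" "snd \<in> measurable \<pi> borel" by measurable
  have i: "integrable \<pi> (\<lambda>z. f (fst z))" "integrable \<pi> (\<lambda>z. f (snd z))"
    using int m unfolding d[symmetric] by (simp_all add: integrable_distr_eq)
  have "(LINT x|\<mu>. f x) - (LINT x|\<nu>. f x) = (LINT z|\<pi>. f (fst z) - f (snd z))"
    unfolding d[symmetric] using i m by (simp add: integral_distr)
  then have "ennreal ((LINT x|\<mu>. f x) - (LINT x|\<nu>. f x)) \<le> ennreal (norm (LINT z|\<pi>. f (fst z) - f (snd z)))"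
    by (intro ennreal_leI) simp
  also have "\<dots> \<le> (\<integral>\<^sup>+z. ennreal (norm (f (fst z) - f (snd z))) \<partial>\<pi>)"
    using i by (intro integral_norm_bound_ennreal) auto
  also have "\<dots> \<le> (\<integral>\<^sup>+z. (case z of (x, y) \<Rightarrow> ennreal (norm (x - y))) \<partial>\<pi>)"
    using lip by (intro nn_integral_mono) (auto simp: split_def intro!: ennreal_leI)
  finally show "ennreal ((LINT x|\<mu>. f x) - (LINT x|\<nu>. f x)) \<le> \<dots>" .
qed

text \<open>One direction of the Bobkov--Goetze equivalence: apply the transport inequality to the
  exponentially tilted measure \<open>\<mu> \<propto> exp g \<cdot> P\<close>, for which
  \<open>ln \<integral> exp (g - E g) dP = (\<integral> g d\<mu> - \<integral> g dP) - KL(\<mu> | P)\<close>.\<close>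
lemma T1_exp_bounded_lipschitz:
  fixes P :: "'a::{real_normed_vector, second_countable_topology} measure"
  assumes T1: "T1 P v" and v: "v > 0" and L: "L > 0"
    and g [measurable]: "g \<in> borel_measurable borel" and bdd: "\<And>x. \<bar>g x\<bar> \<le> K"
    and lip: "\<And>x y. \<bar>g x - g y\<bar> \<le> L * norm (x - y)"
  shows "(\<integral>\<^sup>+x. ennreal (exp (g x - (LINT x|P. g x))) \<partial>P) \<le> ennreal (exp (L\<^sup>2 * v / 2))"
proof -
  have P: "prob_space P" and setsP [measurable_cong]: "sets P = sets borel"
    and nrm: "integrable P (\<lambda>x. norm x)"
    and tr: "\<And>\<mu>. \<mu> \<in> P1 \<Longrightarrow> kl_div \<mu> P < \<infinity> \<Longrightarrow> W1 \<mu> P \<le> ennreal (sqrt (2 * v * real_of_ereal (kl_div \<mu> P)))"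
    using T1 by (auto simp: T1_def P1_def)
  interpret P: prob_space P by fact
  have ig: "integrable P g"
    by (rule P.integrable_const_bound[where B = K]) (use bdd in auto)
  have ie: "integrable P (\<lambda>x. exp (g x))"
    by (rule P.integrable_const_bound[where B = "exp K"]) (use bdd in \<open>auto simp: abs_le_iff\<close>)
  define Z where "Z = (LINT x|P. exp (g x))"
  have "exp (- K) \<le> Z"
  proof -
    have "(LINT x|P. exp (- K)) \<le> Z"
      unfolding Z_def
    proof (rule integral_mono)
      show "exp (- K) \<le> exp (g x)" for x using bdd[of x] by (simp add: abs_le_iff)
    qed (use ie in auto)
    then show ?thesis by (simp add: P.prob_space)
  qed
  then have Z: "Z > 0" using exp_gt_zero[of "- K"] by linarith
  define h where "h x = exp (g x) / Z" for x
  have h [measurable]: "h \<in> borel_measurable borel" and h0: "\<And>x. h x > 0"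
    unfolding h_def using Z by auto
  have hb: "h x \<le> exp K / Z" for x
    unfolding h_def using bdd[of x] Z by (auto simp: divide_right_mono abs_le_iff)
  have lnh: "ln (h x) = g x - ln Z" for x
    unfolding h_def using Z by (simp add: ln_div)
  define \<mu> where "\<mu> = density P (\<lambda>x. ennreal (h x))"
  have sets\<mu> [measurable_cong]: "sets \<mu> = sets borel" by (simp add: \<mu>_def setsP)
  have ih: "integrable P h" unfolding h_def using ie by simp
  have Eh: "(LINT x|P. h x) = 1" unfolding h_def using Z by (simp add: Z_def)
  have "emeasure \<mu> (space \<mu>) = (\<integral>\<^sup>+x. ennreal (h x) \<partial>P)"
    unfolding \<mu>_def by (subst emeasure_density) (auto intro!: nn_integral_cong)
  also have "\<dots> = 1"
    using ih h0 Eh by (subst nn_integral_eq_integral) (auto simp: less_imp_le)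
  finally have \<mu>: "prob_space \<mu>" by (rule prob_spaceI)
  interpret \<mu>: prob_space \<mu> by fact
  have int\<mu>: "(LINT x|\<mu>. f x) = (LINT x|P. h x * f x)" if [measurable]: "f \<in> borel_measurable borel" for f :: "'a \<Rightarrow> real"
    unfolding \<mu>_def using h0 by (subst integral_real_density) (auto simp: less_imp_le)
  \<comment> \<open>The tilted density is bounded, so the first moment stays finite and the
    transport inequality may be applied to \<open>\<mu>\<close>.\<close>
  have "integrable P (\<lambda>x. h x * norm x)"
  proof (rule Bochner_Integration.integrable_bound)
    show "integrable P (\<lambda>x. exp K / Z * norm x)" using nrm by simp
    show "AE x in P. norm (h x * norm x) \<le> norm (exp K / Z * norm x)"
    proof (intro AE_I2)
      fix x
      have "h x * norm x \<le> exp K / Z * norm x" by (intro mult_right_mono hb) auto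
      then show "norm (h x * norm x) \<le> norm (exp K / Z * norm x)"
        using h0[of x] Z by (simp add: abs_mult)
    qed
  qed measurable
  then have "integrable \<mu> (\<lambda>x. norm x)"
    unfolding \<mu>_def using h0 by (subst integrable_real_density) (auto simp: less_imp_le)
  then have \<mu>P1: "\<mu> \<in> P1" using \<mu> sets\<mu> by (simp add: P1_def)
  have ig\<mu>: "integrable \<mu> g"
    by (rule \<mu>.integrable_const_bound[where B = K]) (use bdd in auto)
  have ac: "absolutely_continuous P \<mu>"
    unfolding \<mu>_def by (rule absolutely_continuousI_density) measurable
  have log: "log (exp 1) x = ln x" for x :: real by (simp add: log_def)
  have ed: "AE x in \<mu>. entropy_density (exp 1) P \<mu> x = g x - ln Z"
  proof -
    have "AE x in P. ennreal (h x) = RN_deriv P \<mu> x"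
      unfolding \<mu>_def by (rule P.RN_deriv_unique) auto
    then have "AE x in P. RN_deriv P \<mu> x = ennreal (h x)"
      by eventually_elim simp
    then have "AE x in P. entropy_density (exp 1) P \<mu> x = g x - ln Z"
      by eventually_elim (simp add: entropy_density_def log lnh h0 less_imp_le)
    then show ?thesis
      unfolding \<mu>_def by (subst AE_density) auto
  qed
  have med: "entropy_density (exp 1) P \<mu> \<in> borel_measurable \<mu>"
    using measurable_entropy_density[of "exp 1" P \<mu>] by (simp add: measurable_cong_sets[OF sets\<mu> refl] measurable_cong_sets[OF setsP refl])
  have ied: "integrable \<mu> (entropy_density (exp 1) P \<mu>)"
    by (rule integrable_cong_AE_imp[OF Bochner_Integration.integrable_diff[OF ig\<mu> \<mu>.integrable_const[of "ln Z"]] med])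
       (use ed in auto)
  define D where "D = KL_divergence (exp 1) P \<mu>"
  have kl: "kl_div \<mu> P = ereal D"
    unfolding kl_div_def D_def using ac ied by simp
  have D: "D = (LINT x|\<mu>. g x) - ln Z"
  proof -
    have "D = (LINT x|\<mu>. g x - ln Z)"
      unfolding D_def KL_divergence_def using ed med by (intro integral_cong_AE) auto
    then show ?thesis using ig\<mu> by (simp add: \<mu>.prob_space)
  qed
  \<comment> \<open>Nonnegativity of the divergence lets \<open>s\<close> be squared back to
    \<open>2 * v * D\<close>.\<close>
  have D0: "D \<ge> 0"
    unfolding D_def \<mu>_def
  proof (rule information_space.KL_nonneg)
    show "information_space P (exp 1)" by unfold_locales simp
    show "prob_space (density P (\<lambda>x. ennreal (h x)))" using \<mu> by (simp add: \<mu>_def)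
    show "integrable P (\<lambda>x. h x * log (exp 1) (h x))"
      unfolding log lnh
    proof (rule P.integrable_const_bound[where B = "exp K / Z * (K + \<bar>ln Z\<bar>)"])
      show "AE x in P. norm (h x * (g x - ln Z)) \<le> exp K / Z * (K + \<bar>ln Z\<bar>)"
      proof (intro AE_I2)
        fix x
        have "\<bar>g x - ln Z\<bar> \<le> K + \<bar>ln Z\<bar>" using bdd[of x] by linarith
        then have "h x * \<bar>g x - ln Z\<bar> \<le> exp K / Z * (K + \<bar>ln Z\<bar>)"
          using Z by (intro mult_mono hb) auto
        then show "norm (h x * (g x - ln Z)) \<le> exp K / Z * (K + \<bar>ln Z\<bar>)"
          using h0[of x] by (simp add: abs_mult)
      qed
    qed measurable
  qed (use h0 in \<open>auto simp: less_imp_le\<close>)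
  define s where "s = sqrt (2 * v * D)"
  have s: "s \<ge> 0" "s\<^sup>2 = 2 * v * D" unfolding s_def using v D0 by auto
  define w where "w = (LINT x|\<mu>. g x) - (LINT x|P. g x)"
  have "ennreal ((LINT x|\<mu>. g x / L) - (LINT x|P. g x / L)) \<le> W1 \<mu> P"
    using lip L ig ig\<mu> by (intro W1_lower_bound \<mu> sets\<mu> setsP)
      (auto simp: diff_divide_distrib[symmetric] abs_divide pos_divide_le_eq mult.commute)
  also have "\<dots> \<le> ennreal s"
    using tr[OF \<mu>P1] unfolding kl s_def by simp
  finally have "ennreal (w / L) \<le> ennreal s"
    unfolding w_def by (simp add: diff_divide_distrib)
  then have "w / L \<le> s" using s by (simp add: ennreal_le_iff)
  then have "w \<le> L * s" using L by (simp add: pos_divide_le_eq mult.commute)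
  \<comment> \<open>AM-GM arranged so that \<open>D\<close> has coefficient 1. It then cancels
    against \<open>D = (LINT x|\<mu>. g x) - ln Z\<close>, and only the Gaussian exponent
    survives.\<close>
  moreover have "L * s \<le> D + L\<^sup>2 * v / 2"
  proof -
    have "0 \<le> (s - L * v)\<^sup>2 / (2 * v)" using v by simp
    also have "\<dots> = D + L\<^sup>2 * v / 2 - L * s"
      unfolding power2_diff s(2) using v by (simp add: field_simps power2_eq_square)
    finally show ?thesis by simp
  qed
  ultimately have "ln Z - (LINT x|P. g x) \<le> L\<^sup>2 * v / 2"
    unfolding w_def D by simp
  then have "exp (ln Z - (LINT x|P. g x)) \<le> exp (L\<^sup>2 * v / 2)"
    by (simp only: exp_le_cancel_iff)
  then have "Z * exp (- (LINT x|P. g x)) \<le> exp (L\<^sup>2 * v / 2)"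
    using Z by (simp only: diff_conv_add_uminus exp_add exp_ln)
  moreover have "(\<integral>\<^sup>+x. ennreal (exp (g x - (LINT x|P. g x))) \<partial>P) = ennreal (Z * exp (- (LINT x|P. g x)))"
  proof -
    have "(\<integral>\<^sup>+x. ennreal (exp (g x - (LINT x|P. g x))) \<partial>P)
        = (\<integral>\<^sup>+x. ennreal (exp (g x) * exp (- (LINT x|P. g x))) \<partial>P)"
      by (simp flip: exp_add)
    also have "\<dots> = ennreal (LINT x|P. exp (g x) * exp (- (LINT x|P. g x)))"
      using ie by (intro nn_integral_eq_integral) auto
    finally show ?thesis by (simp add: Z_def)
  qed
  ultimately show ?thesis by (simp add: ennreal_leI)
qed

text \<open>Exponential tilting needs a bounded function, so \<open>f\<close> is clamped to
  \<open>[-n, n]\<close>, which keeps the Lipschitz constant. The means converge by domination and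
  the exponential bound passes to the limit by Fatou's lemma.\<close>

lemma T1_sub_gaussian_lipschitz:
  fixes P :: "'a::{real_normed_vector, second_countable_topology} measure"
  assumes T1: "T1 P v" and v: "v > 0" and L: "L > 0"
    and f: "f \<in> borel_measurable P" and lip: "\<And>x y. \<bar>f x - f y\<bar> \<le> L * norm (x - y)"
  shows "sub_gaussian P f (L\<^sup>2 * v)"
proof -
  have P: "prob_space P" and setsP [measurable_cong]: "sets P = sets borel"
    and nrm: "integrable P (\<lambda>x. norm x)"
    using T1 by (auto simp: T1_def P1_def)
  interpret P: prob_space P by fact
  note f [measurable]
  have fb: "f \<in> borel_measurable borel" using f by (simp add: measurable_cong_sets[OF setsP refl])
  have int: "integrable P f"
  proof (rule Bochner_Integration.integrable_bound)
    show "integrable P (\<lambda>x. \<bar>f 0\<bar> + L * norm x)" using nrm by simp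
    have "\<bar>f x\<bar> \<le> \<bar>f 0\<bar> + L * norm x" for x
      using lip[of x 0] by simp
    then show "AE x in P. norm (f x) \<le> norm (\<bar>f 0\<bar> + L * norm x)"
      using L by (intro AE_I2) (simp add: add_nonneg_nonneg)
  qed fact
  define F where "F n x = max (- real n) (min (real n) (f x))" for n x
  have F [measurable]: "F n \<in> borel_measurable borel" for n
    unfolding F_def using fb by measurable
  have Flip: "\<bar>F n x - F n y\<bar> \<le> L * norm (x - y)" for n x y
    using lip[of x y] unfolding F_def by linarith
  have Fb: "\<bar>F n x\<bar> \<le> real n" "\<bar>F n x\<bar> \<le> \<bar>f x\<bar>" for n x
    unfolding F_def by linarith+
  have Flim: "(\<lambda>n. F n x) \<longlonglongrightarrow> f x" for x
  proof (rule tendsto_eventually)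
    obtain N :: nat where "\<bar>f x\<bar> \<le> real N" using real_arch_simple by blast
    then show "\<forall>\<^sub>F n in sequentially. F n x = f x"
      unfolding F_def by (intro eventually_sequentiallyI[of N]) linarith
  qed
  have Elim: "(\<lambda>n. LINT x|P. F n x) \<longlonglongrightarrow> (LINT x|P. f x)"
    using int Fb Flim by (intro integral_dominated_convergence[where w = "\<lambda>x. \<bar>f x\<bar>"]) auto
  have "(\<integral>\<^sup>+x. ennreal (exp (u * (f x - (LINT x|P. f x)))) \<partial>P) \<le> ennreal (exp (u\<^sup>2 * (L\<^sup>2 * v) / 2))" for u
  proof (cases "u = 0")
    case True
    then show ?thesis by (simp add: P.emeasure_space_1)
  next
    case False
    let ?e = "\<lambda>n x. ennreal (exp (u * (F n x - (LINT x|P. F n x))))"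
    have bound: "(\<integral>\<^sup>+x. ?e n x \<partial>P) \<le> ennreal (exp (u\<^sup>2 * (L\<^sup>2 * v) / 2))" for n
    proof -
      have "(\<integral>\<^sup>+x. ennreal (exp (u * F n x - (LINT x|P. u * F n x))) \<partial>P) \<le> ennreal (exp ((\<bar>u\<bar> * L)\<^sup>2 * v / 2))"
      proof (rule T1_exp_bounded_lipschitz[OF T1 v])
        show "\<bar>u\<bar> * L > 0" using False L by simp
        show "\<bar>u * F n x\<bar> \<le> \<bar>u\<bar> * real n" for x
          using Fb(1)[of n x] by (simp add: abs_mult mult_left_mono)
        show "\<bar>u * F n x - u * F n y\<bar> \<le> \<bar>u\<bar> * L * norm (x - y)" for x y
          using Flip[of n x y] by (simp add: right_diff_distrib[symmetric] abs_mult mult.assoc mult_left_mono)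
      qed measurable
      then show ?thesis by (simp add: right_diff_distrib power_mult_distrib mult.assoc)
    qed
    have lim: "(\<lambda>n. ?e n x) \<longlonglongrightarrow> ennreal (exp (u * (f x - (LINT x|P. f x))))" for x
      by (intro tendsto_intros Flim Elim)
    have "(\<integral>\<^sup>+x. ennreal (exp (u * (f x - (LINT x|P. f x)))) \<partial>P) = (\<integral>\<^sup>+x. liminf (\<lambda>n. ?e n x) \<partial>P)"
      by (intro nn_integral_cong lim_imp_Liminf[symmetric] lim) simp
    also have "\<dots> \<le> liminf (\<lambda>n. \<integral>\<^sup>+x. ?e n x \<partial>P)"
      by (rule nn_integral_liminf) measurable
    also have "\<dots> \<le> ennreal (exp (u\<^sup>2 * (L\<^sup>2 * v) / 2))"
      by (rule Liminf_le) (auto simp: bound)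
    finally show ?thesis .
  qed
  then show ?thesis
    using int by (simp add: sub_gaussian_real_iff)
qed

text \<open>The map \<open>x \<mapsto> u \<bullet> x\<close> is Lipschitz with constant
  \<open>norm u\<close>; its scalar bound is taken at parameter 1. This makes the mean estimate for
  sub-Gaussian laws available under the transport inequality.\<close>

lemma T1_imp_sub_gaussian:
  fixes P :: "'a::euclidean_space measure"
  assumes T1: "T1 P v" and v: "v > 0"
  shows "sub_gaussian P (\<lambda>x. x) v"
proof -
  have P: "prob_space P" and setsP [measurable_cong]: "sets P = sets borel"
    and nrm: "integrable P (\<lambda>x. norm x)"
    using T1 by (auto simp: T1_def P1_def)
  interpret P: prob_space P by fact
  have int: "integrable P (\<lambda>x. x)"
    using nrm by (subst integrable_norm_iff[symmetric]) auto
  have "(\<integral>\<^sup>+x. ennreal (exp (u \<bullet> (x - (LINT x|P. x)))) \<partial>P) \<le> ennreal (exp ((norm u)\<^sup>2 * v / 2))" for u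
  proof (cases "u = 0")
    case True
    then show ?thesis by (simp add: P.emeasure_space_1)
  next
    case False
    have "sub_gaussian P (\<lambda>x. u \<bullet> x) ((norm u)\<^sup>2 * v)"
      using False by (intro T1_sub_gaussian_lipschitz[OF T1 v])
        (auto simp: inner_diff_right[symmetric] Cauchy_Schwarz_ineq2)
    then have "(\<integral>\<^sup>+x. ennreal (exp (1 * (u \<bullet> x - (LINT x|P. u \<bullet> x)))) \<partial>P) \<le> ennreal (exp (1\<^sup>2 * ((norm u)\<^sup>2 * v) / 2))"
      unfolding sub_gaussian_real_iff by blast
    then show ?thesis
      using int by (simp add: inner_diff_right)
  qed
  then show ?thesis
    using int by (simp add: sub_gaussian_def)
qed

subsection \<open>Wasserstein distance\<close>

text \<open>\<open>B\<close> contributes only its space and sigma-algebra. The summands are meant to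
  be the pieces of a transport plan.\<close>

definition sum_measure :: "'a measure \<Rightarrow> 'i set \<Rightarrow> ('i \<Rightarrow> 'a measure) \<Rightarrow> 'a measure" where
  "sum_measure B I N = measure_of (space B) (sets B) (\<lambda>A. \<Sum>i\<in>I. emeasure (N i) A)"

lemma sets_sum_measure [simp, measurable_cong]: "sets (sum_measure B I N) = sets B"
  by (simp add: sum_measure_def)

lemma space_sum_measure [simp]: "space (sum_measure B I N) = space B"
  by (simp add: sum_measure_def)

lemma emeasure_sum_measure:
  fixes B :: "'a measure"
  assumes N: "\<And>i. i \<in> I \<Longrightarrow> sets (N i) = sets B" and A: "A \<in> sets B"
  shows "emeasure (sum_measure B I N) A = (\<Sum>i\<in>I. emeasure (N i) A)"
proof -
  have "countably_additive (sets B) (\<lambda>A. \<Sum>i\<in>I. emeasure (N i) A)"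
  proof (rule countably_additiveI)
    fix A :: "nat \<Rightarrow> 'a set"
    assume A: "range A \<subseteq> sets B" "disjoint_family A" "(\<Union>i. A i) \<in> sets B"
    have "(\<Sum>n. \<Sum>i\<in>I. emeasure (N i) (A n)) = (\<Sum>i\<in>I. \<Sum>n. emeasure (N i) (A n))"
      by (rule suminf_sum) simp
    also have "\<dots> = (\<Sum>i\<in>I. emeasure (N i) (\<Union>n. A n))"
      using A N by (intro sum.cong refl suminf_emeasure) simp_all
    finally show "(\<Sum>n. \<Sum>i\<in>I. emeasure (N i) (A n)) = (\<Sum>i\<in>I. emeasure (N i) (\<Union>n. A n))" .
  qed
  then show ?thesis
    unfolding sum_measure_def using A sets.sigma_algebra_axioms[of B]
    by (intro emeasure_measure_of_sigma) (simp_all add: positive_def)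
qed

lemma nn_integral_sum_measure:
  assumes N: "\<And>i. i \<in> I \<Longrightarrow> sets (N i) = sets B" and f: "f \<in> borel_measurable B"
  shows "(\<integral>\<^sup>+x. f x \<partial>sum_measure B I N) = (\<Sum>i\<in>I. \<integral>\<^sup>+x. f x \<partial>N i)"
  using f
proof (induction f rule: borel_measurable_induct)
  case (cong f g)
  have "(\<integral>\<^sup>+x. f x \<partial>sum_measure B I N) = (\<integral>\<^sup>+x. g x \<partial>sum_measure B I N)"
    using cong by (intro nn_integral_cong) simp
  moreover have "(\<integral>\<^sup>+x. f x \<partial>N i) = (\<integral>\<^sup>+x. g x \<partial>N i)" if "i \<in> I" for i
    using cong sets_eq_imp_space_eq[OF N[OF that]] by (intro nn_integral_cong) simp
  ultimately show ?case using cong by simp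
next
  case (set A)
  then show ?case using N by (simp add: emeasure_sum_measure)
next
  case (mult u c)
  have "u \<in> borel_measurable (N i)" if "i \<in> I" for i
    using mult by (simp add: measurable_cong_sets[OF N[OF that] refl])
  then show ?case using mult by (simp add: nn_integral_cmult sum_distrib_left)
next
  case (add u v)
  have "u \<in> borel_measurable (N i)" "v \<in> borel_measurable (N i)" if "i \<in> I" for i
    using add by (simp_all add: measurable_cong_sets[OF N[OF that] refl])
  then show ?case using add by (simp add: nn_integral_add sum.distrib)
next
  case (seq U)
  have m: "U n \<in> borel_measurable (N i)" if "i \<in> I" for i n
    using seq by (simp add: measurable_cong_sets[OF N[OF that] refl])
  have "(\<integral>\<^sup>+x. (SUP n. U n) x \<partial>sum_measure B I N) = (SUP n. \<integral>\<^sup>+x. U n x \<partial>sum_measure B I N)"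
    using seq by (simp add: nn_integral_monotone_convergence_SUP image_comp)
  also have "\<dots> = (SUP n. \<Sum>i\<in>I. \<integral>\<^sup>+x. U n x \<partial>N i)"
    using seq by simp
  also have "\<dots> = (\<Sum>i\<in>I. SUP n. \<integral>\<^sup>+x. U n x \<partial>N i)"
    using seq by (intro ennreal_SUP_sum) (auto simp: incseq_def le_fun_def intro!: nn_integral_mono)
  also have "\<dots> = (\<Sum>i\<in>I. \<integral>\<^sup>+x. (SUP n. U n) x \<partial>N i)"
    using seq m by (intro sum.cong) (simp_all add: nn_integral_monotone_convergence_SUP image_comp)
  finally show ?case .
qed

abbreviation transport_cost :: "('a::real_normed_vector \<times> 'a) measure \<Rightarrow> ennreal" where
  "transport_cost \<pi> \<equiv> \<integral>\<^sup>+(x, y). ennreal (norm (x - y)) \<partial>\<pi>"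

text \<open>The pieces need not be probability measures; only their summed marginals matter. The
  three plan constructions below (averaging, keeping the common part in place, moving each atom) all
  reduce to this bound.\<close>

lemma W1_le_sum_transport_cost:
  fixes \<mu> \<nu> :: "'a::{real_normed_vector, second_countable_topology} measure"
  assumes \<pi>: "\<And>i. i \<in> I \<Longrightarrow> sets (\<pi> i) = sets (borel \<Otimes>\<^sub>M borel)"
    and \<mu>: "sets \<mu> = sets borel" "\<And>A. A \<in> sets borel \<Longrightarrow> emeasure \<mu> A = (\<Sum>i\<in>I. emeasure (\<pi> i) (A \<times> UNIV))"
    and \<nu>: "sets \<nu> = sets borel" "\<And>A. A \<in> sets borel \<Longrightarrow> emeasure \<nu> A = (\<Sum>i\<in>I. emeasure (\<pi> i) (UNIV \<times> A))"
  shows "W1 \<mu> \<nu> \<le> (\<Sum>i\<in>I. transport_cost (\<pi> i))"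
proof -
  let ?B = "borel \<Otimes>\<^sub>M borel :: ('a \<times> 'a) measure"
  let ?S = "sum_measure ?B I \<pi>"
  have "distr ?S borel fst = \<mu>"
  proof (rule measure_eqI)
    fix A assume "A \<in> sets (distr ?S borel fst)"
    then have A: "A \<in> sets borel" by simp
    have "fst -` A \<inter> space ?S = A \<times> UNIV" by (auto simp: space_pair_measure)
    then show "emeasure (distr ?S borel fst) A = emeasure \<mu> A"
      using A \<mu> \<pi> by (subst emeasure_distr) (auto simp: emeasure_sum_measure)
  qed (simp add: \<mu>)
  moreover have "distr ?S borel snd = \<nu>"
  proof (rule measure_eqI)
    fix A assume "A \<in> sets (distr ?S borel snd)"
    then have A: "A \<in> sets borel" by simp
    have "snd -` A \<inter> space ?S = UNIV \<times> A" by (auto simp: space_pair_measure)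
    then show "emeasure (distr ?S borel snd) A = emeasure \<nu> A"
      using A \<nu> \<pi> by (subst emeasure_distr) (auto simp: emeasure_sum_measure)
  qed (simp add: \<nu>)
  ultimately have "?S \<in> couplings \<mu> \<nu>" by (simp add: couplings_def)
  then have "W1 \<mu> \<nu> \<le> transport_cost ?S"
    unfolding W1_def by (rule INF_lower)
  also have "\<dots> = (\<Sum>i\<in>I. transport_cost (\<pi> i))"
    using \<pi> by (intro nn_integral_sum_measure) auto
  finally show ?thesis .
qed

text \<open>Replaces the existence of optimal plans: the constructions start from such a plan and
  let \<open>e\<close> tend to 0.\<close>

lemma W1_near_optimal:
  assumes "W1 \<mu> \<nu> < \<infinity>" "e > 0"
  obtains \<pi> where "\<pi> \<in> couplings \<mu> \<nu>" "transport_cost \<pi> \<le> W1 \<mu> \<nu> + ennreal e"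
proof -
  have "W1 \<mu> \<nu> < W1 \<mu> \<nu> + ennreal e"
    using assms by (cases "W1 \<mu> \<nu>" rule: ennreal_cases) (auto simp flip: ennreal_plus simp: ennreal_less_iff)
  then obtain \<pi> where "\<pi> \<in> couplings \<mu> \<nu>" "transport_cost \<pi> < W1 \<mu> \<nu> + ennreal e"
    unfolding W1_def[of \<mu> \<nu>] INF_less_iff by blast
  then show ?thesis by (auto intro: that less_imp_le)
qed

lemma couplings_sets: "\<pi> \<in> couplings \<mu> \<nu> \<Longrightarrow> sets \<pi> = sets (borel \<Otimes>\<^sub>M borel)"
  by (simp add: couplings_def)

lemma couplings_emeasure:
  assumes "\<pi> \<in> couplings \<mu> \<nu>" "A \<in> sets borel"
  shows "emeasure \<pi> (A \<times> UNIV) = emeasure \<mu> A" "emeasure \<pi> (UNIV \<times> A) = emeasure \<nu> A"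
proof -
  have s [measurable_cong]: "sets \<pi> = sets (borel \<Otimes>\<^sub>M borel)"
    and d: "\<mu> = distr \<pi> borel fst" "\<nu> = distr \<pi> borel snd"
    using assms by (auto simp: couplings_def)
  have sp: "space \<pi> = UNIV" using sets_eq_imp_space_eq[OF s] by (simp add: space_pair_measure)
  have "fst -` A \<inter> space \<pi> = A \<times> UNIV" "snd -` A \<inter> space \<pi> = UNIV \<times> A" by (auto simp: sp)
  then show "emeasure \<pi> (A \<times> UNIV) = emeasure \<mu> A" "emeasure \<pi> (UNIV \<times> A) = emeasure \<nu> A"
    unfolding d using assms(2) by (simp_all add: emeasure_distr)
qed

text \<open>Convexity of the transport distance in its first argument: near-optimal plans, each
  scaled by \<open>1 / n\<close>, add up to a plan for the mixture.\<close>

lemma W1_average_le: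
  fixes \<mu> \<nu> :: "'a::{real_normed_vector, second_countable_topology} measure"
  assumes I: "finite I" "I \<noteq> {}" and n: "n = card I"
    and \<mu>: "sets \<mu> = sets borel" "\<And>A. A \<in> sets borel \<Longrightarrow> emeasure \<mu> A = (\<Sum>i\<in>I. emeasure (\<mu>s i) A) / of_nat n"
    and \<nu>: "sets \<nu> = sets borel"
  shows "W1 \<mu> \<nu> \<le> (\<Sum>i\<in>I. W1 (\<mu>s i) \<nu>) / of_nat n"
proof (rule ennreal_le_epsilon)
  have n0: "n > 0" using I n by (simp add: card_gt_0_iff)
  fix e :: real assume fin: "(\<Sum>i\<in>I. W1 (\<mu>s i) \<nu>) / of_nat n < top" and e: "0 < e"
  \<comment> \<open>The right-hand side may be assumed finite. Every summand is then finite, as the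
    choice of near-optimal plans requires.\<close>
  have "W1 (\<mu>s i) \<nu> < \<infinity>" if "i \<in> I" for i
  proof (rule ccontr)
    assume "\<not> W1 (\<mu>s i) \<nu> < \<infinity>"
    then have "W1 (\<mu>s i) \<nu> = top" by (simp add: less_top[symmetric])
    moreover have "W1 (\<mu>s i) \<nu> \<le> (\<Sum>i\<in>I. W1 (\<mu>s i) \<nu>)"
      using I(1) that by (intro member_le_sum) auto
    ultimately have "(\<Sum>i\<in>I. W1 (\<mu>s i) \<nu>) = top" by (simp add: top_unique)
    then show False using fin n0 by (simp add: ennreal_top_divide of_nat_less_top)
  qed
  then have "\<exists>\<pi>. \<pi> \<in> couplings (\<mu>s i) \<nu> \<and> transport_cost \<pi> \<le> W1 (\<mu>s i) \<nu> + ennreal e" if "i \<in> I" for i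
    using W1_near_optimal[of "\<mu>s i" \<nu> e] that e by blast
  then obtain \<pi> where \<pi>: "\<And>i. i \<in> I \<Longrightarrow> \<pi> i \<in> couplings (\<mu>s i) \<nu>"
    and c: "\<And>i. i \<in> I \<Longrightarrow> transport_cost (\<pi> i) \<le> W1 (\<mu>s i) \<nu> + ennreal e"
    by metis
  let ?c = "inverse (of_nat n :: ennreal)"
  have cn: "of_nat n * ?c = 1"
    using n0 by (simp add: ennreal_divide_self of_nat_less_top flip: divide_ennreal_def)
  have "W1 \<mu> \<nu> \<le> (\<Sum>i\<in>I. transport_cost (scale_measure ?c (\<pi> i)))"
  proof (rule W1_le_sum_transport_cost)
    show "sets (scale_measure ?c (\<pi> i)) = sets (borel \<Otimes>\<^sub>M borel)" if "i \<in> I" for i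
      using couplings_sets[OF \<pi>[OF that]] by simp
    show "emeasure \<mu> A = (\<Sum>i\<in>I. emeasure (scale_measure ?c (\<pi> i)) (A \<times> UNIV))" if "A \<in> sets borel" for A
      using couplings_emeasure(1)[OF \<pi> that] \<mu>(2)[OF that]
      by (simp add: divide_ennreal_def sum_distrib_left mult.commute)
    show "emeasure \<nu> A = (\<Sum>i\<in>I. emeasure (scale_measure ?c (\<pi> i)) (UNIV \<times> A))" if "A \<in> sets borel" for A
      using couplings_emeasure(2)[OF \<pi> that] cn by (simp add: n[symmetric] mult.assoc[symmetric])
  qed (use \<mu> \<nu> in auto)
  also have "\<dots> = (\<Sum>i\<in>I. ?c * transport_cost (\<pi> i))"
  proof (rule sum.cong[OF refl])
    fix i assume "i \<in> I"
    then have [measurable_cong]: "sets (\<pi> i) = sets (borel \<Otimes>\<^sub>M borel)" using couplings_sets[OF \<pi>] by blast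
    show "transport_cost (scale_measure ?c (\<pi> i)) = ?c * transport_cost (\<pi> i)"
      by (rule nn_integral_scale_measure) measurable
  qed
  also have "\<dots> \<le> (\<Sum>i\<in>I. ?c * (W1 (\<mu>s i) \<nu> + ennreal e))"
    using c by (intro sum_mono mult_left_mono) auto
  also have "\<dots> = (\<Sum>i\<in>I. W1 (\<mu>s i) \<nu>) / of_nat n + (of_nat n * ?c) * ennreal e"
    by (simp add: distrib_left sum.distrib divide_ennreal_def sum_distrib_left[symmetric] n[symmetric] mult_ac)
  finally show "W1 \<mu> \<nu> \<le> (\<Sum>i\<in>I. W1 (\<mu>s i) \<nu>) / of_nat n + ennreal e"
    unfolding cn by simp
qed

text \<open>The common part \<open>min p q\<close> stays in place, and the excess of \<open>p\<close> is sent to the excess of \<open>q\<close>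
  by an independent coupling whose cost is bounded by passing through \<open>m\<close>.\<close>
lemma W1_density_le:
  fixes p q :: "'a::euclidean_space \<Rightarrow> real"
  assumes p [measurable]: "p \<in> borel_measurable borel" and p0: "\<And>x. p x \<ge> 0" and p1: "(\<integral>\<^sup>+x. ennreal (p x) \<partial>lborel) = 1"
    and q [measurable]: "q \<in> borel_measurable borel" and q0: "\<And>x. q x \<ge> 0" and q1: "(\<integral>\<^sup>+x. ennreal (q x) \<partial>lborel) = 1"
  shows "W1 (density lborel (\<lambda>x. ennreal (p x))) (density lborel (\<lambda>x. ennreal (q x)))
    \<le> (\<integral>\<^sup>+z. ennreal (norm (z - m) * \<bar>p z - q z\<bar>) \<partial>lborel)"
proof -
  let ?p = "density lborel (\<lambda>x. ennreal (p x))" and ?q = "density lborel (\<lambda>x. ennreal (q x))"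
    and ?R = "\<integral>\<^sup>+z. ennreal (norm (z - m) * \<bar>p z - q z\<bar>) \<partial>lborel"
  define g where "g x = max 0 (p x - q x)" for x
  define h where "h x = max 0 (q x - p x)" for x
  define b where "b x = min (p x) (q x)" for x
  have [measurable]: "g \<in> borel_measurable borel" "h \<in> borel_measurable borel" "b \<in> borel_measurable borel"
    unfolding g_def h_def b_def by measurable
  have pos [simp]: "g x \<ge> 0" "h x \<ge> 0" "b x \<ge> 0" for x
    using p0[of x] q0[of x] by (auto simp: g_def h_def b_def)
  have bg: "p x = b x + g x" and bh: "q x = b x + h x" for x
    by (auto simp: b_def g_def h_def)
  have ip: "integrable lborel p" and iq: "integrable lborel q"
    using p1 q1 p0 q0 by (auto intro!: integrableI_nonneg)
  have ig: "integrable lborel g" and ih: "integrable lborel h"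
    using ip iq unfolding g_def h_def by auto
  define K where "K = (LINT x|lborel. g x)"
  have K0: "K \<ge> 0" by (simp add: K_def)
  have Kg: "(\<integral>\<^sup>+x. ennreal (g x) \<partial>lborel) = ennreal K"
    unfolding K_def using ig by (intro nn_integral_eq_integral) auto
  have "(LINT x|lborel. h x) = K"
    unfolding K_def g_def h_def using p1 q1 p0 q0
    by (intro integral_positive_parts_eq ip iq) (simp add: integral_eq_nn_integral)
  then have Kh: "(\<integral>\<^sup>+x. ennreal (h x) \<partial>lborel) = ennreal K"
    using ih by (subst nn_integral_eq_integral) auto
  \<comment> \<open>Normalises the product of the two excesses. If \<open>K = 0\<close>, division by
    zero gives \<open>c = 0\<close>; the excesses are then null and the product piece contributes
    nothing, as it should.\<close>
  define c where "c = 1 / K"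
  have c0: "c \<ge> 0" using K0 by (simp add: c_def)
  let ?g = "density lborel (\<lambda>x. ennreal (g x))" and ?h = "density lborel (\<lambda>x. ennreal (h x))"
    and ?b = "density lborel (\<lambda>x. ennreal (b x))"
  let ?d = "distr ?b (borel \<Otimes>\<^sub>M borel) (\<lambda>z. (z, z))"
    and ?Ig = "\<integral>\<^sup>+z. ennreal (norm (z - m) * g z) \<partial>lborel"
    and ?Ih = "\<integral>\<^sup>+z. ennreal (norm (z - m) * h z) \<partial>lborel"
  interpret h: finite_measure ?h
    by (rule finite_measureI) (simp add: emeasure_density Kh)
  interpret g: finite_measure ?g
    by (rule finite_measureI) (simp add: emeasure_density Kg)
  have cK: "ennreal c * ennreal K * y = y" if "y \<le> ennreal K" for y
  proof (cases "K = 0")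
    case True
    then show ?thesis using that by simp
  next
    case False
    then have "ennreal c * ennreal K = 1" using c0 K0 by (simp add: c_def flip: ennreal_mult)
    then show ?thesis by simp
  qed
  have Ag: "emeasure ?g A \<le> ennreal K" and Ah: "emeasure ?h A \<le> ennreal K" if [measurable]: "A \<in> sets borel" for A
  proof -
    show "emeasure ?g A \<le> ennreal K"
      unfolding Kg[symmetric] by (auto simp: emeasure_density indicator_def intro!: nn_integral_mono)
    show "emeasure ?h A \<le> ennreal K"
      unfolding Kh[symmetric] by (auto simp: emeasure_density indicator_def intro!: nn_integral_mono)
  qed
  \<comment> \<open>Indexed by \<open>bool\<close>: \<open>True\<close> is the stationary mass on
    the diagonal, \<open>False\<close> the normalised product of the excesses.\<close>
  define \<pi> where "\<pi> i = (if i then ?d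
      else scale_measure (ennreal c) (?g \<Otimes>\<^sub>M ?h))" for i
  have sgh: "sets (?g \<Otimes>\<^sub>M ?h) = sets (borel \<Otimes>\<^sub>M borel)"
    by (intro sets_pair_measure_cong) auto
  have split: "emeasure (density lborel (\<lambda>x. ennreal (b x) + ennreal (r x))) A = emeasure ?b A + emeasure (density lborel (\<lambda>x. ennreal (r x))) A"
    if [measurable]: "r \<in> borel_measurable borel" "A \<in> sets borel" and "\<And>x. r x \<ge> 0" for r A
    using that(3) by (simp add: emeasure_density distrib_right nn_integral_add)
  have diag: "emeasure ?d (A \<times> UNIV) = emeasure ?b A"
      "emeasure ?d (UNIV \<times> A) = emeasure ?b A"
    if [measurable]: "A \<in> sets borel" for A
  proof -
    have v: "(\<lambda>z. (z, z)) -` (A \<times> UNIV) = A" "(\<lambda>z. (z, z)) -` (UNIV \<times> A) = A" by auto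
    have m: "(\<lambda>z. (z, z)) \<in> measurable ?b (borel \<Otimes>\<^sub>M borel)" by measurable
    show "emeasure ?d (A \<times> UNIV) = emeasure ?b A"
      using emeasure_distr[OF m, of "A \<times> UNIV"] by (simp add: v)
    show "emeasure ?d (UNIV \<times> A) = emeasure ?b A"
      using emeasure_distr[OF m, of "UNIV \<times> A"] by (simp add: v)
  qed
  have "W1 ?p ?q \<le> (\<Sum>i\<in>UNIV. transport_cost (\<pi> i))"
  proof (rule W1_le_sum_transport_cost)
    show "sets (\<pi> i) = sets (borel \<Otimes>\<^sub>M borel)" for i
      using sgh by (simp add: \<pi>_def)
    fix A :: "'a set" assume A [measurable]: "A \<in> sets borel"
    have "emeasure (?g \<Otimes>\<^sub>M ?h) (A \<times> UNIV) = emeasure ?g A * ennreal K"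
      by (subst h.emeasure_pair_measure_Times) (auto simp: emeasure_density Kh)
    then have "ennreal c * emeasure (?g \<Otimes>\<^sub>M ?h) (A \<times> UNIV) = emeasure ?g A"
      using cK[OF Ag[OF A]] by (simp add: mult_ac)
    then show "emeasure ?p A = (\<Sum>i\<in>UNIV. emeasure (\<pi> i) (A \<times> UNIV))"
      unfolding bg by (simp add: UNIV_bool \<pi>_def diag split add.commute)
    have "emeasure (?g \<Otimes>\<^sub>M ?h) (UNIV \<times> A) = ennreal K * emeasure ?h A"
      by (subst h.emeasure_pair_measure_Times) (auto simp: emeasure_density Kg)
    then have "ennreal c * emeasure (?g \<Otimes>\<^sub>M ?h) (UNIV \<times> A) = emeasure ?h A"
      using cK[OF Ah[OF A]] by (simp add: mult_ac)
    then show "emeasure ?q A = (\<Sum>i\<in>UNIV. emeasure (\<pi> i) (UNIV \<times> A))"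
      unfolding bh by (simp add: UNIV_bool \<pi>_def diag split add.commute)
  qed auto
  also have "\<dots> = transport_cost ?d
      + ennreal c * transport_cost (?g \<Otimes>\<^sub>M ?h)"
    by (simp add: UNIV_bool \<pi>_def nn_integral_scale_measure add.commute)
  also have "transport_cost ?d = 0"
    by (simp add: nn_integral_distr)
  also have "transport_cost (?g \<Otimes>\<^sub>M ?h)
      \<le> ennreal K * (?Ig + ?Ih)"
  proof -
    have "transport_cost (?g \<Otimes>\<^sub>M ?h) = (\<integral>\<^sup>+x. \<integral>\<^sup>+y. ennreal (norm (x - y)) \<partial>?h \<partial>?g)"
      by (subst h.nn_integral_fst[symmetric]) auto
    also have "\<dots> \<le> (\<integral>\<^sup>+x. \<integral>\<^sup>+y. ennreal (norm (x - m)) + ennreal (norm (y - m)) \<partial>?h \<partial>?g)"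
    proof (intro nn_integral_mono)
      fix x y :: 'a
      have "norm (x - y) \<le> norm (x - m) + norm (y - m)"
        using norm_triangle_ineq4[of "x - m" "y - m"] by simp
      then show "ennreal (norm (x - y)) \<le> ennreal (norm (x - m)) + ennreal (norm (y - m))"
        by (simp add: ennreal_leI flip: ennreal_plus)
    qed
    also have "\<dots> = (\<integral>\<^sup>+x. ennreal (norm (x - m)) \<partial>?g) * emeasure ?h UNIV + emeasure ?g UNIV * (\<integral>\<^sup>+y. ennreal (norm (y - m)) \<partial>?h)"
      by (simp add: nn_integral_add nn_integral_multc mult.commute)
    also have "emeasure ?h UNIV = ennreal K" by (simp add: emeasure_density Kh)
    also have "emeasure ?g UNIV = ennreal K" by (simp add: emeasure_density Kg)
    also have "(\<integral>\<^sup>+x. ennreal (norm (x - m)) \<partial>?g) = ?Ig"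
      by (subst nn_integral_density) (auto simp: mult.commute simp flip: ennreal_mult)
    also have "(\<integral>\<^sup>+x. ennreal (norm (x - m)) \<partial>?h) = ?Ih"
      by (subst nn_integral_density) (auto simp: mult.commute simp flip: ennreal_mult)
    finally show ?thesis by (simp add: distrib_left mult.commute)
  qed
  also have "?Ig + ?Ih
      = ?R"
  proof -
    have "\<bar>p z - q z\<bar> = g z + h z" for z by (auto simp: g_def h_def)
    then show ?thesis
      by (subst nn_integral_add[symmetric]) (auto simp: distrib_left simp flip: ennreal_plus)
  qed
  finally have "W1 ?p ?q
      \<le> (ennreal c * ennreal K) * ?R"
    by (simp add: mult_left_mono mult.assoc)
  also have "ennreal c * ennreal K \<le> 1"
    using K0 c0 by (cases "K = 0") (auto simp: c_def simp flip: ennreal_mult)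
  then have "(ennreal c * ennreal K) * ?R
      \<le> ?R"
    using mult_right_mono[of "ennreal c * ennreal K" 1] by simp
  finally show ?thesis .
qed

section \<open>Finiteness of the smoothed transport distance\<close>

lemma nn_integral_norm_gauss_dens_finite:
  assumes "\<sigma> > 0"
  shows "(\<integral>\<^sup>+z. ennreal (norm (z :: real ^ 'd) * gauss_dens \<sigma> z) \<partial>lborel) < \<infinity>"
proof -
  have "norm z * gauss_dens \<sigma> z \<le> gauss_dens \<sigma> z + (norm z)\<^sup>2 * gauss_dens \<sigma> z" for z :: "real ^ 'd"
  proof -
    have "0 \<le> (norm z - 1)\<^sup>2 + norm z" by (intro add_nonneg_nonneg) auto
    then have "norm z \<le> 1 + (norm z)\<^sup>2" by (simp add: power2_diff)
    then have "norm z * gauss_dens \<sigma> z \<le> (1 + (norm z)\<^sup>2) * gauss_dens \<sigma> z"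
      by (intro mult_right_mono) auto
    then show ?thesis by (simp add: distrib_right)
  qed
  then have "(\<integral>\<^sup>+z. ennreal (norm (z :: real ^ 'd) * gauss_dens \<sigma> z) \<partial>lborel)
      \<le> (\<integral>\<^sup>+z. ennreal (gauss_dens \<sigma> z) + ennreal ((norm (z :: real ^ 'd))\<^sup>2 * gauss_dens \<sigma> z) \<partial>lborel)"
    by (intro nn_integral_mono) (simp flip: ennreal_plus)
  also have "\<dots> = 1 + (\<integral>\<^sup>+z. ennreal ((norm (z :: real ^ 'd))\<^sup>2 * gauss_dens \<sigma> z) \<partial>lborel)"
    by (subst nn_integral_add) (auto simp: nn_integral_gauss_dens[OF assms])
  also have "\<dots> \<le> 1 + ennreal (2 * real CARD('d) * \<sigma>\<^sup>2)"
    by (intro add_left_mono nn_integral_norm_sq_gauss_dens assms)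
  also have "\<dots> < \<infinity>" by simp
  finally show ?thesis .
qed

lemma nn_integral_norm_smooth_dens_finite:
  fixes \<mu> :: "(real ^ 'd) measure"
  assumes \<sigma>: "\<sigma> > 0" and \<mu>: "\<mu> \<in> P1"
  shows "(\<integral>\<^sup>+z. ennreal (norm z * smooth_dens \<sigma> \<mu> z) \<partial>lborel) < \<infinity>"
proof -
  have P: "prob_space \<mu>" and S [measurable_cong]: "sets \<mu> = sets borel" and N: "integrable \<mu> (\<lambda>x. norm x)"
    using \<mu> by (auto simp: P1_def)
  interpret \<mu>: prob_space \<mu> by fact
  interpret pair_sigma_finite \<mu> "lborel :: (real ^ 'd) measure" ..
  let ?C = "\<integral>\<^sup>+z. ennreal (norm (z :: real ^ 'd) * gauss_dens \<sigma> z) \<partial>lborel"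
  have "(\<integral>\<^sup>+z. ennreal (norm z * smooth_dens \<sigma> \<mu> z) \<partial>lborel)
      = (\<integral>\<^sup>+z. \<integral>\<^sup>+x. ennreal (norm z * gauss_dens \<sigma> (z - x)) \<partial>\<mu> \<partial>lborel)"
    by (simp add: ennreal_mult ennreal_smooth_dens[OF \<sigma> P S] nn_integral_cmult)
  also have "\<dots> = (\<integral>\<^sup>+x. \<integral>\<^sup>+z. ennreal (norm z * gauss_dens \<sigma> (z - x)) \<partial>lborel \<partial>\<mu>)"
    by (rule Fubini') measurable
  also have "\<dots> \<le> (\<integral>\<^sup>+x. ?C + ennreal (norm x) \<partial>\<mu>)"
  proof (rule nn_integral_mono)
    fix x :: "real ^ 'd"
    have "(\<integral>\<^sup>+z. ennreal (norm z * gauss_dens \<sigma> (z - x)) \<partial>lborel)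
        = (\<integral>\<^sup>+z. ennreal (norm (z + x) * gauss_dens \<sigma> (z + x - x)) \<partial>lborel)"
      by (rule nn_integral_lborel_shift[symmetric]) measurable
    also have "\<dots> \<le> (\<integral>\<^sup>+z. ennreal (norm z * gauss_dens \<sigma> (z :: real ^ 'd)) + ennreal (norm x) * ennreal (gauss_dens \<sigma> z) \<partial>lborel)"
    proof (rule nn_integral_mono)
      fix z
      have "norm (z + x) * gauss_dens \<sigma> (z + x - x) \<le> (norm z + norm x) * gauss_dens \<sigma> z"
        using norm_triangle_ineq[of z x] by (simp add: mult_right_mono)
      then show "ennreal (norm (z + x) * gauss_dens \<sigma> (z + x - x)) \<le> ennreal (norm z * gauss_dens \<sigma> z) + ennreal (norm x) * ennreal (gauss_dens \<sigma> z)"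
        by (simp add: distrib_right ennreal_leI flip: ennreal_mult ennreal_plus)
    qed
    also have "\<dots> = ?C + ennreal (norm x)"
      by (subst nn_integral_add) (auto simp: nn_integral_cmult nn_integral_gauss_dens[OF \<sigma>])
    finally show "(\<integral>\<^sup>+z. ennreal (norm z * gauss_dens \<sigma> (z - x)) \<partial>lborel) \<le> \<dots>" .
  qed
  also have "\<dots> = ?C + (\<integral>\<^sup>+x. ennreal (norm x) \<partial>\<mu>)"
    by (subst nn_integral_add) (auto simp: \<mu>.emeasure_space_1)
  also have "\<dots> < \<infinity>"
    using nn_integral_norm_gauss_dens_finite[OF \<sigma>, where 'd='d] N by (simp add: integrable_iff_bounded)
  finally show ?thesis .
qed

lemma W1_smooth_le:
  fixes \<mu> \<nu> :: "(real ^ 'd) measure"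
  assumes \<sigma>: "\<sigma> > 0" and \<mu>: "prob_space \<mu>" "sets \<mu> = sets borel" and \<nu>: "prob_space \<nu>" "sets \<nu> = sets borel"
  shows "W1_smooth \<sigma> \<mu> \<nu> \<le> (\<integral>\<^sup>+z. ennreal (norm (z - m) * \<bar>smooth_dens \<sigma> \<mu> z - smooth_dens \<sigma> \<nu> z\<bar>) \<partial>lborel)"
  unfolding W1_smooth_def smooth_eq_density[OF \<sigma> \<mu>] smooth_eq_density[OF \<sigma> \<nu>]
  using smooth_dens_measurable[OF \<mu>] smooth_dens_measurable[OF \<nu>] nn_integral_smooth_dens[OF \<sigma> \<mu>] nn_integral_smooth_dens[OF \<sigma> \<nu>]
  by (intro W1_density_le) auto

text \<open>Finiteness makes \<open>enn2real\<close> faithful, so the extended-valued distance can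
  be treated as a real statistic. Both smoothed densities keep a finite first moment, which suffices
  with centre 0.\<close>

lemma W1_smooth_finite:
  fixes \<mu> \<nu> :: "(real ^ 'd) measure"
  assumes \<sigma>: "\<sigma> > 0" and "\<mu> \<in> P1" "\<nu> \<in> P1"
  shows "W1_smooth \<sigma> \<mu> \<nu> < \<infinity>"
proof -
  have \<mu>: "prob_space \<mu>" "sets \<mu> = sets borel" and \<nu>: "prob_space \<nu>" "sets \<nu> = sets borel"
    using assms by (auto simp: P1_def)
  note [measurable] = smooth_dens_measurable[OF \<mu>] smooth_dens_measurable[OF \<nu>]
  have "W1_smooth \<sigma> \<mu> \<nu> \<le> (\<integral>\<^sup>+z. ennreal (norm (z - 0) * \<bar>smooth_dens \<sigma> \<mu> z - smooth_dens \<sigma> \<nu> z\<bar>) \<partial>lborel)"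
    by (rule W1_smooth_le[OF \<sigma> \<mu> \<nu>])
  also have "\<dots> \<le> (\<integral>\<^sup>+z. ennreal (norm z * smooth_dens \<sigma> \<mu> z) + ennreal (norm z * smooth_dens \<sigma> \<nu> z) \<partial>lborel)"
  proof (rule nn_integral_mono)
    fix z :: "real ^ 'd"
    have "\<bar>smooth_dens \<sigma> \<mu> z - smooth_dens \<sigma> \<nu> z\<bar> \<le> smooth_dens \<sigma> \<mu> z + smooth_dens \<sigma> \<nu> z"
      by (auto simp: abs_le_iff)
    then have "norm z * \<bar>smooth_dens \<sigma> \<mu> z - smooth_dens \<sigma> \<nu> z\<bar> \<le> norm z * (smooth_dens \<sigma> \<mu> z + smooth_dens \<sigma> \<nu> z)"
      by (intro mult_left_mono) auto
    then show "ennreal (norm (z - 0) * \<bar>smooth_dens \<sigma> \<mu> z - smooth_dens \<sigma> \<nu> z\<bar>)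
        \<le> ennreal (norm z * smooth_dens \<sigma> \<mu> z) + ennreal (norm z * smooth_dens \<sigma> \<nu> z)"
      by (simp add: distrib_left ennreal_leI flip: ennreal_plus)
  qed
  also have "\<dots> = (\<integral>\<^sup>+z. ennreal (norm z * smooth_dens \<sigma> \<mu> z) \<partial>lborel) + (\<integral>\<^sup>+z. ennreal (norm z * smooth_dens \<sigma> \<nu> z) \<partial>lborel)"
    by (rule nn_integral_add) measurable
  also have "\<dots> < \<infinity>"
    using nn_integral_norm_smooth_dens_finite[OF \<sigma> assms(2)] nn_integral_norm_smooth_dens_finite[OF \<sigma> assms(3)]
    by simp
  finally show ?thesis .
qed

lemma empirical_in_P1: "t \<ge> 1 \<Longrightarrow> empirical x t \<in> P1"
  by (auto simp: P1_def prob_space_empirical)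
     (simp add: empirical_eq_distr integrable_distr_eq integrable_measure_pmf_finite)

text \<open>A coupling of the smoothed empirical measure of \<open>x\<close> is transported to one for \<open>y\<close>: a point \<open>a\<close> is
  attributed to the atom \<open>x i\<close> with its posterior probability \<open>w i a\<close> and then moved by \<open>y i - x i\<close>.
  This replaces the gluing lemma.\<close>
lemma W1_smooth_empirical_lipschitz:
  fixes P :: "(real ^ 'd) measure"
  assumes \<sigma>: "\<sigma> > 0" and P: "prob_space P" "sets P = sets borel" and t: "t \<ge> 1"
  shows "W1_smooth \<sigma> (empirical y t) P
    \<le> W1_smooth \<sigma> (empirical x t) P + ennreal ((\<Sum>i=1..t. norm (y i - x i)) / real t)"
proof -
  let ?K = "ennreal ((\<Sum>i=1..t. norm (y i - x i)) / real t)"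
  let ?g = "\<lambda>z v. gauss_dens \<sigma> (z - v) :: real"
  define \<nu> where "\<nu> = smooth \<sigma> P"
  have sets\<nu>: "sets \<nu> = sets borel" by (simp add: \<nu>_def smooth_def)
  have dens: "smooth \<sigma> (empirical x t) = density lborel (\<lambda>z. ennreal ((\<Sum>i=1..t. ?g z (x i)) / real t))" for x
    unfolding smooth_eq_density[OF \<sigma> prob_space_empirical[OF t] sets_empirical] smooth_dens_empirical[OF t] ..
  define F where "F z = (\<Sum>i=1..t. ?g z (x i))" for z
  have F: "F z > 0" for z
    unfolding F_def using t by (intro sum_pos gauss_dens_pos \<sigma>) auto
  have Fm [measurable]: "F \<in> borel_measurable borel" unfolding F_def by measurable
  define w where "w i z = ?g z (x i) / F z" for i z
  have w0: "w i z \<ge> 0" for i z unfolding w_def using F[of z] by (simp add: less_imp_le)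
  have w1: "(\<Sum>i=1..t. w i z) = 1" for z
    unfolding w_def sum_divide_distrib[symmetric] F_def[symmetric] using F[of z] by simp
  have wm [measurable]: "w i \<in> borel_measurable borel" for i unfolding w_def by measurable
  let ?\<mu> = "smooth \<sigma> (empirical x t)" and ?\<mu>' = "smooth \<sigma> (empirical y t)"
  let ?c = "\<lambda>i u. ennreal (w i (fst u)) * ennreal (norm (fst u - snd u))"
  have bound: "W1 ?\<mu>' \<nu> \<le> transport_cost \<pi> + ?K"
    if \<pi>: "\<pi> \<in> couplings ?\<mu> \<nu>" for \<pi>
  proof -
    have S [measurable_cong]: "sets \<pi> = sets (borel \<Otimes>\<^sub>M borel)" using couplings_sets[OF \<pi>] .
    have sp: "space \<pi> = UNIV" using sets_eq_imp_space_eq[OF S] by (simp add: space_pair_measure)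
    have d1: "distr \<pi> borel fst = ?\<mu>" using \<pi> by (simp add: couplings_def)
    let ?T = "\<lambda>i u. (fst u + (y i - x i), snd u)"
    define \<pi>' where "\<pi>' i = distr (density \<pi> (\<lambda>u. ennreal (w i (fst u)))) (borel \<Otimes>\<^sub>M borel) (?T i)" for i
    have int: "(\<integral>\<^sup>+u. G u \<partial>\<pi>' i) = (\<integral>\<^sup>+u. ennreal (w i (fst u)) * G (?T i u) \<partial>\<pi>)"
      if [measurable]: "G \<in> borel_measurable (borel \<Otimes>\<^sub>M borel)" for G i
      unfolding \<pi>'_def by (subst nn_integral_distr, measurable) (subst nn_integral_density, auto)
    \<comment> \<open>The first marginal of the plan has density \<open>F z / real t\<close>;
      weighting by \<open>w i\<close> isolates the share \<open>?g z (x i) / real t\<close> of the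
      atom \<open>x i\<close>.\<close>
    have marg: "(\<integral>\<^sup>+u. ennreal (w i (fst u)) * f (fst u) \<partial>\<pi>) = (\<integral>\<^sup>+z. ennreal (?g z (x i) / real t) * f z \<partial>lborel)"
      if [measurable]: "f \<in> borel_measurable borel" for f i
    proof -
      have "(\<integral>\<^sup>+u. ennreal (w i (fst u)) * f (fst u) \<partial>\<pi>) = (\<integral>\<^sup>+z. ennreal (w i z) * f z \<partial>distr \<pi> borel fst)"
        by (subst nn_integral_distr) auto
      also have "\<dots> = (\<integral>\<^sup>+z. ennreal (F z / real t) * (ennreal (w i z) * f z) \<partial>lborel)"
        unfolding d1 dens F_def[symmetric] by (subst nn_integral_density) auto
      also have "\<dots> = (\<integral>\<^sup>+z. ennreal (?g z (x i) / real t) * f z \<partial>lborel)"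
      proof (rule nn_integral_cong)
        fix z
        have "F z / real t * w i z = ?g z (x i) / real t"
          unfolding w_def using F[of z] by simp
        moreover have "ennreal (F z / real t) * ennreal (w i z) = ennreal (F z / real t * w i z)"
          using F[of z] w0[of i z] by (intro ennreal_mult[symmetric]) (auto simp: less_imp_le)
        ultimately show "ennreal (F z / real t) * (ennreal (w i z) * f z) = ennreal (?g z (x i) / real t) * f z"
          by (simp only: mult.assoc[symmetric])
      qed
      finally show ?thesis .
    qed
    have "W1 ?\<mu>' \<nu> \<le> (\<Sum>i=1..t. transport_cost (\<pi>' i))"
    proof (rule W1_le_sum_transport_cost)
      show "sets (\<pi>' i) = sets (borel \<Otimes>\<^sub>M borel)" for i by (simp add: \<pi>'_def)
      show "sets ?\<mu>' = sets borel" by (simp add: smooth_def)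
      show "sets \<nu> = sets borel" by (rule sets\<nu>)
      fix A :: "(real ^ 'd) set" assume A [measurable]: "A \<in> sets borel"
      have "emeasure (\<pi>' i) (A \<times> UNIV) = (\<integral>\<^sup>+z. ennreal (?g z (y i) / real t) * indicator A z \<partial>lborel)" for i
      proof -
        have "emeasure (\<pi>' i) (A \<times> UNIV) = (\<integral>\<^sup>+u. indicator (A \<times> UNIV) u \<partial>\<pi>' i)"
          by (rule nn_integral_indicator[symmetric]) (simp add: \<pi>'_def)
        also have "\<dots> = (\<integral>\<^sup>+u. ennreal (w i (fst u)) * indicator (A \<times> UNIV) (?T i u) \<partial>\<pi>)"
          by (rule int) measurable
        also have "\<dots> = (\<integral>\<^sup>+u. ennreal (w i (fst u)) * indicator A (fst u + (y i - x i)) \<partial>\<pi>)"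
          by (simp add: indicator_def)
        also have "\<dots> = (\<integral>\<^sup>+z. ennreal (?g z (x i) / real t) * indicator A (z + (y i - x i)) \<partial>lborel)"
          by (rule marg) measurable
        \<comment> \<open>The shift by \<open>y i - x i\<close> carries the kernel centred at
          \<open>x i\<close> to the one centred at \<open>y i\<close>. The second coordinate is not
          moved, so the second marginal is recovered from the weights summing to 1.\<close>
        also have "\<dots> = (\<integral>\<^sup>+z. ennreal (?g (z + (y i - x i)) (y i) / real t) * indicator A (z + (y i - x i)) \<partial>lborel)"
          by simp
        also have "\<dots> = (\<integral>\<^sup>+z. ennreal (?g z (y i) / real t) * indicator A z \<partial>lborel)"
          by (rule nn_integral_lborel_shift) measurable
        finally show ?thesis .
      qed
      then have "(\<Sum>i=1..t. emeasure (\<pi>' i) (A \<times> UNIV)) = (\<integral>\<^sup>+z. (\<Sum>i=1..t. ennreal (?g z (y i) / real t) * indicator A z) \<partial>lborel)"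
        by (simp only:) (rule nn_integral_sum[symmetric], measurable)
      also have "\<dots> = (\<integral>\<^sup>+z. ennreal ((\<Sum>i=1..t. ?g z (y i)) / real t) * indicator A z \<partial>lborel)"
        by (simp only: sum_distrib_right[symmetric] sum_divide_distrib) (simp add: sum_ennreal)
      also have "\<dots> = emeasure ?\<mu>' A"
        unfolding dens by (subst emeasure_density) auto
      finally show "emeasure ?\<mu>' A = (\<Sum>i=1..t. emeasure (\<pi>' i) (A \<times> UNIV))" ..
      have "emeasure (\<pi>' i) (UNIV \<times> A) = (\<integral>\<^sup>+u. ennreal (w i (fst u)) * indicator (UNIV \<times> A) u \<partial>\<pi>)" for i
      proof -
        have "emeasure (\<pi>' i) (UNIV \<times> A) = (\<integral>\<^sup>+u. indicator (UNIV \<times> A) u \<partial>\<pi>' i)"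
          by (rule nn_integral_indicator[symmetric]) (simp add: \<pi>'_def)
        also have "\<dots> = (\<integral>\<^sup>+u. ennreal (w i (fst u)) * indicator (UNIV \<times> A) (?T i u) \<partial>\<pi>)"
          by (rule int) measurable
        finally show ?thesis by (simp add: indicator_def mem_Times_iff)
      qed
      then have "(\<Sum>i=1..t. emeasure (\<pi>' i) (UNIV \<times> A)) = (\<integral>\<^sup>+u. (\<Sum>i=1..t. ennreal (w i (fst u)) * indicator (UNIV \<times> A) u) \<partial>\<pi>)"
        by (simp only:) (rule nn_integral_sum[symmetric], measurable)
      also have "\<dots> = (\<integral>\<^sup>+u. indicator (UNIV \<times> A) u \<partial>\<pi>)"
        by (simp only: sum_distrib_right[symmetric] sum_ennreal[OF w0] w1) simp
      also have "\<dots> = emeasure \<pi> (UNIV \<times> A)"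
        by (rule nn_integral_indicator) measurable
      also have "\<dots> = emeasure \<nu> A"
        by (rule couplings_emeasure(2)[OF \<pi> A])
      finally show "emeasure \<nu> A = (\<Sum>i=1..t. emeasure (\<pi>' i) (UNIV \<times> A))" ..
    qed
    also have "\<dots> \<le> (\<Sum>i=1..t. (\<integral>\<^sup>+u. ?c i u \<partial>\<pi>)
        + ennreal (norm (y i - x i) / real t))"
    proof (rule sum_mono)
      fix i
      have "transport_cost (\<pi>' i) = (\<integral>\<^sup>+u. ennreal (w i (fst u)) * ennreal (norm (fst u + (y i - x i) - snd u)) \<partial>\<pi>)"
        by (subst int) auto
      also have "\<dots> \<le> (\<integral>\<^sup>+u. ?c i u
          + ennreal (w i (fst u)) * ennreal (norm (y i - x i)) \<partial>\<pi>)"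
      proof (rule nn_integral_mono)
        fix u :: "(real ^ 'd) \<times> (real ^ 'd)"
        have "norm (fst u + (y i - x i) - snd u) \<le> norm (fst u - snd u) + norm (y i - x i)"
          using norm_triangle_ineq[of "fst u - snd u" "y i - x i"] by (simp add: algebra_simps)
        then have "ennreal (w i (fst u)) * ennreal (norm (fst u + (y i - x i) - snd u))
            \<le> ennreal (w i (fst u)) * ennreal (norm (fst u - snd u) + norm (y i - x i))"
          by (intro mult_left_mono ennreal_leI) auto
        then show "ennreal (w i (fst u)) * ennreal (norm (fst u + (y i - x i) - snd u))
            \<le> ?c i u + ennreal (w i (fst u)) * ennreal (norm (y i - x i))"
          by (simp add: distrib_left)
      qed
      also have "\<dots> = (\<integral>\<^sup>+u. ?c i u \<partial>\<pi>)
          + (\<integral>\<^sup>+u. ennreal (w i (fst u)) * ennreal (norm (y i - x i)) \<partial>\<pi>)"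
        by (rule nn_integral_add) measurable
      also have "(\<integral>\<^sup>+u. ennreal (w i (fst u)) * ennreal (norm (y i - x i)) \<partial>\<pi>)
          = (\<integral>\<^sup>+z. ennreal (?g z (x i) / real t) * ennreal (norm (y i - x i)) \<partial>lborel)"
        by (rule marg) measurable
      also have "\<dots> = (\<integral>\<^sup>+z. ennreal (?g z (x i)) * ennreal (norm (y i - x i) / real t) \<partial>lborel)"
        by (intro nn_integral_cong) (simp flip: ennreal_mult)
      \<comment> \<open>Each atom owns mass \<open>1 / t\<close>, which is what its displacement
        costs.\<close>
      also have "\<dots> = ennreal (norm (y i - x i) / real t)"
        by (subst nn_integral_multc) (auto simp: integrable_gauss_dens_shift(2)[OF \<sigma>])
      finally show "transport_cost (\<pi>' i) \<le> (\<integral>\<^sup>+u. ?c i u \<partial>\<pi>)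
          + ennreal (norm (y i - x i) / real t)" .
    qed
    also have "\<dots> = (\<Sum>i=1..t. \<integral>\<^sup>+u. ?c i u \<partial>\<pi>) + ?K"
      by (simp add: sum.distrib sum_ennreal sum_divide_distrib)
    also have "(\<Sum>i=1..t. \<integral>\<^sup>+u. ?c i u \<partial>\<pi>)
        = (\<integral>\<^sup>+u. (\<Sum>i=1..t. ?c i u) \<partial>\<pi>)"
      by (rule nn_integral_sum[symmetric]) measurable
    also have "\<dots> = (\<integral>\<^sup>+u. ennreal (norm (fst u - snd u)) \<partial>\<pi>)"
      by (simp only: sum_distrib_right[symmetric] sum_ennreal[OF w0] w1) simp
    finally show ?thesis by (simp add: split_def)
  qed
  show ?thesis
    unfolding W1_smooth_def \<nu>_def[symmetric]
  proof (rule ennreal_le_epsilon)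
    fix e :: real assume "W1 ?\<mu> \<nu> + ?K < top" and e: "0 < e"
    then have "W1 ?\<mu> \<nu> < \<infinity>" by (simp add: ennreal_add_less_top)
    then obtain \<pi> where \<pi>: "\<pi> \<in> couplings ?\<mu> \<nu>"
        "transport_cost \<pi> \<le> W1 ?\<mu> \<nu> + ennreal e"
      using W1_near_optimal e by blast
    have "W1 ?\<mu>' \<nu> \<le> transport_cost \<pi> + ?K" by (rule bound[OF \<pi>(1)])
    also have "\<dots> \<le> W1 ?\<mu> \<nu> + ennreal e + ?K" by (intro add_right_mono \<pi>)
    finally show "W1 ?\<mu>' \<nu> \<le> W1 ?\<mu> \<nu> + ?K + ennreal e"
      by (simp add: ac_simps)
  qed
qed

lemma empirical_cong:
  assumes "\<And>i. i \<in> {1..t} \<Longrightarrow> x i = y i"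
  shows "empirical x t = empirical y t"
proof -
  have "(\<Sum>i=1..t. emeasure (return borel (x i)) A) = (\<Sum>i=1..t. emeasure (return borel (y i)) A)" for A
    using assms by (intro sum.cong) auto
  then show ?thesis unfolding empirical_def by (simp only:)
qed

lemma empirical_comp_swap:
  assumes "i \<in> {1..t}" "t \<le> s"
  shows "empirical (x \<circ> swap i t) s = empirical x s"
  unfolding empirical_def
  using sum_comp_swap[OF assms, of "\<lambda>v. emeasure (return borel v) _" x] by simp

text \<open>The smoothed empirical measure is the average of the \<open>t\<close> smoothed
  leave-one-out measures, already at the level of densities; the rest is convexity.\<close>

lemma W1_smooth_leave_one_out:
  fixes P :: "(real ^ 'd) measure"
  assumes \<sigma>: "\<sigma> > 0" and t: "2 \<le> t"
  shows "W1_smooth \<sigma> (empirical x t) P \<le> (\<Sum>i=1..t. W1_smooth \<sigma> (empirical (x \<circ> swap i t) (t - 1)) P) / of_nat t"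
  unfolding W1_smooth_def
proof (rule W1_average_le)
  have t1: "t \<ge> 1" "t - 1 \<ge> 1" using t by auto
  let ?D = "\<lambda>n x z. (\<Sum>i=1..n. gauss_dens \<sigma> (z - x i)) / real n"
  have dens: "smooth \<sigma> (empirical x n) = density lborel (\<lambda>z. ennreal (?D n x z))" if "n \<ge> 1" for x :: "nat \<Rightarrow> real ^ 'd" and n
    unfolding smooth_eq_density[OF \<sigma> prob_space_empirical[OF that] sets_empirical] smooth_dens_empirical[OF that] ..
  fix A :: "(real ^ 'd) set" assume A [measurable]: "A \<in> sets borel"
  have avg: "?D t x z = (\<Sum>i=1..t. ?D (t - 1) (x \<circ> swap i t) z) / real t" for z
    by (rule leave_one_out_average[OF t, of "\<lambda>v. gauss_dens \<sigma> (z - v)" x, symmetric])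
  have D0: "?D n x z \<ge> 0" for n x z by (simp add: sum_nonneg)
  have "emeasure (smooth \<sigma> (empirical x t)) A = (\<integral>\<^sup>+z. ennreal (?D t x z) * indicator A z \<partial>lborel)"
    unfolding dens[OF t1(1)] by (rule emeasure_density) measurable
  also have "\<dots> = (\<integral>\<^sup>+z. (\<Sum>i=1..t. ennreal (?D (t - 1) (x \<circ> swap i t) z) * indicator A z) / of_nat t \<partial>lborel)"
  proof (rule nn_integral_cong)
    fix z
    have "ennreal (?D t x z) = (\<Sum>i=1..t. ennreal (?D (t - 1) (x \<circ> swap i t) z)) / of_nat t"
      unfolding avg sum_ennreal[OF D0] ennreal_of_nat_eq_real_of_nat
      using t by (intro divide_ennreal[symmetric] sum_nonneg D0) auto
    then show "ennreal (?D t x z) * indicator A z = (\<Sum>i=1..t. ennreal (?D (t - 1) (x \<circ> swap i t) z) * indicator A z) / of_nat t"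
      by (simp only: sum_distrib_right[symmetric] divide_ennreal_def mult.assoc mult.commute[of "inverse _"])
  qed
  also have "\<dots> = (\<integral>\<^sup>+z. (\<Sum>i=1..t. ennreal (?D (t - 1) (x \<circ> swap i t) z) * indicator A z) \<partial>lborel) / of_nat t"
    by (rule nn_integral_divide) measurable
  also have "(\<integral>\<^sup>+z. (\<Sum>i=1..t. ennreal (?D (t - 1) (x \<circ> swap i t) z) * indicator A z) \<partial>lborel)
      = (\<Sum>i=1..t. \<integral>\<^sup>+z. ennreal (?D (t - 1) (x \<circ> swap i t) z) * indicator A z \<partial>lborel)"
    by (rule nn_integral_sum) measurable
  also have "\<dots> = (\<Sum>i=1..t. emeasure (smooth \<sigma> (empirical (x \<circ> swap i t) (t - 1))) A)"
    unfolding dens[OF t1(2)] by (intro sum.cong refl emeasure_density[symmetric]) measurable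
  finally show "emeasure (smooth \<sigma> (empirical x t)) A
      = (\<Sum>i=1..t. emeasure (smooth \<sigma> (empirical (x \<circ> swap i t) (t - 1))) A) / of_nat t" .
qed (use t in \<open>auto simp: smooth_def\<close>)

text \<open>The infimum over couplings gives no direct access to measurability. A Lipschitz bound in
  finitely many coordinates gives continuity for the product topology, whose Borel sets are the
  product sigma-algebra here.\<close>

lemma borel_measurable_PiM_lipschitz:
  fixes G :: "(nat \<Rightarrow> 'a::{real_normed_vector, second_countable_topology}) \<Rightarrow> real"
  assumes "\<And>x y. \<bar>G y - G x\<bar> \<le> (\<Sum>i\<in>I. norm (y i - x i)) * C"
  shows "G \<in> borel_measurable (Pi\<^sub>M UNIV (\<lambda>_. borel))"
proof -
  have "continuous_on UNIV G"
    unfolding continuous_on_def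
  proof
    fix x :: "nat \<Rightarrow> 'a"
    have coord: "((\<lambda>y. y i) \<longlongrightarrow> x i) (at x)" for i
      using continuous_on_product_coordinates[of i] by (auto simp: continuous_on_def)
    have "((\<lambda>y. (\<Sum>i\<in>I. norm (y i - x i)) * C) \<longlongrightarrow> (\<Sum>i\<in>I. norm (x i - x i)) * C) (at x)"
      by (intro tendsto_intros coord)
    then have "((\<lambda>y. (\<Sum>i\<in>I. norm (y i - x i)) * C) \<longlongrightarrow> 0) (at x)" by simp
    then have "((\<lambda>y. G y - G x) \<longlongrightarrow> 0) (at x)"
      by (rule Lim_null_comparison[rotated]) (use assms in auto)
    then show "(G \<longlongrightarrow> G x) (at x within UNIV)"
      by (rule LIM_zero_cancel)
  qed
  then have "G \<in> borel_measurable borel" by (rule borel_measurable_continuous_onI)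
  then show ?thesis
    using measurable_cong_sets[OF sets_PiM_equal_borel refl] by blast
qed

text \<open>From \<open>a \<le> \<sigma> + sqrt 2 * \<tau>\<close> one gets \<open>sqrt 2 * a \<le>
  2 * \<sigma> * (1 / sqrt 2 + \<tau> / \<sigma>)\<close>, the extra factor of
  \<open>C_const\<close> apart from \<open>sqrt d\<close>. The \<open>sqrt 2\<close> on the left
  pays for the factor 2 in the second moment bound.\<close>

lemma W1_constant_bound:
  assumes \<sigma>: "\<sigma> > 0" and \<tau>: "\<tau> > 0" and a: "a > 0" "a\<^sup>2 = 2 * \<tau>\<^sup>2 + \<sigma>\<^sup>2"
  shows "sqrt (2 * real d * a\<^sup>2 * (a / \<sigma>) ^ d) \<le> C_const d \<tau> \<sigma> / sqrt 2"
proof -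
  have "a\<^sup>2 \<le> (\<sigma> + sqrt 2 * \<tau>)\<^sup>2"
    unfolding a(2) using \<sigma> \<tau> by (simp add: power2_sum power_mult_distrib)
  then have "a \<le> \<sigma> + sqrt 2 * \<tau>"
    using \<sigma> \<tau> by (intro power2_le_imp_le[of a]) auto
  then have "sqrt 2 * a \<le> sqrt 2 * (\<sigma> + sqrt 2 * \<tau>)" by simp
  also have "\<dots> = 2 * \<sigma> * (1 / sqrt 2 + \<tau> / \<sigma>)"
    using \<sigma> by (simp add: distrib_left real_div_sqrt field_simps)
  finally have le: "sqrt 2 * a \<le> 2 * \<sigma> * (1 / sqrt 2 + \<tau> / \<sigma>)" .
  have "sqrt (2 * real d * a\<^sup>2 * (a / \<sigma>) ^ d) = sqrt (real d) * (sqrt 2 * a) * sqrt ((a / \<sigma>) ^ d)"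
    using a(1) by (simp add: real_sqrt_mult)
  also have "\<dots> \<le> sqrt (real d) * (2 * \<sigma> * (1 / sqrt 2 + \<tau> / \<sigma>)) * (c_const d \<tau> \<sigma> / sqrt 2)"
    using a \<sigma> \<tau> by (intro mult_mono mult_left_mono le sqrt_ratio_le_c_const mult_nonneg_nonneg add_nonneg_nonneg) auto
  also have "\<dots> = C_const d \<tau> \<sigma> / sqrt 2"
    using \<sigma> by (simp add: C_const_def real_sqrt_mult)
  finally show ?thesis .
qed

text \<open>The transport inequality enters twice: through Lipschitz functions it gives the
  concentration, and through the sub-Gaussianity of \<open>P\<close> that it implies it gives the
  mean bound.\<close>

lemma W1_time_uniform:
  fixes P :: "(real ^ 'd) measure" and M :: "'w measure" and l :: "real \<Rightarrow> real"
  assumes M: "prob_space M"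
    and indep: "prob_space.indep_vars M (\<lambda>_. borel) X {1..}"
    and law: "\<And>i. i \<ge> 1 \<Longrightarrow> distr M borel (X i) = P"
    and T1: "T1 P (\<tau>\<^sup>2)" and \<sigma>: "\<sigma> > 0" and \<tau>: "\<tau> > 0"
  shows "t \<ge> 1 \<Longrightarrow> W1_smooth \<sigma> (empirical x t) P < \<infinity>"
    and "t \<ge> 1 \<Longrightarrow> sub_gaussian M (\<lambda>\<omega>. enn2real (W1_smooth \<sigma> (empirical (\<lambda>i. X i \<omega>) t) P)) (\<tau>\<^sup>2 / real t)"
    and "\<lbrakk>0 < \<delta>; \<delta> < 1; \<And>x. x \<ge> 0 \<Longrightarrow> l x \<ge> 1;
      summable (\<lambda>j. 1 / l (real (Suc j))); (\<Sum>j. 1 / l (real (Suc j))) \<le> 1;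
      \<And>x. x \<in> {0..1} \<Longrightarrow> l x = l 1;
      \<And>u v. 1 \<le> u \<Longrightarrow> u \<le> v \<Longrightarrow> 2 powr (- v) * ln (l v) \<le> 2 powr (- u) * ln (l u)\<rbrakk> \<Longrightarrow>
      (let E = {\<omega> \<in> space M. \<exists>t\<ge>1. W1_smooth \<sigma> (empirical (\<lambda>i. X i \<omega>) t) P
          \<ge> ennreal (C_const CARD('d) \<tau> \<sigma> / sqrt (real t)
              + 2 * sqrt (\<tau>\<^sup>2 / real t * (ln (l (log 2 (real t))) + ln (1 / \<delta>))))}
       in E \<in> sets M \<and> measure M E \<le> \<delta>)"
proof -
  interpret M: prob_space M by fact
  have PP1: "P \<in> P1" using T1 by (simp add: T1_def)
  then have P: "prob_space P" and setsP: "sets P = sets borel" by (auto simp: P1_def)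
  have v: "\<tau>\<^sup>2 > 0" using \<tau> by simp
  have sub: "sub_gaussian P (\<lambda>x. x) (\<tau>\<^sup>2)" by (rule T1_imp_sub_gaussian[OF T1 v])
  show fin: "W1_smooth \<sigma> (empirical x t) P < \<infinity>" if "t \<ge> 1" for t x
    using that by (intro W1_smooth_finite[OF \<sigma>] empirical_in_P1 PP1)
  \<comment> \<open>There is no sample at \<open>t = 0\<close>; the value 0 keeps the Lipschitz
    bound, and with it measurability, valid for every \<open>t\<close>.\<close>
  define G where "G t x = (if t = 0 then 0 else enn2real (W1_smooth \<sigma> (empirical x t) P))" for t x
  have G0: "G t x \<ge> 0" for t x by (simp add: G_def)
  have eG: "ennreal (G t x) = W1_smooth \<sigma> (empirical x t) P" if "t \<ge> 1" for t x
    using fin[OF that, of x] that by (simp add: G_def)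
  have lip1: "G t y \<le> G t x + (\<Sum>i=1..t. norm (y i - x i)) / real t" if "t \<ge> 1" for t x y
  proof -
    have "ennreal (G t y) \<le> ennreal (G t x + (\<Sum>i=1..t. norm (y i - x i)) / real t)"
      using W1_smooth_empirical_lipschitz[OF \<sigma> P setsP that, of y x] G0
      by (simp add: eG[OF that] ennreal_plus sum_nonneg)
    then show ?thesis using G0[of t x] by (subst (asm) ennreal_le_iff) (auto intro!: add_nonneg_nonneg divide_nonneg_nonneg sum_nonneg)
  qed
  have lip: "\<bar>G t y - G t x\<bar> \<le> (\<Sum>i=1..t. norm (y i - x i)) * (1 / real t)" for t x y
  proof (cases "t = 0")
    case False
    then show ?thesis
      using lip1[of t y x] lip1[of t x y] by (simp add: norm_minus_commute abs_le_iff)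
  qed (simp add: G_def)
  have meas: "G t \<in> borel_measurable (Pi\<^sub>M UNIV (\<lambda>_. borel))" for t
    by (rule borel_measurable_PiM_lipschitz[OF lip])
  have loc: "G t x = G t y" if "\<And>i. i \<in> {1..t} \<Longrightarrow> x i = y i" for t x y
    unfolding G_def using empirical_cong[OF that] by simp
  have sym: "G s (x \<circ> swap i t) = G s x" if "i \<in> {1..t}" "t \<le> s" for s t i x
    unfolding G_def by (simp add: empirical_comp_swap[OF that])
  have loo: "G t x \<le> (\<Sum>i=1..t. G (t - 1) (x \<circ> swap i t)) / real t" if t: "2 \<le> t" for t x
  proof -
    have t1: "t \<ge> 1" "t - 1 \<ge> 1" using t by auto
    have "ennreal (G t x) \<le> (\<Sum>i=1..t. ennreal (G (t - 1) (x \<circ> swap i t))) / of_nat t"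
      unfolding eG[OF t1(1)] eG[OF t1(2)] by (rule W1_smooth_leave_one_out[OF \<sigma> t])
    also have "\<dots> = ennreal ((\<Sum>i=1..t. G (t - 1) (x \<circ> swap i t)) / real t)"
      unfolding sum_ennreal[OF G0] ennreal_of_nat_eq_real_of_nat
      using t by (intro divide_ennreal sum_nonneg G0) auto
    finally show ?thesis
      by (subst (asm) ennreal_le_iff) (auto intro!: divide_nonneg_nonneg sum_nonneg G0)
  qed
  have sg: "sub_gaussian M (\<lambda>\<omega>. G t (\<lambda>i. X i \<omega>)) (\<tau>\<^sup>2 / real t)" if t: "1 \<le> t" for t
  proof -
    have "sub_gaussian M (\<lambda>\<omega>. G t (\<lambda>i. X i \<omega>)) (real t * ((1 / real t)\<^sup>2 * \<tau>\<^sup>2))"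
    \<comment> \<open>Each coordinate enters with Lipschitz constant \<open>1 / t\<close>, hence
      with proxy \<open>\<tau>\<^sup>2 / t\<^sup>2\<close>; summing over \<open>t\<close>
      coordinates gives \<open>\<tau>\<^sup>2 / t\<close>.\<close>
    proof (rule sub_gaussian_iid[OF M indep law _ meas loc _ t, where c = "\<lambda>y y'. 1 / real t * norm (y - y')"])
      show "sub_gaussian P f ((1 / real t)\<^sup>2 * \<tau>\<^sup>2)"
        if "f \<in> borel_measurable P" "\<And>y y'. \<bar>f y - f y'\<bar> \<le> 1 / real t * norm (y - y')" for f
        using that t by (intro T1_sub_gaussian_lipschitz[OF T1 v]) auto
      fix x :: "nat \<Rightarrow> real ^ 'd" and i y y' assume i: "i \<in> {1..t}"
      have "(\<Sum>k=1..t. norm ((x(i := y)) k - (x(i := y')) k)) = (\<Sum>k=1..t. if k = i then norm (y - y') else 0)"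
        by (intro sum.cong) auto
      also have "\<dots> = norm (y - y')" using i by simp
      finally show "\<bar>G t (x(i := y)) - G t (x(i := y'))\<bar> \<le> 1 / real t * norm (y - y')"
        using lip[of t "x(i := y)" "x(i := y')"] by (simp only: mult.commute)
    qed
    also have "real t * ((1 / real t)\<^sup>2 * \<tau>\<^sup>2) = \<tau>\<^sup>2 / real t"
      using t by (simp add: power2_eq_square)
    finally show ?thesis .
  qed
  show "sub_gaussian M (\<lambda>\<omega>. enn2real (W1_smooth \<sigma> (empirical (\<lambda>i. X i \<omega>) t) P)) (\<tau>\<^sup>2 / real t)" if "t \<ge> 1"
    using sg[OF that] that by (simp add: G_def)
  define a where "a = sqrt (2 * \<tau>\<^sup>2 + \<sigma>\<^sup>2)"
  have pos: "2 * \<tau>\<^sup>2 + \<sigma>\<^sup>2 > 0" using \<sigma> \<tau> by (simp add: add_pos_pos)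
  have a: "a > 0" "a\<^sup>2 = 2 * \<tau>\<^sup>2 + \<sigma>\<^sup>2"
    using pos by (simp_all add: a_def)
  let ?A = "2 * real CARD('d) * a\<^sup>2"
  have mean: "(LINT \<omega>|M. G t (\<lambda>i. X i \<omega>)) \<le> C_const CARD('d) \<tau> \<sigma> / sqrt (2 * real t)" if t: "1 \<le> t" for t
  proof -
    \<comment> \<open>The excess mass is routed through the mean of \<open>P\<close>, which is also
      the centre of the reference Gaussian. The weight \<open>norm (z - ?m)\<close> then contributes
      its centred second moment \<open>?A\<close>.\<close>
    let ?m = "LINT x|P. x"
    have "ennreal (LINT \<omega>|M. G t (\<lambda>i. X i \<omega>)) = (\<integral>\<^sup>+\<omega>. ennreal (G t (\<lambda>i. X i \<omega>)) \<partial>M)"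
      using sg[OF t] G0 by (intro nn_integral_eq_integral[symmetric]) (auto simp: sub_gaussian_def)
    also have "\<dots> \<le> (\<integral>\<^sup>+\<omega>. \<integral>\<^sup>+z. ennreal (norm (z - ?m) * \<bar>(\<Sum>i=1..t. gauss_dens \<sigma> (z - X i \<omega>)) / real t
        - (LINT x|P. gauss_dens \<sigma> (z - x))\<bar>) \<partial>lborel \<partial>M)"
    proof (rule nn_integral_mono)
      fix \<omega>
      show "ennreal (G t (\<lambda>i. X i \<omega>)) \<le> (\<integral>\<^sup>+z. ennreal (norm (z - ?m) * \<bar>(\<Sum>i=1..t. gauss_dens \<sigma> (z - X i \<omega>)) / real t
        - (LINT x|P. gauss_dens \<sigma> (z - x))\<bar>) \<partial>lborel)"
        using W1_smooth_le[OF \<sigma> prob_space_empirical[OF t] sets_empirical P setsP, of "\<lambda>i. X i \<omega>" ?m]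
        unfolding eG[OF t] smooth_dens_empirical[OF t] smooth_dens_def[of \<sigma> P] .
    qed
    also have "\<dots> \<le> ennreal (sqrt (?A * (a / \<sigma>) ^ CARD('d) / real t))"
    proof (rule nn_integral_weighted_density_deviation[OF M indep law sub \<sigma> \<tau> a t])
      have "(\<integral>\<^sup>+z. ennreal ((norm (z - ?m))\<^sup>2 * gauss_dens a (z - ?m)) \<partial>lborel)
          = (\<integral>\<^sup>+z. ennreal ((norm z)\<^sup>2 * gauss_dens a (z :: real ^ 'd)) \<partial>lborel)"
        using nn_integral_lborel_shift[of "\<lambda>z. ennreal ((norm z)\<^sup>2 * gauss_dens a z)" "- ?m"] by simp
      also have "\<dots> \<le> ennreal ?A"
        by (rule nn_integral_norm_sq_gauss_dens[OF a(1)])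
      finally show "(\<integral>\<^sup>+z. ennreal ((norm (z - ?m))\<^sup>2 * gauss_dens a (z - ?m)) \<partial>lborel) \<le> ennreal ?A" .
    qed (use a(1) in auto)
    finally have "(LINT \<omega>|M. G t (\<lambda>i. X i \<omega>)) \<le> sqrt (?A * (a / \<sigma>) ^ CARD('d) / real t)"
      using a \<sigma> by (subst (asm) ennreal_le_iff) auto
    also have "\<dots> = sqrt (?A * (a / \<sigma>) ^ CARD('d)) / sqrt (real t)"
      by (simp add: real_sqrt_divide)
    also have "\<dots> \<le> (C_const CARD('d) \<tau> \<sigma> / sqrt 2) / sqrt (real t)"
      by (intro divide_right_mono W1_constant_bound \<sigma> \<tau> a) auto
    finally show ?thesis by (simp add: real_sqrt_mult)
  qed
  have C0: "C_const CARD('d) \<tau> \<sigma> \<ge> 0"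
    using \<sigma> \<tau> by (auto simp: C_const_def c_const_def intro!: mult_nonneg_nonneg add_nonneg_nonneg)
  assume \<delta>: "0 < \<delta>" "\<delta> < 1" and l: "\<And>x. x \<ge> 0 \<Longrightarrow> l x \<ge> 1"
      "summable (\<lambda>j. 1 / l (real (Suc j)))" "(\<Sum>j. 1 / l (real (Suc j))) \<le> 1"
      "\<And>x. x \<in> {0..1} \<Longrightarrow> l x = l 1"
      "\<And>u v. 1 \<le> u \<Longrightarrow> u \<le> v \<Longrightarrow> 2 powr (- v) * ln (l v) \<le> 2 powr (- u) * ln (l u)"
  have iff: "ennreal r \<le> W1_smooth \<sigma> (empirical x t) P \<longleftrightarrow> r \<le> G t x" if "t \<ge> 1" for r t x
    unfolding eG[OF that, symmetric] by (rule ennreal_le_iff[OF G0])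
  have "{\<omega> \<in> space M. \<exists>t\<ge>1. W1_smooth \<sigma> (empirical (\<lambda>i. X i \<omega>) t) P
          \<ge> ennreal (C_const CARD('d) \<tau> \<sigma> / sqrt (real t)
              + 2 * sqrt (\<tau>\<^sup>2 / real t * (ln (l (log 2 (real t))) + ln (1 / \<delta>))))}
      = {\<omega> \<in> space M. \<exists>t\<ge>1. C_const CARD('d) \<tau> \<sigma> / sqrt (real t)
              + 2 * sqrt (\<tau>\<^sup>2 / real t * (ln (l (log 2 (real t))) + ln (1 / \<delta>))) \<le> G t (\<lambda>i. X i \<omega>)}"
    (is "?E = ?E'")
    using iff by blast
  moreover have "?E' \<in> sets M" "measure M ?E' \<le> \<delta>"
    by (rule stitched_bound[OF M indep law meas loc sym loo sg mean v C0 \<delta> l]; assumption)+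
  ultimately show "let E = ?E in E \<in> sets M \<and> measure M E \<le> \<delta>"
    unfolding Let_def by (simp only: simp_thms)
qed

theorem proposition8:
  fixes P :: "(real ^ 'd) measure"
    and M :: "'w measure"
    and X :: "nat \<Rightarrow> 'w \<Rightarrow> real ^ 'd"
    and l :: "real \<Rightarrow> real"
    and \<delta> \<sigma> \<tau> :: real
  assumes \<delta>: "0 < \<delta>" "\<delta> < 1"
    and \<sigma>: "\<sigma> > 0"
    and \<tau>: "\<tau> > 0"
    and P: "prob_space P" "sets P = sets borel"
    and M: "prob_space M"
    and indep: "prob_space.indep_vars M (\<lambda>_. borel) X {1..}"
    and law: "\<And>i. i \<ge> 1 \<Longrightarrow> distr M borel (X i) = P"
    and l_ge1: "\<And>x. x \<ge> 0 \<Longrightarrow> l x \<ge> 1"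
    and l_sum: "summable (\<lambda>j. 1 / l (real (Suc j)))" "(\<Sum>j. 1 / l (real (Suc j))) \<le> 1"
    and l_const: "\<And>x. x \<in> {0..1} \<Longrightarrow> l x = l 1"
    and l_decr: "\<And>u v. 1 \<le> u \<Longrightarrow> u \<le> v \<Longrightarrow> 2 powr (- v) * ln (l v) \<le> 2 powr (- u) * ln (l u)"
  shows
    "(sub_gaussian P (\<lambda>x. x) (\<tau>\<^sup>2) \<longrightarrow>
       (let E = {\<omega> \<in> space M. \<exists>t\<ge>1.
                  tv_smooth \<sigma> (empirical (\<lambda>i. X i \<omega>) t) P
                    \<ge> c_const CARD('d) \<tau> \<sigma> / sqrt (real t)
                      + 4 * sqrt (2 / real t * (ln (l (log 2 (real t))) + ln (1 / \<delta>)))}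
        in E \<in> sets M \<and> measure M E \<le> \<delta>))
   \<and> (T1 P (\<tau>\<^sup>2) \<longrightarrow>
       ((\<forall>t\<ge>1.
          (\<forall>\<omega>\<in>space M. W1_smooth \<sigma> (empirical (\<lambda>i. X i \<omega>) t) P < \<infinity>) \<and>
          sub_gaussian M (\<lambda>\<omega>. enn2real (W1_smooth \<sigma> (empirical (\<lambda>i. X i \<omega>) t) P)) (\<tau>\<^sup>2 / real t)))
     \<and> (\<forall>\<delta>'. 0 < \<delta>' \<and> \<delta>' < 1 \<longrightarrow>
          (let E = {\<omega> \<in> space M. \<exists>t\<ge>1.
                     W1_smooth \<sigma> (empirical (\<lambda>i. X i \<omega>) t) P
                       \<ge> ennreal (C_const CARD('d) \<tau> \<sigma> / sqrt (real t)
                           + 2 * sqrt (\<tau>\<^sup>2 / real t * (ln (l (log 2 (real t))) + ln (1 / \<delta>'))))}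
           in E \<in> sets M \<and> measure M E \<le> \<delta>')))"
proof (intro conjI impI)
  assume sub: "sub_gaussian P (\<lambda>x. x) (\<tau>\<^sup>2)"
  show "let E = {\<omega> \<in> space M. \<exists>t\<ge>1. tv_smooth \<sigma> (empirical (\<lambda>i. X i \<omega>) t) P
                    \<ge> c_const CARD('d) \<tau> \<sigma> / sqrt (real t)
                      + 4 * sqrt (2 / real t * (ln (l (log 2 (real t))) + ln (1 / \<delta>)))}
        in E \<in> sets M \<and> measure M E \<le> \<delta>"
    unfolding Let_def
    by (intro conjI tv_time_uniform[OF M indep law sub \<sigma> \<tau> \<delta> l_ge1 l_sum l_const l_decr]; assumption)
next
  assume "T1 P (\<tau>\<^sup>2)"
  note W = W1_time_uniform[OF M indep law this \<sigma> \<tau>]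
  show "\<forall>t\<ge>1. (\<forall>\<omega>\<in>space M. W1_smooth \<sigma> (empirical (\<lambda>i. X i \<omega>) t) P < \<infinity>) \<and>
          sub_gaussian M (\<lambda>\<omega>. enn2real (W1_smooth \<sigma> (empirical (\<lambda>i. X i \<omega>) t) P)) (\<tau>\<^sup>2 / real t)"
    by (intro allI impI conjI ballI W(1,2); assumption)
  show "\<forall>\<delta>'. 0 < \<delta>' \<and> \<delta>' < 1 \<longrightarrow>
          (let E = {\<omega> \<in> space M. \<exists>t\<ge>1.
                     W1_smooth \<sigma> (empirical (\<lambda>i. X i \<omega>) t) P
                       \<ge> ennreal (C_const CARD('d) \<tau> \<sigma> / sqrt (real t)
                           + 2 * sqrt (\<tau>\<^sup>2 / real t * (ln (l (log 2 (real t))) + ln (1 / \<delta>'))))}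
           in E \<in> sets M \<and> measure M E \<le> \<delta>')"
    by (intro allI impI, elim conjE, rule W(3)[where l = l])
       (assumption | rule l_ge1 l_sum l_const l_decr)+
qed

end
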